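(* Let $\omega(x)=|x|^{\gamma}$, $v(x)=|x|^{\beta}$, and $\omega_i(x)=|x|^{\gamma_i}$, $v_i(x)=|x|^{\beta_i}$ for $i=1,\dots,m$, where $\beta,\gamma,\beta_i,\gamma_i>-n$. Let $1\le p,q<\infty$ and $1\le p_i,q_i<\infty$ with $\sum_{i=1}^m\frac1{p_i}=\frac1p$ and $\sum_{i=1}^m\frac1{q_i}=\frac1q$. Let $\lambda_i>0$ and $\alpha_i\in\mathbb{R}$ for $i=1,\dots,m$, and $\lambda,\alpha\in\mathbb{R}$, be such that $$\sum_{i=1}^m\Big(1+\frac{\beta_i}{n}\Big)\lambda_i=\Big(1+\frac{\beta}{n}\Big)\lambda,\qquad \sum_{i=1}^m \frac{\gamma_i}{q_i}=\frac{\gamma}{q},\qquad \sum_{i=1}^m \Big(1+\frac{\beta_i}{n}\Big)\alpha_i=\Big(1+\frac{\beta}{n}\Big)\alpha .$$ Let $\Phi$ and $A_1,\dots,A_m$ be as in the context; in particular $$\rho_{\vec A}:=\operatorname*{ess\,sup}_{t\in\mathbb{R}^n,\ i=1,\dots,m}\|A_i(t)\|\,\|A_i^{-1}(t)\|<\infty .$$ Put $$\mathcal{C}_{3}=\int_{\mathbb{R}^n}\frac{|\Phi(y)|}{|y|^n}\prod_{i=1}^m\|A^{-1}_i(y)\|^{\left(1+\frac{\beta_i}{n}\right)(\alpha_i-\lambda_i)+\frac{n+\gamma_i}{q_i}}\,dy .$$ (i) If $\mathcal{C}_3<\infty$, then $\mathcal{H}_{\Phi,\vec{A}}$ is bounded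 from $\prod_{i=1}^m M\dot{K}^{\alpha_i,\lambda_i,p_i,q_i}_{v_i,\omega_i}(\mathbb{R}^n)$ to $M\dot{K}^{\alpha,\lambda,p,q}_{v,\omega}(\mathbb{R}^n)$, and $$\|\mathcal{H}_{\Phi,\vec{A}}\|_{\prod_{i=1}^m M\dot{K}^{\alpha_i,\lambda_i,p_i,q_i}_{v_i,\omega_i}(\mathbb{R}^n)\to M\dot{K}^{\alpha,\lambda,p,q}_{v,\omega}(\mathbb{R}^n)}\lesssim\mathcal{C}_3 .$$ (ii) Conversely, suppose $\Phi$ is a real function with a constant sign in $\mathbb{R}^n$. If $\mathcal{H}_{\Phi,\vec{A}}$ is bounded from $\prod_{i=1}^m M\dot{K}^{\alpha_i,\lambda_i,p_i,q_i}_{v_i,\omega_i}(\mathbb{R}^n)$ to $M\dot{K}^{\alpha,\lambda,p,q}_{v,\omega}(\mathbb{R}^n)$, then $\mathcal{C}_3<\infty$, and $$\|\mathcal{H}_{\Phi,\vec{A}}\|_{\prod_{i=1}^m M\dot{K}^{\alpha_i,\lambda_i,p_i,q_i}_{v_i,\omega_i}(\mathbb{R}^n)\to M\dot{K}^{\alpha,\lambda,p,q}_{v,\omega}(\mathbb{R}^n)}\gtrsim\mathcal{C}_3 .$$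
   Context: $n,m\ge 1$ are integers. $\Phi$ is a locally integrable function on $\mathbb{R}^n$; $A_1,\dots,A_m$ are measurable functions on $\mathbb{R}^n$ with values in the $n\times n$ real matrices, invertible almost everywhere. For a matrix $A=(a_{ij})$, $\|A\|=\big(\sum_{i,j=1}^n|a_{ij}|^2\big)^{1/2}$, and $A_i^{-1}(y)$ denotes the inverse of $A_i(y)$. The multilinear Hausdorff operator is, for $\vec f=(f_1,\dots,f_m)$ with $f_i$ complex-valued measurable functions on $\mathbb{R}^n$, $$\mathcal{H}_{\Phi,\vec{A}}(\vec{f})(x)=\int_{\mathbb{R}^n}\frac{\Phi(y)}{|y|^n}\prod_{i=1}^m f_i(A_i(y)x)\,dy,\qquad x\in\mathbb{R}^n.$$ For $k\in\mathbb{Z}$ let $B_k=\{x\in\mathbb{R}^n:|x|\le 2^k\}$, $C_k=B_k\setminus B_{k-1}$, $\chi_k=\chi_{C_k}$ (characteristic function). For a weight $v$ (nonnegative locally integrable function), $v(E)=\int_E v(x)\,dx$, and $\|f\|_{L^q_\omega(\mathbb{R}^n)}=\big(\int_{\mathbb{R}^n}|f|^q\omega\,dx\big)^{1/q}$. Two weighted Morrey-Herz space: for weights $v,\omega$, $\alpha\in\mathbb{R}$, $0<p<\infty$, $1\le q<\infty$, $\lambda\ge0$, $M\dot{K}^{\alpha,\lambda,p,q}_{v,\omega}(\mathbb{R}^n)$ is the set of measurable $f$ with $\int_K|f|^q\omega\,dx<\infty$ for all compact $K\subset\mathbb{R}^n\setminus\{0\}$ and $$\|f\|_{M\dot{K}^{\alpha,\lambda,p,q}_{v,\omega}(\mathbb{R}^n)}=\sup_{k_0\in\mathbb{Z}}\Big(v(B_{k_0})^{-\frac{\lambda}{n}}\Big(\sum_{k=-\infty}^{k_0}v(B_k)^{\frac{\alpha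 p}{n}}\|f\chi_k\|^p_{L^q_\omega(\mathbb{R}^n)}\Big)^{1/p}\Big)<\infty .$$ Boundedness of an $m$-linear operator $T$ from $\prod X_i$ to $Y$ means $\|T(\vec f)\|_Y\le C\prod_i\|f_i\|_{X_i}$ for all $f_i\in X_i$, with $T(\vec f)$ well defined almost everywhere; the operator norm is the least such $C$. $a\lesssim b$ (equivalently $b\gtrsim a$) means $a\le Cb$ with $C>0$ independent of $\vec f$ and $\Phi$; $C$ may depend on $n$, $m$, the exponents and $\rho_{\vec A}$. *)

theory Defs
  imports "HOL-Analysis.Analysis" "HOL-Probability.Essential_Supremum"
begin

text \<open>Euclidean n-space is \<^typ>\<open>real ^ 'n\<close> with n = \<^term>\<open>CARD('n)\<close>; functions and weights are measurable
  with respect to \<^const>\<open>lebesgue\<close> (the completed Lebesgue measure). Families indexed by 1, ..., m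
  are functions on \<^typ>\<open>nat\<close>, of which only the values on \<open>{1..m}\<close> matter.

  The norm of \<^typ>\<open>real ^ 'n ^ 'n\<close> that the library provides is the Frobenius norm:\<close>

lemma norm_matrix_eq_frobenius:
  fixes A :: "real ^ 'n ^ 'n"
  shows "norm A = sqrt (\<Sum>i\<in>UNIV. \<Sum>j\<in>UNIV. \<bar>A $ i $ j\<bar>\<^sup>2)"
  by (simp add: norm_vec_def L2_set_def sum_nonneg)

definition locally_integrable :: "(real ^ 'n \<Rightarrow> complex) \<Rightarrow> bool" where
  "locally_integrable f \<longleftrightarrow> (\<forall>K. compact K \<longrightarrow> set_integrable lebesgue K f)"

text \<open>Real powers on \<open>[0, \<infinity>]\<close>; only used with positive exponents.\<close>

definition epowr :: "ennreal \<Rightarrow> real \<Rightarrow> ennreal" where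
  "epowr x a = (if x = \<infinity> then \<infinity> else ennreal (enn2real x powr a))"

text \<open>\<open>|x|\<^sup>\<gamma>\<close>. With \<open>powr\<close> the value at \<open>x = 0\<close> is 0 for every exponent; this affects a null set only.\<close>

definition power_weight :: "real \<Rightarrow> real ^ 'n \<Rightarrow> real" where
  "power_weight \<gamma> x = norm x powr \<gamma>"

definition weight_measure :: "(real ^ 'n \<Rightarrow> real) \<Rightarrow> (real ^ 'n) set \<Rightarrow> real" where
  "weight_measure v E = (LINT x:E|lebesgue. v x)"

definition dyadic_ball :: "int \<Rightarrow> (real ^ 'n) set" where
  "dyadic_ball k = {x. norm x \<le> 2 powi k}"

definition dyadic_shell :: "int \<Rightarrow> (real ^ 'n) set" where
  "dyadic_shell k = dyadic_ball k - dyadic_ball (k - 1)"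

definition Lq_norm :: "real \<Rightarrow> (real ^ 'n \<Rightarrow> real) \<Rightarrow> (real ^ 'n \<Rightarrow> complex) \<Rightarrow> ennreal" where
  "Lq_norm q \<omega> f = epowr (\<integral>\<^sup>+x. ennreal (norm (f x) powr q * \<omega> x) \<partial>lebesgue) (1 / q)"

text \<open>A function space is given by its set of elements and its norm.\<close>

type_synonym 'a fspace = "('a \<Rightarrow> complex) set \<times> (('a \<Rightarrow> complex) \<Rightarrow> ennreal)"

text \<open>The parameter usually called lambda is written \<open>\<mu>\<close>, since \<open>\<lambda>\<close> is not available as a variable.\<close>

definition MK_norm ::
  "real \<Rightarrow> real \<Rightarrow> real \<Rightarrow> real \<Rightarrow> (real ^ 'n \<Rightarrow> real) \<Rightarrow> (real ^ 'n \<Rightarrow> real) \<Rightarrow> (real ^ 'n \<Rightarrow> complex) \<Rightarrow> ennreal" where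
  "MK_norm \<alpha> \<mu> p q v \<omega> f =
    (SUP k0::int.
       ennreal (weight_measure v (dyadic_ball k0) powr (- \<mu> / real CARD('n))) *
       epowr (\<Sum>\<^sub>\<infinity>k\<in>{..k0}.
          ennreal (weight_measure v (dyadic_ball k) powr (\<alpha> * p / real CARD('n))) *
          epowr (Lq_norm q \<omega> (\<lambda>x. f x * indicator (dyadic_shell k) x)) p) (1 / p))"

definition MK_space ::
  "real \<Rightarrow> real \<Rightarrow> real \<Rightarrow> real \<Rightarrow> (real ^ 'n \<Rightarrow> real) \<Rightarrow> (real ^ 'n \<Rightarrow> real) \<Rightarrow> (real ^ 'n) fspace" where
  "MK_space \<alpha> \<mu> p q v \<omega> =
    ({f. f \<in> borel_measurable lebesgue \<and>
         (\<forall>K. compact K \<and> 0 \<notin> K \<longrightarrow> (\<integral>\<^sup>+x\<in>K. ennreal (norm (f x) powr q * \<omega> x) \<partial>lebesgue) < \<infinity>) \<and>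
         MK_norm \<alpha> \<mu> p q v \<omega> f < \<infinity>},
     MK_norm \<alpha> \<mu> p q v \<omega>)"

definition hausdorff_integrand ::
  "nat \<Rightarrow> (real ^ 'n \<Rightarrow> complex) \<Rightarrow> (nat \<Rightarrow> real ^ 'n \<Rightarrow> real ^ 'n ^ 'n) \<Rightarrow>
   (nat \<Rightarrow> real ^ 'n \<Rightarrow> complex) \<Rightarrow> real ^ 'n \<Rightarrow> real ^ 'n \<Rightarrow> complex" where
  "hausdorff_integrand m \<Phi> A f x y =
    \<Phi> y / complex_of_real (norm y ^ CARD('n)) * (\<Prod>i\<in>{1..m}. f i (A i y *v x))"

definition hausdorff_op ::
  "nat \<Rightarrow> (real ^ 'n \<Rightarrow> complex) \<Rightarrow> (nat \<Rightarrow> real ^ 'n \<Rightarrow> real ^ 'n ^ 'n) \<Rightarrow>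
   (nat \<Rightarrow> real ^ 'n \<Rightarrow> complex) \<Rightarrow> real ^ 'n \<Rightarrow> complex" where
  "hausdorff_op m \<Phi> A f x = (LINT y|lebesgue. hausdorff_integrand m \<Phi> A f x y)"

text \<open>The Bochner integral is total (0 for non-integrable functions), so the points at which
  the operator is well defined are described separately.\<close>

definition hausdorff_defined ::
  "nat \<Rightarrow> (real ^ 'n \<Rightarrow> complex) \<Rightarrow> (nat \<Rightarrow> real ^ 'n \<Rightarrow> real ^ 'n ^ 'n) \<Rightarrow>
   (nat \<Rightarrow> real ^ 'n \<Rightarrow> complex) \<Rightarrow> real ^ 'n \<Rightarrow> bool" where
  "hausdorff_defined m \<Phi> A f x \<longleftrightarrow> integrable lebesgue (hausdorff_integrand m \<Phi> A f x)"

text \<open>The constants \<open>C\<close> in \<open>\<parallel>T f\<parallel>\<^sub>Y \<le> C \<Prod>i. \<parallel>f i\<parallel>\<^sub>X\<^sub>i\<close>, for an m-linear operator \<open>T\<close>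
  whose value \<open>T f x\<close> is meaningful where \<open>D f x\<close> holds.\<close>

definition bound_constants ::
  "nat \<Rightarrow> (nat \<Rightarrow> (real ^ 'n) fspace) \<Rightarrow> (real ^ 'n) fspace \<Rightarrow>
   ((nat \<Rightarrow> real ^ 'n \<Rightarrow> complex) \<Rightarrow> real ^ 'n \<Rightarrow> bool) \<Rightarrow>
   ((nat \<Rightarrow> real ^ 'n \<Rightarrow> complex) \<Rightarrow> real ^ 'n \<Rightarrow> complex) \<Rightarrow> real set" where
  "bound_constants m X Y D T =
    {C. 0 \<le> C \<and>
        (\<forall>f. (\<forall>i\<in>{1..m}. f i \<in> fst (X i)) \<longrightarrow>
             (AE x in lebesgue. D f x) \<and> T f \<in> fst Y \<and>
             snd Y (T f) \<le> ennreal C * (\<Prod>i\<in>{1..m}. snd (X i) (f i)))}"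

definition hausdorff_bounded ::
  "nat \<Rightarrow> (nat \<Rightarrow> (real ^ 'n) fspace) \<Rightarrow> (real ^ 'n) fspace \<Rightarrow>
   (real ^ 'n \<Rightarrow> complex) \<Rightarrow> (nat \<Rightarrow> real ^ 'n \<Rightarrow> real ^ 'n ^ 'n) \<Rightarrow> bool" where
  "hausdorff_bounded m X Y \<Phi> A \<longleftrightarrow>
    bound_constants m X Y (hausdorff_defined m \<Phi> A) (hausdorff_op m \<Phi> A) \<noteq> {}"

text \<open>The operator norm; it is \<open>\<infinity>\<close> if the operator is not bounded.\<close>

definition hausdorff_norm ::
  "nat \<Rightarrow> (nat \<Rightarrow> (real ^ 'n) fspace) \<Rightarrow> (real ^ 'n) fspace \<Rightarrow>
   (real ^ 'n \<Rightarrow> complex) \<Rightarrow> (nat \<Rightarrow> real ^ 'n \<Rightarrow> real ^ 'n ^ 'n) \<Rightarrow> ennreal" where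
  "hausdorff_norm m X Y \<Phi> A =
    Inf (ennreal ` bound_constants m X Y (hausdorff_defined m \<Phi> A) (hausdorff_op m \<Phi> A))"

definition hausdorff_data ::
  "nat \<Rightarrow> (real ^ 'n \<Rightarrow> complex) \<Rightarrow> (nat \<Rightarrow> real ^ 'n \<Rightarrow> real ^ 'n ^ 'n) \<Rightarrow> bool" where
  "hausdorff_data m \<Phi> A \<longleftrightarrow>
    locally_integrable \<Phi> \<and>
    (\<forall>i\<in>{1..m}. A i \<in> borel_measurable lebesgue \<and> (AE y in lebesgue. invertible (A i y)))"

definition ess_rho :: "nat \<Rightarrow> (nat \<Rightarrow> real ^ 'n \<Rightarrow> real ^ 'n ^ 'n) \<Rightarrow> ereal" where
  "ess_rho m A =
    esssup lebesgue (\<lambda>t. SUP i\<in>{1..m}. ereal (norm (A i t) * norm (matrix_inv (A i t))))"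

definition C3_const ::
  "nat \<Rightarrow> (nat \<Rightarrow> real) \<Rightarrow> (nat \<Rightarrow> real) \<Rightarrow> (nat \<Rightarrow> real) \<Rightarrow> (nat \<Rightarrow> real) \<Rightarrow> (nat \<Rightarrow> real) \<Rightarrow>
   (real ^ 'n \<Rightarrow> complex) \<Rightarrow> (nat \<Rightarrow> real ^ 'n \<Rightarrow> real ^ 'n ^ 'n) \<Rightarrow> ennreal" where
  "C3_const m \<alpha>s \<mu>s qs \<beta>s \<gamma>s \<Phi> A =
    (\<integral>\<^sup>+y. ennreal (norm (\<Phi> y) / norm y ^ CARD('n) *
       (\<Prod>i\<in>{1..m}. norm (matrix_inv (A i y)) powr
          ((1 + \<beta>s i / real CARD('n)) * (\<alpha>s i - \<mu>s i) + (real CARD('n) + \<gamma>s i) / qs i))) \<partial>lebesgue)"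

definition constant_sign :: "(real ^ 'n \<Rightarrow> complex) \<Rightarrow> bool" where
  "constant_sign \<Phi> \<longleftrightarrow>
    (\<forall>y. \<Phi> y \<in> \<real>) \<and> ((\<forall>y. 0 \<le> Re (\<Phi> y)) \<or> (\<forall>y. Re (\<Phi> y) \<le> 0))"

end

theory Submission
  imports Defs
begin

text \<open>
  Put \<open>a = (1 + \<beta>/n)\<alpha>\<close>, \<open>l = (1 + \<beta>/n)\<mu>\<close> and \<open>\<tau> = a + (n + \<gamma>)/q\<close>, and likewise with an index \<open>i\<close>. Since
  \<open>v(B\<^sub>k)\<close> is a constant multiple of \<open>2\<close> to the power \<open>k(n + \<beta>)\<close> and \<open>|x|\<close> is comparable to \<open>2\<close> to the
  power \<open>k\<close> on \<open>C\<^sub>k\<close>, the Morrey-Herz norm of \<open>f\<close> is equivalent to an unweighted one of the function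
  \<open>|f(x)| |x|\<^sup>\<tau>\<close>: the supremum over \<open>k\<^sub>0\<close> of \<open>2\<close> to the power \<open>- l k\<^sub>0\<close> times the \<open>\<ell>\<^sup>p\<close> norm over \<open>k \<le> k\<^sub>0\<close>
  of the \<open>L\<^sup>q\<close> norms on \<open>C\<^sub>k\<close> with respect to \<open>dx / |x|\<^sup>n\<close>. The hypotheses say that the numbers
  \<open>1/p\<^sub>i\<close>, \<open>1/q\<^sub>i\<close>, \<open>l\<^sub>i\<close>, \<open>\<tau>\<^sub>i\<close> add up to \<open>1/p\<close>, \<open>1/q\<close>, \<open>l\<close>, \<open>\<tau>\<close>. Part (i) is Minkowski's inequality in
  \<open>y\<close> followed by Hoelder's inequality, both in \<open>L\<^sup>q\<close> and in \<open>\<ell>\<^sup>p\<close>, and the behaviour of the norm under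
  \<open>x \<mapsto> A x\<close>: up to constants depending on \<open>\<rho>\<close>, the matrix \<open>A\<close> acts like the dilation by the inverse of
  \<open>b = \<parallel>inverse of A\<parallel>\<close>, which costs the factor \<open>b\<close> to the power \<open>\<tau> - l\<close>, the one in \<open>\<C>\<^sub>3\<close>. Part (ii)
  tests the operator on the powers \<open>f\<^sub>i(x) = |x|\<close> to the power \<open>l\<^sub>i - \<tau>\<^sub>i\<close>, for which \<open>|H(f)(x)|\<close> is bounded
  from below by a multiple of \<open>\<C>\<^sub>3\<close> times the power \<open>l - \<tau>\<close> of \<open>|x|\<close>; their norms are finite as \<open>l\<^sub>i > 0\<close>.
\<close>

section \<open>Hoelder and Minkowski inequalities on the extended nonnegative reals\<close>

lemma epowr_ennreal: "0 \<le> x \<Longrightarrow> epowr (ennreal x) a = ennreal (x powr a)"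
  by (simp add: epowr_def)

lemma epowr_simps [simp]:
  "epowr top a = top" "epowr 0 a = 0" "epowr 1 a = 1" "epowr x 1 = x"
  by (cases x; auto simp: epowr_def)+

lemma epowr_eq_0_iff [simp]: "epowr x a = 0 \<longleftrightarrow> x = 0"
  by (cases x) (auto simp: epowr_ennreal)

lemma epowr_eq_top_iff [simp]: "epowr x a = top \<longleftrightarrow> x = top"
  by (cases x) (auto simp: epowr_ennreal)

lemma epowr_less_top_iff [simp]: "epowr x a < top \<longleftrightarrow> x < top"
  by (cases x) (auto simp: epowr_ennreal)

lemma epowr_mult: "epowr (x * y) a = epowr x a * epowr y a"
proof (cases x; cases y)
  fix r s :: real assume "0 \<le> r" "0 \<le> s" "x = ennreal r" "y = ennreal s"
  then show ?thesis
    by (simp add: epowr_ennreal powr_mult flip: ennreal_mult)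
qed (auto simp: ennreal_mult_top ennreal_top_mult)

lemma epowr_epowr: "epowr (epowr x a) b = epowr x (a * b)"
  by (cases x) (auto simp: epowr_ennreal powr_powr)

lemma epowr_add: "epowr x (a + b) = epowr x a * epowr x b"
  by (cases x) (auto simp: epowr_ennreal powr_add ennreal_mult)

lemma epowr_prod: "epowr (\<Prod>i\<in>I. f i) a = (\<Prod>i\<in>I. epowr (f i) a)"
  by (induction I rule: infinite_finite_induct) (auto simp: epowr_mult)

lemma epowr_mono: "0 \<le> a \<Longrightarrow> x \<le> y \<Longrightarrow> epowr x a \<le> epowr y a"
  by (cases x; cases y) (auto simp: epowr_ennreal powr_mono2 ennreal_leI top_unique)

lemma epowr_inverse_cancel:
  assumes "0 < a"
  shows "epowr (epowr x a) (1 / a) = x" "epowr (epowr x (1 / a)) a = x"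
  using assms by (simp_all add: epowr_epowr)

lemma epowr_measurable [measurable (raw)]:
  assumes [measurable]: "f \<in> borel_measurable M"
  shows "(\<lambda>x. epowr (f x) a) \<in> borel_measurable M"
  unfolding epowr_def by measurable

text \<open>For positive finite \<open>z i\<close> this is convexity of \<open>exp\<close> at the
  points \<open>ln (z i)\<close>. An infinite \<open>z i\<close> makes the right side infinite
  because its weight is positive; otherwise a vanishing \<open>z i\<close> makes the left side
  zero.\<close>

lemma weighted_arith_geo_mean_ennreal:
  fixes z :: "'i \<Rightarrow> ennreal"
  assumes I: "finite I" and pos: "\<And>i. i \<in> I \<Longrightarrow> 0 < \<theta> i" and one: "sum \<theta> I = 1"
  shows "(\<Prod>i\<in>I. epowr (z i) (\<theta> i)) \<le> (\<Sum>i\<in>I. ennreal (\<theta> i) * z i)"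
proof -
  consider (inf) i where "i \<in> I" "z i = top" | (zero) i where "i \<in> I" "z i = 0"
    | (fin) "\<And>i. i \<in> I \<Longrightarrow> z i \<noteq> top \<and> z i \<noteq> 0" by metis
  then show ?thesis
  proof cases
    case inf
    have "top = ennreal (\<theta> i) * z i" using inf pos[of i] by (simp add: ennreal_mult_top)
    also have "\<dots> \<le> (\<Sum>i\<in>I. ennreal (\<theta> i) * z i)"
      by (rule member_le_sum[OF inf(1)]) (auto simp: I)
    finally show ?thesis by (simp add: top_unique)
  next
    case zero
    then have "(\<Prod>i\<in>I. epowr (z i) (\<theta> i)) = 0" using I by (intro prod_zero) auto
    then show ?thesis by (simp only: zero_le)
  next
    case fin
    define r where "r i = enn2real (z i)" for i
    have r: "z i = ennreal (r i)" "0 < r i" if "i \<in> I" for i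
      using fin[OF that] by (auto simp: r_def less_top enn2real_positive_iff zero_less_iff_neq_zero)
    have [simp]: "r i \<noteq> 0" if "i \<in> I" for i using r(2)[OF that] by simp
    have "(\<Prod>i\<in>I. r i powr \<theta> i) = exp (\<Sum>i\<in>I. \<theta> i *\<^sub>R ln (r i))"
      using I by (subst exp_sum) (auto simp: powr_def intro!: prod.cong)
    also have "\<dots> \<le> (\<Sum>i\<in>I. \<theta> i * exp (ln (r i)))"
      using one by (intro convex_on_sum[OF I _ exp_convex one]) (auto simp: pos less_imp_le)
    also have "\<dots> = (\<Sum>i\<in>I. \<theta> i * r i)"
      using r(2) by (intro sum.cong) auto
    finally have "ennreal (\<Prod>i\<in>I. r i powr \<theta> i) \<le> ennreal (\<Sum>i\<in>I. \<theta> i * r i)"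
      by (rule ennreal_leI)
    also have "ennreal (\<Prod>i\<in>I. r i powr \<theta> i) = (\<Prod>i\<in>I. epowr (z i) (\<theta> i))"
      using r by (subst prod_ennreal[symmetric]) (auto intro!: prod.cong simp: epowr_ennreal less_imp_le)
    also have "ennreal (\<Sum>i\<in>I. \<theta> i * r i) = (\<Sum>i\<in>I. ennreal (\<theta> i) * z i)"
      using r pos by (subst sum_ennreal[symmetric]) (auto intro!: sum.cong simp: ennreal_mult less_imp_le)
    finally show ?thesis .
  qed
qed

text \<open>Hoelder's inequality with exponents \<open>1 / \<theta> i\<close>. Dividing each
  \<open>F i\<close> by its integral reduces it to the arithmetic-geometric mean inequality, whose
  right side then integrates to \<open>sum \<theta> I = 1\<close>. A vanishing integral forces the
  integrand on the left to vanish almost everywhere; an infinite one, when none vanishes, makes the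
  right side infinite.\<close>

lemma nn_integral_prod_epowr_le:
  fixes F :: "'i \<Rightarrow> 'a \<Rightarrow> ennreal"
  assumes I: "finite I" and pos: "\<And>i. i \<in> I \<Longrightarrow> 0 < \<theta> i" and one: "sum \<theta> I = 1"
    and [measurable]: "\<And>i. i \<in> I \<Longrightarrow> F i \<in> borel_measurable M"
  shows "(\<integral>\<^sup>+x. (\<Prod>i\<in>I. epowr (F i x) (\<theta> i)) \<partial>M) \<le> (\<Prod>i\<in>I. epowr (\<integral>\<^sup>+x. F i x \<partial>M) (\<theta> i))"
proof -
  define J where "J i = (\<integral>\<^sup>+x. F i x \<partial>M)" for i
  consider (zero) i where "i \<in> I" "J i = 0" | (inf) i where "i \<in> I" "J i = top" "\<And>i. i \<in> I \<Longrightarrow> J i \<noteq> 0"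
    | (fin) "\<And>i. i \<in> I \<Longrightarrow> J i \<noteq> top \<and> J i \<noteq> 0" by metis
  then show ?thesis
  proof cases
    case zero
    have "AE x in M. F i x = 0"
      using zero by (auto simp: J_def nn_integral_0_iff_AE)
    then have "AE x in M. (\<Prod>i\<in>I. epowr (F i x) (\<theta> i)) = 0"
      by eventually_elim (use zero I in \<open>auto intro!: prod_zero\<close>)
    then have "(\<integral>\<^sup>+x. (\<Prod>i\<in>I. epowr (F i x) (\<theta> i)) \<partial>M) = 0"
      by (subst nn_integral_0_iff_AE) auto
    then show ?thesis by simp
  next
    case inf
    have "(\<Prod>i\<in>I. epowr (J i) (\<theta> i)) = top"
      using inf I by (subst ennreal_prod_eq_top) (auto simp: prod_zero_iff)
    then show ?thesis by (simp add: J_def)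
  next
    case fin
    define z where "z i x = F i x / J i" for i x
    have [measurable]: "z i \<in> borel_measurable M" if "i \<in> I" for i
      using that unfolding z_def by measurable
    have Fz: "F i x = J i * z i x" if "i \<in> I" for i x
      using fin[OF that] mult_divide_eq_ennreal[of "J i" "F i x"]
      by (simp add: z_def ennreal_times_divide mult.commute)
    have "(\<integral>\<^sup>+x. (\<Prod>i\<in>I. epowr (F i x) (\<theta> i)) \<partial>M)
        = (\<integral>\<^sup>+x. (\<Prod>i\<in>I. epowr (J i) (\<theta> i)) * (\<Prod>i\<in>I. epowr (z i x) (\<theta> i)) \<partial>M)"
      by (intro nn_integral_cong) (simp add: Fz epowr_mult prod.distrib cong: prod.cong)
    also have "\<dots> = (\<Prod>i\<in>I. epowr (J i) (\<theta> i)) * (\<integral>\<^sup>+x. (\<Prod>i\<in>I. epowr (z i x) (\<theta> i)) \<partial>M)"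
      by (rule nn_integral_cmult) measurable
    also have "(\<integral>\<^sup>+x. (\<Prod>i\<in>I. epowr (z i x) (\<theta> i)) \<partial>M) \<le> (\<integral>\<^sup>+x. (\<Sum>i\<in>I. ennreal (\<theta> i) * z i x) \<partial>M)"
      by (intro nn_integral_mono weighted_arith_geo_mean_ennreal I pos one)
    also have "\<dots> = (\<Sum>i\<in>I. ennreal (\<theta> i) * (\<integral>\<^sup>+x. z i x \<partial>M))"
      by (subst nn_integral_sum) (auto intro!: sum.cong nn_integral_cmult)
    also have "\<dots> = (\<Sum>i\<in>I. ennreal (\<theta> i))"
      using fin by (intro sum.cong refl)
        (auto simp: z_def nn_integral_divide ennreal_divide_self less_top simp flip: J_def)
    also have "\<dots> = 1"
      using pos one by (subst sum_ennreal) (auto simp: less_imp_le)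
    finally show ?thesis by (simp add: J_def mult_left_mono)
  qed
qed

text \<open>The L^q norm of a function with values in [0, \<infinity>]. Over a counting measure it
  is the l^p norm of a sequence, so one version of Hoelder's and of Minkowski's inequality serves
  both the functions on a shell and the sequences over the shells.\<close>

definition enorm :: "'a measure \<Rightarrow> real \<Rightarrow> ('a \<Rightarrow> ennreal) \<Rightarrow> ennreal" where
  "enorm M q G = epowr (\<integral>\<^sup>+x. epowr (G x) q \<partial>M) (1 / q)"

lemma enorm_mono_AE:
  assumes "0 < q" "AE x in M. F x \<le> G x"
  shows "enorm M q F \<le> enorm M q G"
  unfolding enorm_def using assms
  by (intro epowr_mono nn_integral_mono_AE) (auto elim!: eventually_mono intro: epowr_mono)

lemma enorm_mono: "0 < q \<Longrightarrow> (\<And>x. x \<in> space M \<Longrightarrow> F x \<le> G x) \<Longrightarrow> enorm M q F \<le> enorm M q G"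
  by (rule enorm_mono_AE) auto

lemma enorm_cmult:
  assumes "0 < q" "G \<in> borel_measurable M"
  shows "enorm M q (\<lambda>x. c * G x) = c * enorm M q G"
  using assms by (simp add: enorm_def epowr_mult nn_integral_cmult epowr_inverse_cancel)

text \<open>This is \<open>nn_integral_prod_epowr_le\<close> for the functions
  \<open>epowr (G i x) (qs i)\<close> with the weights \<open>q / qs i\<close>, which add up to
  1.\<close>

lemma enorm_prod_le:
  assumes I: "finite I" and q: "0 < q" "\<And>i. i \<in> I \<Longrightarrow> 0 < qs i" and sum: "(\<Sum>i\<in>I. 1 / qs i) = 1 / q"
    and [measurable]: "\<And>i. i \<in> I \<Longrightarrow> G i \<in> borel_measurable M"
  shows "enorm M q (\<lambda>x. \<Prod>i\<in>I. G i x) \<le> (\<Prod>i\<in>I. enorm M (qs i) (G i))"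
proof -
  have [simp]: "qs i \<noteq> 0" if "i \<in> I" for i using q(2)[OF that] by simp
  have "(\<integral>\<^sup>+x. epowr (\<Prod>i\<in>I. G i x) q \<partial>M) = (\<integral>\<^sup>+x. (\<Prod>i\<in>I. epowr (epowr (G i x) (qs i)) (q / qs i)) \<partial>M)"
    using q by (intro nn_integral_cong) (auto simp: epowr_prod epowr_epowr intro!: prod.cong)
  also have "\<dots> \<le> (\<Prod>i\<in>I. epowr (\<integral>\<^sup>+x. epowr (G i x) (qs i) \<partial>M) (q / qs i))"
  proof (intro nn_integral_prod_epowr_le I)
    show "(\<Sum>i\<in>I. q / qs i) = 1"
      using sum q(1) by (simp add: divide_inverse flip: sum_distrib_left)
  qed (use q in auto)
  finally have "enorm M q (\<lambda>x. \<Prod>i\<in>I. G i x) \<le> epowr (\<Prod>i\<in>I. epowr (\<integral>\<^sup>+x. epowr (G i x) (qs i) \<partial>M) (q / qs i)) (1 / q)"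
    unfolding enorm_def using q by (intro epowr_mono) auto
  also have "\<dots> = (\<Prod>i\<in>I. enorm M (qs i) (G i))"
    unfolding enorm_def using q by (auto simp: epowr_prod epowr_epowr intro!: prod.cong)
  finally show ?thesis .
qed

text \<open>Hoelder's inequality for the splitting of \<open>u * h\<close> into (u^q h)^(1/q) and
  h^(1 - 1/q), raised to the power \<open>q\<close>. The two factors are indexed by
  \<open>bool\<close> to fit the version for finite families.\<close>

lemma epowr_nn_integral_mult_le:
  assumes q: "1 < q" and [measurable]: "u \<in> borel_measurable N" "h \<in> borel_measurable N"
  shows "epowr (\<integral>\<^sup>+y. u y * h y \<partial>N) q \<le> epowr (\<integral>\<^sup>+y. h y \<partial>N) (q - 1) * (\<integral>\<^sup>+y. epowr (u y) q * h y \<partial>N)"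
proof -
  define F where "F b y = (if b then epowr (u y) q * h y else h y)" for b y
  define \<theta> where "\<theta> b = (if b then 1 / q else 1 - 1 / q)" for b
  have "u y * h y = (\<Prod>b\<in>UNIV. epowr (F b y) (\<theta> b))" for y
  proof -
    have "h y = epowr (h y) (1 / q + (1 - 1 / q))" by simp
    then have "h y = epowr (h y) (1 / q) * epowr (h y) (1 - 1 / q)" by (simp only: epowr_add)
    then show ?thesis
      using q by (simp add: UNIV_bool F_def \<theta>_def epowr_mult epowr_inverse_cancel mult_ac)
  qed
  then have "(\<integral>\<^sup>+y. u y * h y \<partial>N) \<le> (\<Prod>b\<in>UNIV. epowr (\<integral>\<^sup>+y. F b y \<partial>N) (\<theta> b))"
  proof (simp, intro nn_integral_prod_epowr_le)
    show "F b \<in> borel_measurable N" for b by (cases b) (simp_all add: F_def[abs_def])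
  qed (use q in \<open>auto simp: \<theta>_def UNIV_bool\<close>)
  then have "epowr (\<integral>\<^sup>+y. u y * h y \<partial>N) q \<le> epowr (\<Prod>b\<in>UNIV. epowr (\<integral>\<^sup>+y. F b y \<partial>N) (\<theta> b)) q"
    using q by (intro epowr_mono) auto
  also have "\<dots> = epowr (\<integral>\<^sup>+y. h y \<partial>N) (q - 1) * (\<integral>\<^sup>+y. epowr (u y) q * h y \<partial>N)"
    using q by (simp add: UNIV_bool F_def \<theta>_def epowr_mult epowr_epowr algebra_simps)
  finally show ?thesis .
qed

text \<open>With \<open>h y\<close> the norm of \<open>F (\<cdot>, y)\<close>, this is Jensen's inequality for \<open>F / h\<close> with respect to \<open>h dy\<close>.\<close>

lemma enorm_nn_integral_le:
  fixes F :: "'a \<Rightarrow> 'b \<Rightarrow> ennreal"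
  assumes q: "1 \<le> q" and "sigma_finite_measure M" "sigma_finite_measure N"
    and F [measurable]: "case_prod F \<in> borel_measurable (M \<Otimes>\<^sub>M N)"
  shows "enorm M q (\<lambda>x. \<integral>\<^sup>+y. F x y \<partial>N) \<le> (\<integral>\<^sup>+y. enorm M q (\<lambda>x. F x y) \<partial>N)"
proof -
  interpret M: sigma_finite_measure M by fact
  interpret N: sigma_finite_measure N by fact
  interpret P: pair_sigma_finite M N ..
  have [measurable]: "case_prod (\<lambda>y x. F x y) \<in> borel_measurable (N \<Otimes>\<^sub>M M)"
    using measurable_pair_swap[OF F] by (simp add: case_prod_beta')
  define h where "h y = enorm M q (\<lambda>x. F x y)" for y
  have h[measurable]: "h \<in> borel_measurable N" unfolding h_def enorm_def by measurable
  define H where "H = (\<integral>\<^sup>+y. h y \<partial>N)"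
  show ?thesis
  proof (cases "H = top \<or> q = 1")
    case True
    then show ?thesis
    proof
      assume "H = top" then show ?thesis by (simp add: H_def h_def)
    next
      assume "q = 1" then show ?thesis by (simp add: enorm_def P.Fubini')
    qed
  next
    case False
    then have q: "1 < q" and H: "H \<noteq> top" using q by auto
    define u where "u x y = F x y / h y" for x y
    have [measurable]: "case_prod u \<in> borel_measurable (M \<Otimes>\<^sub>M N)" unfolding u_def by measurable
    have [measurable]: "case_prod (\<lambda>y x. u x y) \<in> borel_measurable (N \<Otimes>\<^sub>M M)"
      using measurable_pair_swap[of "case_prod u" M N borel] by (simp add: case_prod_beta')
    \<comment> \<open>The identity F = u h can fail only where \<open>h y\<close> is 0 or infinite.
      The latter happens for almost no \<open>y\<close> since \<open>H\<close> is finite; in the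
      former case \<open>F x y\<close> vanishes for almost all \<open>x\<close>. Fubini's theorem
      turns this into a statement for almost every \<open>x\<close>.\<close>
    have AEu: "AE x in M. AE y in N. F x y = u x y * h y"
    proof (subst P.AE_commute)
      show "{x \<in> space (M \<Otimes>\<^sub>M N). F (fst x) (snd x) = u (fst x) (snd x) * h (snd x)} \<in> sets (M \<Otimes>\<^sub>M N)"
        by measurable
      have "AE y in N. h y \<noteq> top" using H nn_integral_PInf_AE[OF h] by (simp add: H_def)
      with AE_space show "AE y in N. AE x in M. F x y = u x y * h y"
      proof (eventually_elim, goal_cases)
        case y: (1 y)
        show ?case
        proof (cases "h y = 0")
          case True
          have [measurable]: "(\<lambda>x. F x y) \<in> borel_measurable M"
            using y by measurable
          have "AE x in M. F x y = 0"
            using True by (simp add: h_def enorm_def nn_integral_0_iff_AE)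
          then show ?thesis
            using True by (auto elim: eventually_mono)
        next
          case False
          then show ?thesis using y
            by (auto simp: u_def ennreal_divide_times less_top zero_less_iff_neq_zero)
        qed
      qed
    qed
    have "(\<integral>\<^sup>+x. epowr (\<integral>\<^sup>+y. F x y \<partial>N) q \<partial>M) = (\<integral>\<^sup>+x. epowr (\<integral>\<^sup>+y. u x y * h y \<partial>N) q \<partial>M)"
      using AEu by (intro nn_integral_cong_AE) (auto elim!: eventually_mono intro!: arg_cong[where f="\<lambda>z. epowr z q"] nn_integral_cong_AE)
    also have "\<dots> \<le> (\<integral>\<^sup>+x. epowr H (q - 1) * (\<integral>\<^sup>+y. epowr (u x y) q * h y \<partial>N) \<partial>M)"
      unfolding H_def using q by (intro nn_integral_mono epowr_nn_integral_mult_le) auto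
    also have "\<dots> = epowr H (q - 1) * (\<integral>\<^sup>+x. \<integral>\<^sup>+y. epowr (u x y) q * h y \<partial>N \<partial>M)"
      by (rule nn_integral_cmult) measurable
    also have "(\<integral>\<^sup>+x. \<integral>\<^sup>+y. epowr (u x y) q * h y \<partial>N \<partial>M) = (\<integral>\<^sup>+y. \<integral>\<^sup>+x. epowr (u x y) q * h y \<partial>M \<partial>N)"
      by (rule P.Fubini'[symmetric]) measurable
    also have "\<dots> \<le> H"
      unfolding H_def
    proof (rule nn_integral_mono)
      fix y assume y: "y \<in> space N"
      have [measurable]: "(\<lambda>x. u x y) \<in> borel_measurable M" "(\<lambda>x. F x y) \<in> borel_measurable M"
        using y by measurable
      have "(\<integral>\<^sup>+x. epowr (u x y) q * h y \<partial>M) = (\<integral>\<^sup>+x. epowr (u x y) q \<partial>M) * h y"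
        by (rule nn_integral_multc) measurable
      also have "\<dots> \<le> h y"
      \<comment> \<open>For \<open>h y\<close> positive and finite the slice of \<open>u\<close> at
        \<open>y\<close> has L^q norm 1 by the choice of \<open>h\<close>; otherwise the inequality
        is trivial.\<close>
      proof (cases "h y = 0 \<or> h y = top")
        case False
        have "(\<integral>\<^sup>+x. epowr (u x y) q \<partial>M) = (\<integral>\<^sup>+x. epowr (inverse (h y)) q * epowr (F x y) q \<partial>M)"
          by (simp add: u_def divide_ennreal_def epowr_mult mult.commute)
        also have "\<dots> = epowr (inverse (h y)) q * (\<integral>\<^sup>+x. epowr (F x y) q \<partial>M)"
          by (rule nn_integral_cmult) measurable
        also have "(\<integral>\<^sup>+x. epowr (F x y) q \<partial>M) = epowr (h y) q"
          using q by (simp add: h_def enorm_def epowr_inverse_cancel)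
        also have "epowr (inverse (h y)) q * epowr (h y) q = 1"
          using False ennreal_divide_self[of "h y"]
          by (simp add: divide_ennreal_def mult.commute less_top flip: epowr_mult)
        finally show ?thesis by simp
      qed (auto)
      finally show "(\<integral>\<^sup>+x. epowr (u x y) q * h y \<partial>M) \<le> h y" .
    qed
    also have "epowr H (q - 1) * H = epowr H q"
      using epowr_add[of H "q - 1" 1] by simp
    finally have "enorm M q (\<lambda>x. \<integral>\<^sup>+y. F x y \<partial>N) \<le> epowr (epowr H q) (1 / q)"
      unfolding enorm_def using q by (intro epowr_mono) (auto simp: mult_left_mono)
    then show ?thesis using q by (simp add: epowr_inverse_cancel H_def h_def)
  qed
qed

text \<open>Minkowski's integral inequality with the counting measure on the finite index set as
  inner measure.\<close>

lemma enorm_sum_le: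
  assumes "finite I" "1 \<le> q" "sigma_finite_measure M"
    and [measurable]: "\<And>i. i \<in> I \<Longrightarrow> F i \<in> borel_measurable M"
  shows "enorm M q (\<lambda>x. \<Sum>i\<in>I. F i x) \<le> (\<Sum>i\<in>I. enorm M q (F i))"
proof -
  have "(\<lambda>(i, x). F i x) \<in> borel_measurable (count_space I \<Otimes>\<^sub>M M)"
    using assms by (intro measurable_pair_measure_countable1) (auto simp: countable_finite)
  from measurable_pair_swap[OF this]
  have "(\<lambda>(x, i). F i x) \<in> borel_measurable (M \<Otimes>\<^sub>M count_space I)"
    by (simp add: case_prod_beta')
  from enorm_nn_integral_le[OF _ _ _ this, of q] show ?thesis
    using assms by (simp add: nn_integral_count_space_finite sigma_finite_measure_count_space_finite)
qed

section \<open>Linear maps and dyadic shells\<close>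

text \<open>Minkowski's and Fubini's theorems are applied with \<open>y\<close> ranging over
  \<open>lebesgue\<close>, the completion of \<open>lborel\<close>.\<close>

lemma sigma_finite_completion:
  assumes "sigma_finite_measure M"
  shows "sigma_finite_measure (completion M)"
proof -
  obtain \<A> where "countable \<A>" "\<A> \<subseteq> sets M" "\<Union>\<A> = space M" "\<forall>a\<in>\<A>. emeasure M a \<noteq> \<infinity>"
    using sigma_finite_measure.sigma_finite_countable[OF assms] by blast
  then show ?thesis
    by (intro sigma_finite_measure.intro exI[of _ \<A>]) (auto simp: subset_eq)
qed

section \<open>Matrix norms and linear changes of variables\<close>

lemma norm_matrix_vector_mult_le:
  fixes A :: "real ^ 'n ^ 'm"
  shows "norm (A *v x) \<le> norm A * norm x"
proof -
  have "norm (A *v x) \<le> L2_set (\<lambda>i. norm (A $ i) * norm x) UNIV"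
    unfolding norm_vec_def[of "A *v x"]
    by (intro L2_set_mono) (auto simp: matrix_vector_mul_component Cauchy_Schwarz_ineq2)
  also have "\<dots> = norm A * norm x"
    by (simp add: norm_vec_def[of A] L2_set_left_distrib)
  finally show ?thesis .
qed

lemma matrix_inv_mult:
  fixes A :: "real ^ 'n ^ 'n"
  assumes "invertible A"
  shows "A ** matrix_inv A = mat 1" "matrix_inv A ** A = mat 1"
  using assms someI_ex[of "\<lambda>A'. A ** A' = mat 1 \<and> A' ** A = mat 1"]
  unfolding invertible_def matrix_inv_def by auto

text \<open>Writing \<open>x\<close> as \<open>matrix_inv A *v (A *v x)\<close> gives the first
  bound; at a unit vector it forces both norms to be positive.\<close>

lemma invertible_imp_norm_bounds:
  fixes A :: "real ^ 'n ^ 'n"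
  assumes "invertible A"
  shows "norm x \<le> norm (matrix_inv A) * norm (A *v x)" "0 < norm (matrix_inv A)" "0 < norm A"
proof -
  have "x = matrix_inv A *v (A *v x)" for x
    using assms by (simp add: matrix_vector_mul_assoc matrix_inv_mult)
  then show *: "norm x \<le> norm (matrix_inv A) * norm (A *v x)" for x
    using norm_matrix_vector_mult_le[of "matrix_inv A" "A *v x"] by simp
  obtain e :: "real ^ 'n" where "norm e = 1" using vector_choose_size[of 1] by auto
  then show "0 < norm (matrix_inv A)" "0 < norm A"
    using *[of e] norm_matrix_vector_mult_le[of A e] by (auto simp: less_le)
qed

lemma nn_integral_lborel_translation:
  fixes h :: "'a::euclidean_space \<Rightarrow> ennreal"
  assumes [measurable]: "h \<in> borel_measurable borel"
  shows "(\<integral>\<^sup>+x. h (x + c) \<partial>lborel) = (\<integral>\<^sup>+x. h x \<partial>lborel)"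
proof -
  have "(\<integral>\<^sup>+x. h x \<partial>lborel) = (\<integral>\<^sup>+x. h x \<partial>distr lborel borel ((+) c))"
    by (simp add: lborel_distr_plus)
  then show ?thesis by (simp add: nn_integral_distr add.commute)
qed

lemma nn_integral_lborel_scaleR:
  fixes h :: "'a::euclidean_space \<Rightarrow> ennreal"
  assumes c: "0 < c" and [measurable]: "h \<in> borel_measurable borel"
  shows "(\<integral>\<^sup>+x. h x \<partial>lborel) = ennreal (c ^ DIM('a)) * (\<integral>\<^sup>+x. h (c *\<^sub>R x) \<partial>lborel)"
proof -
  have "(\<integral>\<^sup>+x. h x \<partial>lborel) = (\<integral>\<^sup>+x. h x \<partial>density (distr lborel borel (\<lambda>x. 0 + c *\<^sub>R x)) (\<lambda>_. \<bar>c\<bar> ^ DIM('a)))"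
    using lborel_affine[of c "0::'a"] c by (metis less_irrefl)
  then show ?thesis using c
    by (simp add: nn_integral_density nn_integral_distr nn_integral_cmult)
qed

lemma borel_measurable_matrix_vector_mult [measurable (raw)]:
  fixes A :: "'a \<Rightarrow> real ^ 'n ^ 'm"
  assumes "A \<in> borel_measurable M" "f \<in> borel_measurable M"
  shows "(\<lambda>x. A x *v f x) \<in> borel_measurable M"
proof -
  have "continuous_on UNIV (\<lambda>p::(real ^ 'n ^ 'm) \<times> (real ^ 'n). fst p *v snd p)"
    unfolding matrix_vector_mult_def by (intro continuous_intros)
  then show ?thesis by (rule borel_measurable_continuous_Pair[OF assms])
qed

text \<open>The image of Lebesgue measure under an invertible matrix is invariant under translations, hence
  a multiple of Lebesgue measure. The proof is the one of the uniqueness of Haar measure; it avoids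
  determinants, whose relation to volumes the library provides for well-ordered index types only.\<close>

lemma nn_integral_matrix_vector_mult:
  fixes A :: "real ^ 'n ^ 'n"
  assumes A: "invertible A"
    and [measurable]: "h \<in> borel_measurable borel" "g \<in> borel_measurable borel"
  shows "(\<integral>\<^sup>+x. h (A *v x) \<partial>lborel) * (\<integral>\<^sup>+y. g y \<partial>lborel)
       = (\<integral>\<^sup>+x. g (- (A *v x)) \<partial>lborel) * (\<integral>\<^sup>+y. h y \<partial>lborel)"
proof -
  have [simp]: "A *v (matrix_inv A *v y) = y" for y
    using A by (simp add: matrix_vector_mul_assoc matrix_inv_mult)
  have "(\<integral>\<^sup>+x. h (A *v x) \<partial>lborel) * (\<integral>\<^sup>+y. g y \<partial>lborel) = (\<integral>\<^sup>+x. h (A *v x) * (\<integral>\<^sup>+y. g y \<partial>lborel) \<partial>lborel)"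
    by (rule nn_integral_multc[symmetric]) measurable
  also have "\<dots> = (\<integral>\<^sup>+x. h (A *v x) * (\<integral>\<^sup>+y. g (y + - (A *v x)) \<partial>lborel) \<partial>lborel)"
    by (subst nn_integral_lborel_translation) auto
  also have "\<dots> = (\<integral>\<^sup>+x. \<integral>\<^sup>+y. h (A *v x) * g (y + - (A *v x)) \<partial>lborel \<partial>lborel)"
    by (intro nn_integral_cong nn_integral_cmult[symmetric]) measurable
  also have "\<dots> = (\<integral>\<^sup>+y. \<integral>\<^sup>+x. h (A *v x) * g (y + - (A *v x)) \<partial>lborel \<partial>lborel)"
    by (rule lborel_pair.Fubini'[symmetric]) measurable
  \<comment> \<open>Shifting \<open>x\<close> by \<open>matrix_inv A *v y\<close> turns the argument
    of \<open>h\<close> into \<open>y + A *v x\<close> and that of \<open>g\<close> into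
    \<open>- (A *v x)\<close>, so that \<open>y\<close> survives in \<open>h\<close> only.\<close>
  also have "\<dots> = (\<integral>\<^sup>+y. \<integral>\<^sup>+x. h (A *v (x + matrix_inv A *v y)) * g (y + - (A *v (x + matrix_inv A *v y))) \<partial>lborel \<partial>lborel)"
    by (intro nn_integral_cong nn_integral_lborel_translation[symmetric]) measurable
  also have "\<dots> = (\<integral>\<^sup>+y. \<integral>\<^sup>+x. g (- (A *v x)) * h (y + A *v x) \<partial>lborel \<partial>lborel)"
    by (simp add: matrix_vector_right_distrib mult.commute add.commute)
  also have "\<dots> = (\<integral>\<^sup>+x. \<integral>\<^sup>+y. g (- (A *v x)) * h (y + A *v x) \<partial>lborel \<partial>lborel)"
    by (rule lborel_pair.Fubini') measurable
  also have "\<dots> = (\<integral>\<^sup>+x. g (- (A *v x)) * (\<integral>\<^sup>+y. h (y + A *v x) \<partial>lborel) \<partial>lborel)"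
    by (intro nn_integral_cong nn_integral_cmult) measurable
  also have "\<dots> = (\<integral>\<^sup>+x. g (- (A *v x)) * (\<integral>\<^sup>+y. h y \<partial>lborel) \<partial>lborel)"
    by (subst nn_integral_lborel_translation) auto
  also have "\<dots> = (\<integral>\<^sup>+x. g (- (A *v x)) \<partial>lborel) * (\<integral>\<^sup>+y. h y \<partial>lborel)"
    by (rule nn_integral_multc) measurable
  finally show ?thesis .
qed

text \<open>Take for \<open>g\<close> the indicator of the unit ball. Its preimage under
  \<open>- (A *v x)\<close> lies in the ball of radius \<open>norm (matrix_inv A)\<close>, and the
  volume of the unit ball cancels.\<close>

lemma nn_integral_matrix_vector_mult_le:
  fixes A :: "real ^ 'n ^ 'n"
  assumes A: "invertible A" and [measurable]: "h \<in> borel_measurable borel"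
  shows "(\<integral>\<^sup>+x. h (A *v x) \<partial>lborel) \<le> ennreal (norm (matrix_inv A) ^ CARD('n)) * (\<integral>\<^sup>+x. h x \<partial>lborel)"
proof -
  define V where "V = unit_ball_vol (real CARD('n))"
  let ?b = "norm (matrix_inv A)"
  have V: "0 < V" by (simp add: V_def)
  have "(\<integral>\<^sup>+x. indicator (cball 0 1) (- (A *v x)) \<partial>lborel) \<le> (\<integral>\<^sup>+x. indicator (cball (0::real^'n) ?b) x \<partial>lborel)"
  proof (intro nn_integral_mono)
    fix x :: "real ^ 'n"
    have "norm x \<le> ?b" if "norm (A *v x) \<le> 1"
      using invertible_imp_norm_bounds(1)[OF A, of x] mult_left_mono[OF that, of ?b] by simp
    then show "indicator (cball 0 1) (- (A *v x)) \<le> (indicator (cball 0 ?b) x :: ennreal)"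
      by (auto simp: indicator_def)
  qed
  also have "\<dots> = ennreal (V * ?b ^ CARD('n))"
    by (simp add: emeasure_cball V_def)
  finally have "(\<integral>\<^sup>+x. indicator (cball 0 1) (- (A *v x)) \<partial>lborel) \<le> ennreal (?b ^ CARD('n)) * ennreal V"
    using V by (simp add: mult.commute flip: ennreal_mult)
  then have "(\<integral>\<^sup>+x. h (A *v x) \<partial>lborel) * (\<integral>\<^sup>+y. indicator (cball (0::real^'n) 1) y \<partial>lborel)
      \<le> ennreal (?b ^ CARD('n)) * ennreal V * (\<integral>\<^sup>+x. h x \<partial>lborel)"
    by (subst nn_integral_matrix_vector_mult[OF A]) (auto intro!: mult_right_mono borel_measurable_indicator)
  moreover have "(\<integral>\<^sup>+y. indicator (cball (0::real^'n) 1) y \<partial>lborel) = ennreal V"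
    by (simp add: emeasure_cball V_def)
  ultimately have "ennreal V * (\<integral>\<^sup>+x. h (A *v x) \<partial>lborel) \<le> ennreal V * (ennreal (?b ^ CARD('n)) * (\<integral>\<^sup>+x. h x \<partial>lborel))"
    by (simp add: mult_ac)
  then show ?thesis
    using V by (simp add: ennreal_mult_le_mult_iff)
qed

text \<open>The change of variables bound for the indicator of \<open>N\<close>: preimages of null
  sets under invertible matrices are null.\<close>

lemma AE_matrix_vector_mult:
  fixes A :: "real ^ 'n ^ 'n"
  assumes A: "invertible A" and N: "N \<in> null_sets lborel"
  shows "AE x in lborel. A *v x \<notin> N"
proof -
  have [measurable]: "N \<in> sets borel" using N by auto
  have "(\<integral>\<^sup>+x. indicator N (A *v x) \<partial>lborel) \<le> ennreal (norm (matrix_inv A) ^ CARD('n)) * (\<integral>\<^sup>+x. indicator N x \<partial>lborel)"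
    by (rule nn_integral_matrix_vector_mult_le[OF A]) measurable
  also have "\<dots> = 0" using N by (simp add: null_setsD1)
  finally have "(\<integral>\<^sup>+x. (indicator N (A *v x) :: ennreal) \<partial>lborel) = 0" by simp
  then show ?thesis
    by (subst (asm) nn_integral_0_iff_AE) (auto elim!: eventually_mono split: split_indicator_asm)
qed

text \<open>With b the norm of the inverse, |x| and b |A x| agree up to the factor \<open>R\<close>:
  |x| \<le> b |A x| settles nonnegative \<open>s\<close>, and b |A x| \<le> R |x| settles negative
  \<open>s\<close>, where powers reverse the order.\<close>

lemma norm_powr_le_matrix_vector_mult:
  fixes A :: "real ^ 'n ^ 'n"
  assumes A: "invertible A" "norm A * norm (matrix_inv A) \<le> R" and R: "1 \<le> R" and x: "x \<noteq> 0"
  shows "norm x powr s \<le> R powr \<bar>s\<bar> * norm (matrix_inv A) powr s * norm (A *v x) powr s"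
proof -
  let ?a = "norm A" and ?b = "norm (matrix_inv A)"
  note b = invertible_imp_norm_bounds[OF A(1)]
  have Ax: "0 < norm (A *v x)" using b(1)[of x] x by (auto simp: less_le)
  show ?thesis
  proof (cases "0 \<le> s")
    case True
    have "norm x powr s \<le> (?b * norm (A *v x)) powr s"
      using True b(1) by (intro powr_mono2) auto
    also have "\<dots> \<le> R powr \<bar>s\<bar> * (?b * norm (A *v x)) powr s"
      using R by (simp add: ge_one_powr_ge_zero mult_le_cancel_right1)
    finally show ?thesis by (simp add: powr_mult mult.assoc)
  next
    case False
    have "norm (A *v x) * ?b \<le> ?a * ?b * norm x"
      using mult_right_mono[OF norm_matrix_vector_mult_le[of A x], of ?b] by (simp add: mult_ac)
    also have "\<dots> \<le> R * norm x" using A(2) by (simp add: mult_right_mono)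
    finally have "norm (A *v x) * ?b / R \<le> norm x" using R by (simp add: field_simps)
    then have "norm x powr s \<le> (norm (A *v x) * ?b / R) powr s"
      using False R Ax b(2) by (intro powr_mono2') auto
    also have "\<dots> = R powr \<bar>s\<bar> * ?b powr s * norm (A *v x) powr s"
      using False R by (simp add: powr_mult powr_divide powr_minus field_simps)
    finally show ?thesis .
  qed
qed

section \<open>Dyadic shells and the dilation-invariant measure on them\<close>

lemma dyadic_shell_iff:
  "x \<in> dyadic_shell k \<longleftrightarrow> 2 powr (real_of_int k - 1) < norm x \<and> norm x \<le> 2 powr real_of_int k"
proof -
  have "2 powr (real_of_int k - 1) = 2 powi (k - 1)" "2 powr real_of_int k = 2 powi k"
    using powr_real_of_int'[of 2 "k - 1"] powr_real_of_int'[of 2 k] by auto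
  then show ?thesis by (auto simp: dyadic_shell_def dyadic_ball_def)
qed

lemma dyadic_ball_iff: "x \<in> dyadic_ball k \<longleftrightarrow> norm x \<le> 2 powr real_of_int k"
  using powr_real_of_int'[of 2 k] by (auto simp: dyadic_ball_def)

lemma dyadic_ball_eq_cball: "dyadic_ball k = cball 0 (2 powr real_of_int k)"
  by (auto simp: dyadic_ball_iff)

lemma sets_dyadic [measurable]: "dyadic_ball k \<in> sets borel" "dyadic_shell k \<in> sets borel"
  by (auto simp: dyadic_shell_def dyadic_ball_eq_cball)

lemma dyadic_shell_nonzero: "x \<in> dyadic_shell k \<Longrightarrow> x \<noteq> 0"
  by (auto simp: dyadic_shell_iff)

lemma ex_dyadic_shell:
  assumes "x \<noteq> 0"
  shows "x \<in> dyadic_shell \<lceil>log 2 (norm x)\<rceil>"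
proof -
  define k where "k = \<lceil>log 2 (norm x)\<rceil>"
  have "real_of_int k - 1 < log 2 (norm x)" "log 2 (norm x) \<le> real_of_int k"
    unfolding k_def by linarith+
  then show ?thesis
    using assms by (simp add: dyadic_shell_iff less_log_iff log_le_iff flip: k_def)
qed

text \<open>On the shell, |x| lies between half of \<open>2 powr k\<close> and
  \<open>2 powr k\<close>, so \<open>s\<close>-th powers agree up to
  \<open>2 powr \<bar>s\<bar>\<close>. The sign of \<open>s\<close> decides which end of the shell
  is the extreme one.\<close>

lemma norm_powr_dyadic_shell:
  assumes "x \<in> dyadic_shell k"
  shows "norm x powr s \<le> 2 powr (\<bar>s\<bar> + k * s)" "2 powr (k * s) \<le> 2 powr \<bar>s\<bar> * norm x powr s"
proof -
  have x: "2 powr (real_of_int k - 1) \<le> norm x" "norm x \<le> 2 powr real_of_int k" "0 < norm x"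
    using assms by (auto simp: dyadic_shell_iff)
  show "norm x powr s \<le> 2 powr (\<bar>s\<bar> + k * s)"
  proof (cases "0 \<le> s")
    case True
    then have "norm x powr s \<le> (2 powr real_of_int k) powr s" using x by (intro powr_mono2) auto
    also have "\<dots> \<le> 2 powr (\<bar>s\<bar> + k * s)" unfolding powr_powr by (intro powr_mono) auto
    finally show ?thesis .
  next
    case False
    then have "norm x powr s \<le> (2 powr (real_of_int k - 1)) powr s" using x by (intro powr_mono2') auto
    also have "\<dots> = 2 powr (\<bar>s\<bar> + k * s)" using False by (simp add: powr_powr algebra_simps)
    finally show ?thesis .
  qed
  show "2 powr (k * s) \<le> 2 powr \<bar>s\<bar> * norm x powr s"
  proof (cases "0 \<le> s")
    case True
    then have "(2 powr (real_of_int k - 1)) powr s \<le> norm x powr s" using x by (intro powr_mono2) auto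
    then have "2 powr \<bar>s\<bar> * (2 powr (real_of_int k - 1)) powr s \<le> 2 powr \<bar>s\<bar> * norm x powr s" by simp
    then show ?thesis using True by (simp add: powr_powr algebra_simps flip: powr_add)
  next
    case False
    then have "(2 powr real_of_int k) powr s \<le> norm x powr s" using x by (intro powr_mono2') auto
    also have "\<dots> \<le> 2 powr \<bar>s\<bar> * norm x powr s"
      by (simp add: mult_le_cancel_right1 ge_one_powr_ge_zero)
    finally show ?thesis by (simp add: powr_powr)
  qed
qed

text \<open>On a dyadic shell the power weights are comparable to constants. Working with the
  dilation-invariant measure \<open>dx / |x|\<^sup>n\<close> moves all of them into the function.\<close>

definition shell_measure :: "int \<Rightarrow> (real ^ 'n) measure" where
  "shell_measure k =
    density lborel (\<lambda>x. ennreal (norm x powr - real CARD('n)) * indicator (dyadic_shell k) x)"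

lemma sets_shell_measure [simp, measurable_cong]: "sets (shell_measure k) = sets borel"
  by (simp add: shell_measure_def)

lemma space_shell_measure [simp]: "space (shell_measure k) = UNIV"
  by (simp add: shell_measure_def)

lemma nn_integral_shell_measure:
  fixes h :: "real ^ 'n \<Rightarrow> ennreal"
  assumes "h \<in> borel_measurable borel"
  shows "(\<integral>\<^sup>+x. h x \<partial>shell_measure k) =
    (\<integral>\<^sup>+x. ennreal (norm x powr - real CARD('n)) * h x * indicator (dyadic_shell k) x \<partial>lborel)"
  using assms unfolding shell_measure_def
  by (subst nn_integral_density) (auto intro!: nn_integral_cong simp: mult_ac)

lemma AE_shell_measure_iff:
  fixes P :: "real ^ 'n \<Rightarrow> bool"
  shows "(AE x in shell_measure k. P x) \<longleftrightarrow> (AE x in lborel. x \<in> dyadic_shell k \<longrightarrow> P x)"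
proof -
  have "(AE x in shell_measure k. P x) \<longleftrightarrow>
    (AE x in lborel. 0 < ennreal (norm x powr - real CARD('n)) * indicator (dyadic_shell k) x \<longrightarrow> P x)"
    unfolding shell_measure_def by (rule AE_density) measurable
  also have "\<dots> \<longleftrightarrow> (AE x in lborel. x \<in> dyadic_shell k \<longrightarrow> P x)"
    by (intro AE_cong) (auto simp: indicator_def dest: dyadic_shell_nonzero)
  finally show ?thesis .
qed

lemma AE_shell_measure: "AE x in shell_measure k. x \<in> dyadic_shell k"
  by (simp add: AE_shell_measure_iff)

text \<open>The bound is uniform in \<open>k\<close>: on the shell the density is at most 2^(n - k
  n), while the enclosing ball has volume 2^(k n) times that of the unit ball.\<close>

lemma emeasure_shell_measure_le:
  "emeasure (shell_measure k :: (real ^ 'n) measure) UNIV \<le> ennreal (2 ^ CARD('n) * unit_ball_vol (real CARD('n)))"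
proof -
  have "emeasure (shell_measure k :: (real ^ 'n) measure) UNIV = (\<integral>\<^sup>+x. 1 \<partial>(shell_measure k :: (real ^ 'n) measure))"
    by simp
  also have "\<dots> \<le> (\<integral>\<^sup>+x. ennreal (2 powr (real CARD('n) - k * real CARD('n))) * indicator (dyadic_ball k) (x :: real ^ 'n) \<partial>lborel)"
    unfolding nn_integral_shell_measure[OF borel_measurable_const]
  proof (intro nn_integral_mono)
    fix x :: "real ^ 'n"
    show "ennreal (norm x powr - real CARD('n)) * 1 * indicator (dyadic_shell k) x
      \<le> ennreal (2 powr (real CARD('n) - k * real CARD('n))) * indicator (dyadic_ball k) x"
      using norm_powr_dyadic_shell(1)[of x k "- real CARD('n)"]
      by (auto simp: indicator_def dyadic_shell_def intro!: ennreal_leI)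
  qed
  also have "\<dots> = ennreal (2 powr (real CARD('n) - k * real CARD('n))) * emeasure lborel (dyadic_ball k :: (real ^ 'n) set)"
    by (rule nn_integral_cmult_indicator) simp
  also have "\<dots> = ennreal (2 ^ CARD('n) * unit_ball_vol (real CARD('n)))"
    by (simp add: dyadic_ball_eq_cball emeasure_cball powr_diff powr_realpow powr_powr powr_power mult.commute flip: ennreal_mult)
  finally show ?thesis .
qed

lemma finite_measure_shell_measure: "finite_measure (shell_measure k)"
proof
  have "emeasure (shell_measure k) (space (shell_measure k)) < top"
    unfolding space_shell_measure by (rule le_less_trans[OF emeasure_shell_measure_le]) simp
  then show "emeasure (shell_measure k) (space (shell_measure k)) \<noteq> \<infinity>" by (simp add: less_top)
qed

lemma sigma_finite_shell_measure: "sigma_finite_measure (shell_measure k)"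
proof -
  interpret finite_measure "shell_measure k" by (rule finite_measure_shell_measure)
  show ?thesis by unfold_locales
qed

text \<open>Replacing the density at \<open>x\<close> by the one at \<open>A *v x\<close> costs
  norm(A)^n, and the change of variables costs the n-th power of the norm of the inverse. Together
  this is at most R^n, of which the \<open>q\<close>-th root is taken.\<close>

lemma enorm_shell_measure_matrix_le:
  fixes A :: "real ^ 'n ^ 'n"
  assumes A: "invertible A" "norm A * norm (matrix_inv A) \<le> R" and R: "1 \<le> R" and q: "0 < q"
    and [measurable]: "G \<in> borel_measurable borel"
  shows "enorm (shell_measure k) q (\<lambda>x. G (A *v x) * indicator (dyadic_shell j) (A *v x))
    \<le> ennreal (R powr (real CARD('n) / q)) * enorm (shell_measure j) q G"
proof -
  let ?a = "norm A" and ?b = "norm (matrix_inv A)" and ?n = "real CARD('n)"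
  let ?h = "\<lambda>x. ennreal (norm x powr - ?n) * epowr (G x) q * indicator (dyadic_shell j) x"
  have R0: "0 < R" using R by simp
  note b = invertible_imp_norm_bounds[OF A(1)]
  have "(\<integral>\<^sup>+x. epowr (G (A *v x) * indicator (dyadic_shell j) (A *v x)) q \<partial>shell_measure k)
      = (\<integral>\<^sup>+x. ennreal (norm x powr - ?n) * epowr (G (A *v x) * indicator (dyadic_shell j) (A *v x)) q
           * indicator (dyadic_shell k) x \<partial>lborel)"
    by (rule nn_integral_shell_measure) measurable
  also have "\<dots> \<le> (\<integral>\<^sup>+x. ennreal (?a powr ?n) * ?h (A *v x) \<partial>lborel)"
  proof (intro nn_integral_mono)
    fix x :: "real ^ 'n"
    show "ennreal (norm x powr - ?n) * epowr (G (A *v x) * indicator (dyadic_shell j) (A *v x)) q * indicator (dyadic_shell k) x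
      \<le> ennreal (?a powr ?n) * ?h (A *v x)"
    proof (cases "x \<in> dyadic_shell k \<and> A *v x \<in> dyadic_shell j")
      case True
      then have x: "0 < norm x" "0 < norm (A *v x)" by (auto dest: dyadic_shell_nonzero)
      have "norm (A *v x) powr ?n \<le> (?a * norm x) powr ?n"
        by (intro powr_mono2 norm_matrix_vector_mult_le) auto
      then have "norm x powr - ?n \<le> ?a powr ?n * norm (A *v x) powr - ?n"
        using x by (simp add: powr_mult powr_minus field_simps)
      then have "ennreal (norm x powr - ?n) \<le> ennreal (?a powr ?n) * ennreal (norm (A *v x) powr - ?n)"
        by (simp flip: ennreal_mult)
      then show ?thesis using True by (simp add: mult_right_mono flip: mult.assoc)
    qed (auto simp: indicator_def)
  qed
  also have "\<dots> = ennreal (?a powr ?n) * (\<integral>\<^sup>+x. ?h (A *v x) \<partial>lborel)"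
    by (rule nn_integral_cmult) measurable
  also have "\<dots> \<le> ennreal (?a powr ?n) * (ennreal (?b ^ CARD('n)) * (\<integral>\<^sup>+x. ?h x \<partial>lborel))"
    by (intro mult_left_mono nn_integral_matrix_vector_mult_le[OF A(1)]) auto
  also have "(\<integral>\<^sup>+x. ?h x \<partial>lborel) = (\<integral>\<^sup>+x. epowr (G x) q \<partial>shell_measure j)"
    by (rule nn_integral_shell_measure[symmetric]) measurable
  also have "ennreal (?a powr ?n) * (ennreal (?b ^ CARD('n)) * \<dots>) = ennreal ((?a * ?b) powr ?n) * \<dots>"
    using b by (simp add: powr_mult powr_realpow ennreal_mult mult.assoc)
  also have "\<dots> \<le> ennreal (R powr ?n) * (\<integral>\<^sup>+x. epowr (G x) q \<partial>shell_measure j)"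
    using A(2) by (intro mult_right_mono ennreal_leI powr_mono2) auto
  finally have "enorm (shell_measure k) q (\<lambda>x. G (A *v x) * indicator (dyadic_shell j) (A *v x))
      \<le> epowr (ennreal (R powr ?n) * (\<integral>\<^sup>+x. epowr (G x) q \<partial>shell_measure j)) (1 / q)"
    unfolding enorm_def using q by (intro epowr_mono) auto
  then show ?thesis
    by (simp add: enorm_def epowr_mult epowr_ennreal powr_powr)
qed

section \<open>Unweighted Morrey-Herz norms\<close>

text \<open>The expression under the supremum over \<open>k0\<close>. It is kept apart because, for
  fixed \<open>k0\<close>, it is a mixed norm, l^p over the shells of L^q on each of them, to which
  Hoelder's and Minkowski's inequalities apply directly.\<close>

definition block_norm :: "real \<Rightarrow> real \<Rightarrow> real \<Rightarrow> int \<Rightarrow> (real ^ 'n \<Rightarrow> ennreal) \<Rightarrow> ennreal" where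
  "block_norm l p q k0 G =
    ennreal (2 powr (- l * real_of_int k0)) * enorm (count_space {..k0}) p (\<lambda>k. enorm (shell_measure k) q G)"

definition herz_norm :: "real \<Rightarrow> real \<Rightarrow> real \<Rightarrow> (real ^ 'n \<Rightarrow> ennreal) \<Rightarrow> ennreal" where
  "herz_norm l p q G = (SUP k0. block_norm l p q k0 G)"

lemma block_norm_le_herz_norm: "block_norm l p q k0 G \<le> herz_norm l p q G"
  unfolding herz_norm_def by (rule SUP_upper) simp

lemma block_norm_mono:
  assumes "0 < p" "0 < q" "\<And>k. k \<le> k0 \<Longrightarrow> AE x in shell_measure k. F x \<le> G x"
  shows "block_norm l p q k0 F \<le> block_norm l p q k0 G"
  unfolding block_norm_def using assms
  by (intro mult_left_mono enorm_mono[of p] enorm_mono_AE[of q]) auto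

lemma herz_norm_mono:
  assumes "0 < p" "0 < q" "\<And>k. AE x in shell_measure k. F x \<le> G x"
  shows "herz_norm l p q F \<le> herz_norm l p q G"
  unfolding herz_norm_def using assms by (intro SUP_mono' block_norm_mono) auto

lemma block_norm_cmult:
  assumes "0 < p" "0 < q" "G \<in> borel_measurable borel"
  shows "block_norm l p q k0 (\<lambda>x. c * G x) = c * block_norm l p q k0 G"
  using assms by (simp add: block_norm_def enorm_cmult measurable_cong_sets[OF sets_shell_measure refl] mult_ac)

lemma herz_norm_cmult:
  assumes "0 < p" "0 < q" "G \<in> borel_measurable borel"
  shows "herz_norm l p q (\<lambda>x. c * G x) = c * herz_norm l p q G"
  using assms by (simp add: herz_norm_def block_norm_cmult SUP_mult_left_ennreal)

text \<open>Hoelder's inequality in L^q on each shell, then in l^p over the shells; the factors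
  \<open>2 powr (- ls i * k0)\<close> multiply to the one with exponent \<open>l\<close>.\<close>

lemma block_norm_prod_le:
  assumes I: "finite I" and pos: "0 < p" "0 < q" "\<And>i. i \<in> I \<Longrightarrow> 0 < ps i" "\<And>i. i \<in> I \<Longrightarrow> 0 < qs i"
    and sum: "(\<Sum>i\<in>I. 1 / ps i) = 1 / p" "(\<Sum>i\<in>I. 1 / qs i) = 1 / q" "(\<Sum>i\<in>I. ls i) = l"
    and G: "\<And>i. i \<in> I \<Longrightarrow> G i \<in> borel_measurable borel"
  shows "block_norm l p q k0 (\<lambda>x. \<Prod>i\<in>I. G i x) \<le> (\<Prod>i\<in>I. block_norm (ls i) (ps i) (qs i) k0 (G i))"
proof -
  have "enorm (count_space {..k0}) p (\<lambda>k. enorm (shell_measure k) q (\<lambda>x. \<Prod>i\<in>I. G i x))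
      \<le> enorm (count_space {..k0}) p (\<lambda>k. \<Prod>i\<in>I. enorm (shell_measure k) (qs i) (G i))"
    using assms by (intro enorm_mono enorm_prod_le) (auto simp: measurable_cong_sets[OF sets_shell_measure refl])
  also have "\<dots> \<le> (\<Prod>i\<in>I. enorm (count_space {..k0}) (ps i) (\<lambda>k. enorm (shell_measure k) (qs i) (G i)))"
    using assms by (intro enorm_prod_le) auto
  finally have "block_norm l p q k0 (\<lambda>x. \<Prod>i\<in>I. G i x) \<le> ennreal (2 powr (- l * k0)) *
      (\<Prod>i\<in>I. enorm (count_space {..k0}) (ps i) (\<lambda>k. enorm (shell_measure k) (qs i) (G i)))"
    unfolding block_norm_def by (rule mult_left_mono) simp
  also have "ennreal (2 powr (- l * k0)) = (\<Prod>i\<in>I. ennreal (2 powr (- ls i * k0)))"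
    by (simp add: prod_ennreal sum_distrib_right sum_negf flip: powr_sum sum(3))
  finally show ?thesis
    by (simp add: block_norm_def prod.distrib)
qed

text \<open>The shell index is countable, so joint measurability reduces to measurability in
  \<open>y\<close> for each fixed \<open>k\<close>. Minkowski's inequality over the shells needs the
  joint form.\<close>

lemma measurable_enorm_shell_measure:
  fixes F :: "real ^ 'n \<Rightarrow> 'b \<Rightarrow> ennreal" and k0 :: int
  assumes F: "case_prod F \<in> borel_measurable (borel \<Otimes>\<^sub>M N)"
  shows "(\<lambda>(k, y). enorm (shell_measure k) q (\<lambda>x. F x y)) \<in> borel_measurable (count_space {..k0} \<Otimes>\<^sub>M N)"
proof (intro measurable_pair_measure_countable1)
  fix k
  interpret sigma_finite_measure "shell_measure k :: (real ^ 'n) measure" by (rule sigma_finite_shell_measure)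
  have "case_prod F \<in> borel_measurable (shell_measure k \<Otimes>\<^sub>M N)"
    using F by (simp cong: measurable_cong_sets sets_pair_measure_cong)
  from measurable_pair_swap[OF this]
  have [measurable]: "(\<lambda>(y, x). F x y) \<in> borel_measurable (N \<Otimes>\<^sub>M shell_measure k)"
    by (simp add: case_prod_beta')
  show "(\<lambda>y. case (k, y) of (k, y) \<Rightarrow> enorm (shell_measure k) q (\<lambda>x. F x y)) \<in> borel_measurable N"
    unfolding enorm_def prod.case by measurable
qed simp

lemma borel_measurable_block_norm:
  fixes F :: "real ^ 'n \<Rightarrow> 'b \<Rightarrow> ennreal"
  assumes F: "case_prod F \<in> borel_measurable (borel \<Otimes>\<^sub>M N)"
  shows "(\<lambda>y. block_norm l p q k0 (\<lambda>x. F x y)) \<in> borel_measurable N"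
proof -
  interpret C: sigma_finite_measure "count_space {..k0}"
    by (intro sigma_finite_measure_count_space_countable) auto
  have [measurable]: "(\<lambda>(y, k). enorm (shell_measure k) q (\<lambda>x. F x y)) \<in> borel_measurable (N \<Otimes>\<^sub>M count_space {..k0})"
    using measurable_pair_swap[OF measurable_enorm_shell_measure[OF F, of q k0]] by (simp add: case_prod_beta')
  show ?thesis unfolding block_norm_def enorm_def[of "count_space _"] by measurable
qed

text \<open>Minkowski's integral inequality applied twice, first in L^q on each shell and then in
  l^p over the shells.\<close>

lemma block_norm_nn_integral_le:
  fixes F :: "real ^ 'n \<Rightarrow> 'b \<Rightarrow> ennreal"
  assumes pq: "1 \<le> p" "1 \<le> q" and N: "sigma_finite_measure N"
    and F: "case_prod F \<in> borel_measurable (borel \<Otimes>\<^sub>M N)"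
  shows "block_norm l p q k0 (\<lambda>x. \<integral>\<^sup>+y. F x y \<partial>N) \<le> (\<integral>\<^sup>+y. block_norm l p q k0 (\<lambda>x. F x y) \<partial>N)"
proof -
  have F1: "case_prod F \<in> borel_measurable (shell_measure k \<Otimes>\<^sub>M N)" for k
    using F by (simp cong: measurable_cong_sets sets_pair_measure_cong)
  have cs: "sigma_finite_measure (count_space {..k0})"
    by (intro sigma_finite_measure_count_space_countable) auto
  interpret C: sigma_finite_measure "count_space {..k0}" by fact
  note E = measurable_enorm_shell_measure[OF F, of q k0]
  have [measurable]: "(\<lambda>(y, k). enorm (shell_measure k) q (\<lambda>x. F x y)) \<in> borel_measurable (N \<Otimes>\<^sub>M count_space {..k0})"
    using measurable_pair_swap[OF E] by (simp add: case_prod_beta')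
  have "enorm (count_space {..k0}) p (\<lambda>k. enorm (shell_measure k) q (\<lambda>x. \<integral>\<^sup>+y. F x y \<partial>N))
      \<le> enorm (count_space {..k0}) p (\<lambda>k. \<integral>\<^sup>+y. enorm (shell_measure k) q (\<lambda>x. F x y) \<partial>N)"
    using pq by (intro enorm_mono enorm_nn_integral_le N sigma_finite_shell_measure F1) auto
  also have "\<dots> \<le> (\<integral>\<^sup>+y. enorm (count_space {..k0}) p (\<lambda>k. enorm (shell_measure k) q (\<lambda>x. F x y)) \<partial>N)"
    by (intro enorm_nn_integral_le pq cs N E)
  finally have "block_norm l p q k0 (\<lambda>x. \<integral>\<^sup>+y. F x y \<partial>N) \<le> ennreal (2 powr (- l * k0)) *
     (\<integral>\<^sup>+y. enorm (count_space {..k0}) p (\<lambda>k. enorm (shell_measure k) q (\<lambda>x. F x y)) \<partial>N)"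
    unfolding block_norm_def by (rule mult_left_mono) simp
  also have "\<dots> = (\<integral>\<^sup>+y. block_norm l p q k0 (\<lambda>x. F x y) \<partial>N)"
    unfolding block_norm_def by (rule nn_integral_cmult[symmetric]) (unfold enorm_def[of "count_space _"], measurable)
  finally show ?thesis .
qed

section \<open>Behaviour of the unweighted norm under invertible matrices\<close>

lemma enorm_count_space_shift:
  fixes k0 s :: int
  shows "enorm (count_space {..k0}) p (\<lambda>k. E (k + s)) = enorm (count_space {..k0 + s}) p E"
proof -
  have "bij_betw (\<lambda>k. k + s) {..k0} {..k0 + s}"
    by (rule bij_betwI[where g="\<lambda>k. k - s"]) auto
  from nn_integral_bij_count_space[OF this, of "\<lambda>k. epowr (E k) p"] show ?thesis
    by (simp add: enorm_def)
qed

text \<open>With b the norm of the inverse, |A x| lies between |x| / b and 2^N |x| / b, and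
  \<open>s\<close> is chosen so that 2^s \<le> 1 / b < 2^(s + 1). Hence \<open>A\<close> shifts
  shells by \<open>s\<close>, up to a spread that depends on \<open>R\<close> only through
  \<open>N\<close>; rounding 1 / b up to 2^(s + 1) is what turns \<open>N\<close> into
  \<open>Suc N\<close>.\<close>

lemma matrix_image_dyadic_shell:
  fixes A :: "real ^ 'n ^ 'n"
  assumes A: "invertible A" "norm A * norm (matrix_inv A) \<le> R" and R: "R \<le> 2 ^ N"
    and s: "s = \<lfloor>- log 2 (norm (matrix_inv A))\<rfloor>" and x: "x \<in> dyadic_shell k"
  shows "\<exists>r\<le>Suc N. A *v x \<in> dyadic_shell (k + s + int r)"
proof -
  let ?b = "norm (matrix_inv A)"
  note b = invertible_imp_norm_bounds[OF A(1)]
  have s': "2 powr real_of_int s \<le> 1 / ?b" "1 / ?b < 2 powr (real_of_int s + 1)"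
  proof -
    have b': "2 powr (- log 2 ?b) = 1 / ?b" using b by (simp add: powr_minus_divide)
    show "2 powr real_of_int s \<le> 1 / ?b"
      unfolding b'[symmetric] s by (intro powr_mono) auto
    show "1 / ?b < 2 powr (real_of_int s + 1)"
      unfolding b'[symmetric] s by (intro powr_less_mono) linarith+
  qed
  have x: "2 powr (real_of_int k - 1) < norm x" "norm x \<le> 2 powr real_of_int k"
    using x by (auto simp: dyadic_shell_iff)
  define j where "j = \<lceil>log 2 (norm (A *v x))\<rceil>"
  have "norm x > 0" using x(1) by (rule order.strict_trans2[rotated, OF less_imp_le]) simp
  then have Ax: "0 < norm (A *v x)" using b(1)[of x] by (auto simp: less_le)
  then have j: "A *v x \<in> dyadic_shell j" unfolding j_def by (intro ex_dyadic_shell) auto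
  have "2 powr (real_of_int (k + s) - 1) = 2 powr (real_of_int k - 1) * 2 powr real_of_int s"
    by (simp add: algebra_simps flip: powr_add)
  also have "\<dots> \<le> 2 powr (real_of_int k - 1) * (1 / ?b)"
    using s'(1) by (intro mult_left_mono) auto
  also have "\<dots> < norm x * (1 / ?b)"
    using x(1) b(2) by (intro mult_strict_right_mono) auto
  also have "\<dots> \<le> norm (A *v x)" using b(1)[of x] b(2) by (simp add: field_simps)
  finally have low: "2 powr (real_of_int (k + s) - 1) < norm (A *v x)" .
  have "norm (A *v x) \<le> norm A * norm x" by (rule norm_matrix_vector_mult_le)
  also have "\<dots> \<le> (2 ^ N * (1 / ?b)) * 2 powr real_of_int k"
    using A(2) R b x(2) by (intro mult_mono) (auto simp: field_simps)
  also have "\<dots> \<le> (2 ^ N * 2 powr (real_of_int s + 1)) * 2 powr real_of_int k"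
    using s'(2) by (intro mult_right_mono mult_left_mono) auto
  also have "\<dots> = 2 powr real_of_int (k + s + int (Suc N))"
    by (simp add: powr_add powr_realpow)
  finally have up: "norm (A *v x) \<le> 2 powr real_of_int (k + s + int (Suc N))" .
  have "2 powr (real_of_int (k + s) - 1) < 2 powr real_of_int j" "2 powr (real_of_int j - 1) < 2 powr real_of_int (k + s + int (Suc N))"
    using j low up unfolding dyadic_shell_iff by linarith+
  then have "k + s \<le> j" "j \<le> k + s + int (Suc N)" by auto
  then show ?thesis
    using j by (intro exI[of _ "nat (j - (k + s))"]) auto
qed

text \<open>The matrix moves shell \<open>k\<close> into the shells \<open>k + s + r\<close> with
  \<open>r \<le> Suc N\<close>, so the truncation at \<open>k0\<close> becomes one at
  \<open>k0 + s + r\<close>. Since the weight \<open>2 powr (- l * k0)\<close> refers to the old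
  truncation, a factor \<open>2 powr (l * (s + r))\<close> appears, a constant times the power
  \<open>- l\<close> of the norm of the inverse. The new truncation depends on \<open>A\<close>,
  which is why the full \<open>herz_norm\<close> stands on the right.\<close>

lemma block_norm_matrix_le:
  assumes R: "1 \<le> R" and l: "0 \<le> l" and pq: "1 \<le> p" "1 \<le> q"
  obtains D where "0 < D"
    "\<And>(A :: real ^ 'n ^ 'n) G k0. invertible A \<Longrightarrow> norm A * norm (matrix_inv A) \<le> R \<Longrightarrow> G \<in> borel_measurable borel \<Longrightarrow>
      block_norm l p q k0 (\<lambda>x. G (A *v x)) \<le> ennreal (D * norm (matrix_inv A) powr - l) * herz_norm l p q G"
proof -
  obtain N where N: "R \<le> 2 ^ N"
    using real_arch_pow[of 2 R] by (auto intro: less_imp_le)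
  \<comment> \<open>The three factors come from the change of variables on a shell, from the
    \<open>N + 2\<close> values of \<open>r\<close>, and from \<open>2 powr (r * l)\<close> at the
    largest \<open>r\<close>.\<close>
  define D where "D = R powr (real CARD('n) / q) * (real (Suc (Suc N)) * 2 powr (real (Suc N) * l))"
  show thesis
  proof (rule that[of D])
    show "0 < D" using R by (simp add: D_def)
    fix A :: "real ^ 'n ^ 'n" and G :: "real ^ 'n \<Rightarrow> ennreal" and k0
    assume A: "invertible A" "norm A * norm (matrix_inv A) \<le> R" and [measurable]: "G \<in> borel_measurable borel"
    let ?b = "norm (matrix_inv A)" and ?C = "ennreal (R powr (real CARD('n) / q))"
    define s where "s = \<lfloor>- log 2 ?b\<rfloor>"
    define E where "E k = enorm (shell_measure k) q G" for k
    note b = invertible_imp_norm_bounds[OF A(1)]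
    have shell: "enorm (shell_measure k) q (\<lambda>x. G (A *v x)) \<le> ?C * (\<Sum>r\<in>{..Suc N}. E (k + (s + int r)))" for k
    proof -
      have "enorm (shell_measure k) q (\<lambda>x. G (A *v x)) \<le>
        enorm (shell_measure k) q (\<lambda>x. \<Sum>r\<in>{..Suc N}. G (A *v x) * indicator (dyadic_shell (k + (s + int r))) (A *v x))"
      proof (rule enorm_mono_AE)
        show "AE x in shell_measure k. G (A *v x) \<le> (\<Sum>r\<in>{..Suc N}. G (A *v x) * indicator (dyadic_shell (k + (s + int r))) (A *v x))"
          using AE_shell_measure
        proof eventually_elim
          case (elim x)
          obtain r where r: "r \<le> Suc N" "A *v x \<in> dyadic_shell (k + (s + int r))"
            using matrix_image_dyadic_shell[OF A N s_def elim] by (auto simp: add.assoc)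
          then have "G (A *v x) = G (A *v x) * indicator (dyadic_shell (k + (s + int r))) (A *v x)" by simp
          also have "\<dots> \<le> (\<Sum>r\<in>{..Suc N}. G (A *v x) * indicator (dyadic_shell (k + (s + int r))) (A *v x))"
            using r(1) by (intro member_le_sum) auto
          finally show ?case .
        qed
      qed (use pq in simp)
      \<comment> \<open>Each summand sees the image of \<open>x\<close> in a single shell, so after
        the triangle inequality the change of variables bound applies to it.\<close>
      also have "\<dots> \<le> (\<Sum>r\<in>{..Suc N}. enorm (shell_measure k) q (\<lambda>x. G (A *v x) * indicator (dyadic_shell (k + (s + int r))) (A *v x)))"
        using pq by (intro enorm_sum_le sigma_finite_shell_measure) (auto simp: measurable_cong_sets[OF sets_shell_measure refl])
      also have "\<dots> \<le> (\<Sum>r\<in>{..Suc N}. ?C * E (k + (s + int r)))"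
        unfolding E_def using pq R by (intro sum_mono enorm_shell_measure_matrix_le A) auto
      finally show ?thesis unfolding sum_distrib_left .
    qed
    have "enorm (count_space {..k0}) p (\<lambda>k. enorm (shell_measure k) q (\<lambda>x. G (A *v x)))
        \<le> enorm (count_space {..k0}) p (\<lambda>k. ?C * (\<Sum>r\<in>{..Suc N}. E (k + (s + int r))))"
      using pq by (intro enorm_mono shell) auto
    also have "\<dots> = ?C * enorm (count_space {..k0}) p (\<lambda>k. \<Sum>r\<in>{..Suc N}. E (k + (s + int r)))"
      using pq by (intro enorm_cmult) auto
    also have "\<dots> \<le> ?C * (\<Sum>r\<in>{..Suc N}. enorm (count_space {..k0}) p (\<lambda>k. E (k + (s + int r))))"
      using pq by (intro mult_left_mono enorm_sum_le sigma_finite_measure_count_space_countable) auto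
    finally have "block_norm l p q k0 (\<lambda>x. G (A *v x)) \<le> ennreal (2 powr (- l * k0)) *
        (?C * (\<Sum>r\<in>{..Suc N}. enorm (count_space {..k0 + (s + int r)}) p E))"
      unfolding block_norm_def enorm_count_space_shift by (rule mult_left_mono) simp
    also have "\<dots> = ?C * (\<Sum>r\<in>{..Suc N}. ennreal (2 powr (- l * k0)) * enorm (count_space {..k0 + (s + int r)}) p E)"
      by (simp add: sum_distrib_left mult_ac del: sum.atMost_Suc)
    also have "\<dots> \<le> ?C * (\<Sum>r\<in>{..Suc N}. ennreal (2 powr (real (Suc N) * l) * ?b powr - l) * herz_norm l p q G)"
    proof (intro mult_left_mono sum_mono)
      fix r assume r: "r \<in> {..Suc N}"
      have "real_of_int s \<le> - log 2 ?b" unfolding s_def by linarith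
      then have "real_of_int s * l \<le> - log 2 ?b * l" using l by (rule mult_right_mono)
      then have "2 powr (real_of_int s * l) \<le> 2 powr (- log 2 ?b * l)" by (intro powr_mono) auto
      also have "\<dots> = ?b powr - l" using b by (simp add: powr_powr[symmetric] powr_minus_divide powr_divide flip: minus_mult_left)
      finally have sl: "2 powr (real_of_int s * l) \<le> ?b powr - l" .
      have "2 powr (- l * k0) = 2 powr (real r * l) * 2 powr (real_of_int s * l) * 2 powr (- l * (k0 + (s + int r)))"
        by (simp add: algebra_simps flip: powr_add)
      also have "\<dots> \<le> (2 powr (real (Suc N) * l) * ?b powr - l) * 2 powr (- l * (k0 + (s + int r)))"
        using r l by (intro mult_right_mono mult_mono sl powr_mono) auto
      finally have "ennreal (2 powr (- l * k0)) \<le> ennreal (2 powr (real (Suc N) * l) * ?b powr - l) * ennreal (2 powr (- l * (k0 + (s + int r))))"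
        by (subst ennreal_mult[symmetric]) (auto intro: ennreal_leI)
      then have "ennreal (2 powr (- l * k0)) * enorm (count_space {..k0 + (s + int r)}) p E
        \<le> ennreal (2 powr (real (Suc N) * l) * ?b powr - l) * block_norm l p q (k0 + (s + int r)) G"
        unfolding block_norm_def E_def by (simp add: mult_right_mono mult.assoc[symmetric])
      also have "\<dots> \<le> ennreal (2 powr (real (Suc N) * l) * ?b powr - l) * herz_norm l p q G"
        by (intro mult_left_mono block_norm_le_herz_norm) simp
      finally show "ennreal (2 powr (- l * k0)) * enorm (count_space {..k0 + (s + int r)}) p E
        \<le> ennreal (2 powr (real (Suc N) * l) * ?b powr - l) * herz_norm l p q G" .
    qed auto
    also have "\<dots> = ennreal (D * ?b powr - l) * herz_norm l p q G"
      by (simp add: D_def mult.assoc[symmetric] ennreal_mult ennreal_of_nat_eq_real_of_nat del: of_nat_Suc)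
    finally show "block_norm l p q k0 (\<lambda>x. G (A *v x)) \<le> ennreal (D * ?b powr - l) * herz_norm l p q G" .
  qed
qed

text \<open>Truncate at \<open>k0 = k\<close> and keep only the last term of the sum.\<close>

lemma shell_le_herz_norm:
  assumes "0 < p"
  shows "ennreal (2 powr (- l * k)) * enorm (shell_measure k) q G \<le> herz_norm l p q G"
proof -
  have "epowr (enorm (shell_measure k) q G) p = (\<integral>\<^sup>+j. epowr (enorm (shell_measure j) q G) p * indicator {k} j \<partial>count_space {..k})"
    by (subst nn_integral_count_space'[of "{k}"]) auto
  also have "\<dots> \<le> (\<integral>\<^sup>+j. epowr (enorm (shell_measure j) q G) p \<partial>count_space {..k})"
    by (intro nn_integral_mono) (auto simp: indicator_def)
  finally have "enorm (shell_measure k) q G \<le> enorm (count_space {..k}) p (\<lambda>k. enorm (shell_measure k) q G)"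
    using assms epowr_mono[of "1 / p"] by (fastforce simp: enorm_def[of "count_space _"] epowr_inverse_cancel)
  then have "ennreal (2 powr (- l * k)) * enorm (shell_measure k) q G \<le> block_norm l p q k G"
    unfolding block_norm_def by (rule mult_left_mono) simp
  then show ?thesis using block_norm_le_herz_norm order.trans by blast
qed

lemma herz_norm_finite_imp_shell:
  fixes G :: "real ^ 'n \<Rightarrow> ennreal"
  assumes "0 < p" "herz_norm l p q G < top"
  shows "enorm (shell_measure k) q G < top"
proof -
  have "ennreal (2 powr (- l * k)) * enorm (shell_measure k) q G < top"
    using shell_le_herz_norm[OF assms(1)] assms(2) by (rule le_less_trans)
  then show ?thesis by (auto simp: ennreal_mult_less_top)
qed

section \<open>Comparison with the weighted norms\<close>

text \<open>Both sides are suprema of finite partial sums: the intervals from \<open>k0 - j\<close>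
  to \<open>k0\<close> exhaust the index set, and monotone convergence applies. The sum in
  \<open>MK_norm\<close> thereby becomes the integral in \<open>enorm\<close>.\<close>

lemma infsum_ennreal_atMost_int:
  fixes f :: "int \<Rightarrow> ennreal"
  shows "(\<Sum>\<^sub>\<infinity>k\<in>{..k0}. f k) = (\<integral>\<^sup>+k. f k \<partial>count_space {..k0})"
proof -
  define F where "F j = {k0 - int j..k0}" for j :: nat
  have F: "finite (F j)" "F j \<subseteq> {..k0}" for j by (auto simp: F_def)
  have int_F: "(\<integral>\<^sup>+k. f k * indicator A k \<partial>count_space {..k0}) = sum f A" if "finite A" "A \<subseteq> {..k0}" for A
    using that by (subst nn_integral_count_space'[of A]) auto
  have inf: "(\<Sum>\<^sub>\<infinity>k\<in>{..k0}. f k) = (SUP A\<in>{A. finite A \<and> A \<subseteq> {..k0}}. sum f A)"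
    by (rule nonneg_infsum_complete) simp
  have "(\<integral>\<^sup>+k. f k \<partial>count_space {..k0}) = (\<integral>\<^sup>+k. (SUP j. f k * indicator (F j) k) \<partial>count_space {..k0})"
  proof (intro nn_integral_cong antisym)
    fix k assume "k \<in> space (count_space {..k0})"
    then have "k \<in> F (nat (k0 - k))" by (auto simp: F_def)
    then show "f k \<le> (SUP j. f k * indicator (F j) k)"
      by (intro SUP_upper2[of "nat (k0 - k)"]) auto
  qed (auto intro!: SUP_least simp: indicator_def)
  also have "\<dots> = (SUP j. \<integral>\<^sup>+k. f k * indicator (F j) k \<partial>count_space {..k0})"
    by (intro nn_integral_monotone_convergence_SUP)
       (auto simp: incseq_def le_fun_def F_def intro!: mult_left_mono split: split_indicator)
  also have "\<dots> = (SUP j. sum f (F j))" using int_F[OF F] by simp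
  also have "\<dots> \<le> (SUP A\<in>{A. finite A \<and> A \<subseteq> {..k0}}. sum f A)"
    using F by (intro SUP_mono) blast
  finally have "(\<integral>\<^sup>+k. f k \<partial>count_space {..k0}) \<le> (\<Sum>\<^sub>\<infinity>k\<in>{..k0}. f k)" by (simp add: inf)
  moreover have "(\<Sum>\<^sub>\<infinity>k\<in>{..k0}. f k) \<le> (\<integral>\<^sup>+k. f k \<partial>count_space {..k0})"
    unfolding inf
  proof (rule SUP_least)
    fix A assume "A \<in> {A. finite A \<and> A \<subseteq> {..k0}}"
    then have "sum f A = (\<integral>\<^sup>+k. f k * indicator A k \<partial>count_space {..k0})" by (simp add: int_F)
    also have "\<dots> \<le> (\<integral>\<^sup>+k. f k \<partial>count_space {..k0})"
      by (intro nn_integral_mono) (auto simp: indicator_def)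
    finally show "sum f A \<le> (\<integral>\<^sup>+k. f k \<partial>count_space {..k0})" .
  qed
  ultimately show ?thesis by (rule antisym[rotated])
qed

section \<open>Power weights of dyadic balls\<close>

lemma emeasure_dyadic_ball:
  "emeasure lborel (dyadic_ball k :: (real ^ 'n) set) = ennreal (unit_ball_vol (real CARD('n)) * 2 powr (k * real CARD('n)))"
  by (simp add: dyadic_ball_eq_cball emeasure_cball powr_power mult.commute)

text \<open>The substitution of \<open>2 powr k *\<^sub>R x\<close> for \<open>x\<close> gives the
  dependence on \<open>k\<close>. For finiteness the unit ball is cut into shells, which yields a
  geometric series of ratio 2^(-(n + \<beta>)); it converges because \<beta> > -n.\<close>

lemma nn_integral_power_weight_dyadic_ball:
  fixes \<beta> :: real and k :: int
  defines "W \<equiv> \<lambda>k. \<integral>\<^sup>+x. ennreal (indicator (dyadic_ball k) x * norm x powr \<beta>) \<partial>(lborel :: (real ^ 'n) measure)"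
  assumes \<beta>: "\<beta> > - real CARD('n)"
  shows "W k = ennreal (2 powr (k * (real CARD('n) + \<beta>))) * W 0" "0 < W 0" "W 0 < top"
proof -
  have "W k = ennreal ((2 powr real_of_int k) ^ CARD('n)) *
     (\<integral>\<^sup>+x. ennreal (indicator (dyadic_ball k) (2 powr real_of_int k *\<^sub>R x) * norm (2 powr real_of_int k *\<^sub>R x) powr \<beta>) \<partial>(lborel :: (real ^ 'n) measure))"
    unfolding W_def by (subst nn_integral_lborel_scaleR[of "2 powr real_of_int k"]) auto
  also have "(\<integral>\<^sup>+x. ennreal (indicator (dyadic_ball k) (2 powr real_of_int k *\<^sub>R x) * norm (2 powr real_of_int k *\<^sub>R x) powr \<beta>) \<partial>(lborel :: (real ^ 'n) measure))
    = (\<integral>\<^sup>+x. ennreal (2 powr (k * \<beta>)) * ennreal (indicator (dyadic_ball 0) x * norm x powr \<beta>) \<partial>(lborel :: (real ^ 'n) measure))"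
    by (intro nn_integral_cong) (auto simp: indicator_def dyadic_ball_iff powr_mult powr_powr ennreal_mult)
  also have "\<dots> = ennreal (2 powr (k * \<beta>)) * W 0"
    unfolding W_def by (rule nn_integral_cmult) measurable
  finally show "W k = ennreal (2 powr (k * (real CARD('n) + \<beta>))) * W 0"
    by (simp add: powr_power powr_add distrib_left ennreal_mult mult_ac)
  show "0 < W 0"
  proof (rule ccontr)
    assume "\<not> 0 < W 0"
    then have "AE x in (lborel :: (real ^ 'n) measure). ennreal (indicator (dyadic_ball 0) x * norm x powr \<beta>) = 0"
      unfolding W_def by (subst (asm) not_gr_zero, subst (asm) nn_integral_0_iff_AE) auto
    with AE_lborel_singleton[of "0 :: real ^ 'n"]
    have "AE x in (lborel :: (real ^ 'n) measure). x \<notin> dyadic_ball 0"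
      by eventually_elim (auto simp: indicator_def)
    then have "emeasure lborel (dyadic_ball 0 :: (real ^ 'n) set) = 0"
      by (subst (asm) AE_iff_measurable[of "dyadic_ball 0"]) auto
    moreover have "\<not> unit_ball_vol (real CARD('n)) \<le> 0" by (simp add: not_le)
    ultimately show False
      by (simp add: emeasure_dyadic_ball ennreal_eq_0_iff)
  qed
  define V where "V = unit_ball_vol (real CARD('n))"
  have V: "0 < V" by (simp add: V_def)
  \<comment> \<open>Shell \<open>- int j\<close> is enlarged to the ball containing it, whose volume
    is explicit. The origin contributes nothing, as \<open>0 powr \<beta> = 0\<close>.\<close>
  have "W 0 \<le> (\<integral>\<^sup>+x. (\<Sum>j. ennreal (2 powr (\<bar>\<beta>\<bar> - real j * \<beta>)) * indicator (dyadic_ball (- int j)) x) \<partial>(lborel :: (real ^ 'n) measure))"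
    unfolding W_def
  proof (intro nn_integral_mono)
    fix x :: "real ^ 'n"
    show "ennreal (indicator (dyadic_ball 0) x * norm x powr \<beta>)
      \<le> (\<Sum>j. ennreal (2 powr (\<bar>\<beta>\<bar> - real j * \<beta>)) * indicator (dyadic_ball (- int j)) x)"
    proof (cases "x \<in> dyadic_ball 0 \<and> x \<noteq> 0")
      case True
      define k where "k = \<lceil>log 2 (norm x)\<rceil>"
      have x: "x \<in> dyadic_shell k" unfolding k_def using True by (intro ex_dyadic_shell) auto
      have "log 2 (norm x) \<le> 0" using True by (auto simp: dyadic_ball_iff)
      then have "k \<le> 0" unfolding k_def by linarith
      define j where "j = nat (- k)"
      have j: "k = - int j" using \<open>k \<le> 0\<close> by (simp add: j_def)
      have "ennreal (indicator (dyadic_ball 0) x * norm x powr \<beta>) \<le> ennreal (2 powr (\<bar>\<beta>\<bar> - real j * \<beta>)) * indicator (dyadic_ball (- int j)) x"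
        using norm_powr_dyadic_shell(1)[OF x, of \<beta>] x True
        by (auto simp: j dyadic_shell_def intro!: ennreal_leI)
      also have "\<dots> \<le> (\<Sum>j. ennreal (2 powr (\<bar>\<beta>\<bar> - real j * \<beta>)) * indicator (dyadic_ball (- int j)) x)"
        using sum_le_suminf[of "\<lambda>j. ennreal (2 powr (\<bar>\<beta>\<bar> - real j * \<beta>)) * indicator (dyadic_ball (- int j)) x" "{j}"]
        by (simp only: sum.insert sum.empty finite.intros empty_iff not_False_eq_True add_0_right summableI zero_le simp_thms)
      finally show ?thesis .
    qed auto
  qed
  also have "\<dots> = (\<Sum>j. \<integral>\<^sup>+x. ennreal (2 powr (\<bar>\<beta>\<bar> - real j * \<beta>)) * indicator (dyadic_ball (- int j)) x \<partial>(lborel :: (real ^ 'n) measure))"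
    by (rule nn_integral_suminf) measurable
  also have "\<dots> = (\<Sum>j. ennreal (2 powr \<bar>\<beta>\<bar> * V * (2 powr (- (real CARD('n) + \<beta>))) ^ j))"
    by (intro suminf_cong, subst nn_integral_cmult_indicator)
       (simp_all add: emeasure_dyadic_ball powr_power algebra_simps V_def flip: ennreal_mult powr_add)
  also have "\<dots> < top"
  proof -
    have "2 powr (- (real CARD('n) + \<beta>)) < 2 powr 0" using \<beta> by (intro powr_less_mono) auto
    then have "summable (\<lambda>j. 2 powr \<bar>\<beta>\<bar> * V * (2 powr (- (real CARD('n) + \<beta>))) ^ j)"
      by (intro summable_mult summable_geometric) auto
    then show ?thesis
      using V by (intro suminf_ennreal2[THEN ord_eq_less_trans]) auto
  qed
  finally show "W 0 < top" .
qed

lemma weight_measure_power_weight: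
  assumes \<beta>: "\<beta> > - real CARD('n)"
  obtains c where "0 < c"
    "\<And>k. weight_measure (power_weight \<beta>) (dyadic_ball k :: (real ^ 'n) set) = c * 2 powr (k * (real CARD('n) + \<beta>))"
proof -
  define W where "W k = (\<integral>\<^sup>+x. ennreal (indicator (dyadic_ball k) x * norm x powr \<beta>) \<partial>(lborel :: (real ^ 'n) measure))" for k
  have "weight_measure (power_weight \<beta>) (dyadic_ball k :: (real ^ 'n) set) = enn2real (W k)" for k
    unfolding weight_measure_def set_lebesgue_integral_def power_weight_def W_def
    by (subst integral_eq_nn_integral) (auto simp: nn_integral_completion intro!: measurable_completion)
  moreover have "enn2real (W k) = enn2real (W 0) * 2 powr (k * (real CARD('n) + \<beta>))" for k
    using nn_integral_power_weight_dyadic_ball(1)[OF \<beta>, of k] by (simp add: enn2real_mult flip: W_def)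
  moreover have "0 < enn2real (W 0)"
    using nn_integral_power_weight_dyadic_ball(2,3)[OF \<beta>] by (simp add: enn2real_positive_iff flip: W_def)
  ultimately show thesis using that by metis
qed

section \<open>Equivalence of the weighted and the unweighted norm\<close>

definition weighted_modulus :: "real \<Rightarrow> (real ^ 'n \<Rightarrow> complex) \<Rightarrow> real ^ 'n \<Rightarrow> ennreal" where
  "weighted_modulus \<tau> f x = ennreal (norm (f x) * norm x powr \<tau>)"

lemma weighted_modulus_measurable [measurable (raw)]:
  assumes [measurable]: "f \<in> borel_measurable borel"
  shows "weighted_modulus \<tau> f \<in> borel_measurable borel"
  unfolding weighted_modulus_def[abs_def] by measurable

abbreviation shell_Lq_norm :: "real \<Rightarrow> real \<Rightarrow> (real ^ 'n \<Rightarrow> complex) \<Rightarrow> int \<Rightarrow> ennreal" where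
  "shell_Lq_norm q \<gamma> f k \<equiv> Lq_norm q (power_weight \<gamma>) (\<lambda>x. f x * indicator (dyadic_shell k) x)"

text \<open>Since \<tau> q = a q + \<gamma> + n, the integrand of the unweighted norm is |x|^(a q)
  times that of the weighted one. On the shell, |x|^a may be replaced by
  \<open>2 powr (k * a)\<close> at the cost of \<open>2 powr \<bar>a\<bar>\<close>.\<close>

lemma shell_Lq_norm_equiv:
  fixes f :: "real ^ 'n \<Rightarrow> complex"
  assumes q: "0 < q" and [measurable]: "f \<in> borel_measurable borel" and \<tau>: "\<tau> = a + (real CARD('n) + \<gamma>) / q"
  shows "enorm (shell_measure k) q (weighted_modulus \<tau> f) \<le> ennreal (2 powr \<bar>a\<bar>) * (ennreal (2 powr (k * a)) * shell_Lq_norm q \<gamma> f k)" (is ?le1)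
    and "ennreal (2 powr (k * a)) * shell_Lq_norm q \<gamma> f k \<le> ennreal (2 powr \<bar>a\<bar>) * enorm (shell_measure k) q (weighted_modulus \<tau> f)" (is ?le2)
proof -
  let ?n = "real CARD('n)"
  let ?L = "\<lambda>x. ennreal (norm (f x * indicator (dyadic_shell k) x) powr q * norm x powr \<gamma>)"
  let ?E = "\<lambda>x. ennreal (norm x powr - ?n) * epowr (weighted_modulus \<tau> f x) q * indicator (dyadic_shell k) x"
  have L: "shell_Lq_norm q \<gamma> f k = epowr (\<integral>\<^sup>+x. ?L x \<partial>lborel) (1 / q)"
    by (simp add: Lq_norm_def power_weight_def nn_integral_completion)
  have E: "enorm (shell_measure k) q (weighted_modulus \<tau> f) = epowr (\<integral>\<^sup>+x. ?E x \<partial>lborel) (1 / q)"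
    unfolding enorm_def by (subst nn_integral_shell_measure) auto
  have Eeq: "?E x = ennreal ((norm x powr a) powr q) * ?L x" for x
  proof (cases "x \<in> dyadic_shell k")
    case True
    have \<tau>q: "\<tau> * q = a * q + \<gamma> + ?n" using q by (simp add: \<tau> field_simps)
    have "norm x powr - ?n * (norm (f x) * norm x powr \<tau>) powr q = (norm x powr a) powr q * (norm (f x) powr q * norm x powr \<gamma>)"
      using q dyadic_shell_nonzero[OF True]
      by (simp add: powr_mult powr_powr \<tau>q powr_add powr_minus field_simps)
    then show ?thesis using True
      by (simp add: weighted_modulus_def epowr_ennreal flip: ennreal_mult)
  qed (use q in simp)
  have "(\<integral>\<^sup>+x. ?E x \<partial>lborel) \<le> (\<integral>\<^sup>+x. ennreal ((2 powr (\<bar>a\<bar> + k * a)) powr q) * ?L x \<partial>lborel)"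
  proof (intro nn_integral_mono)
    fix x
    show "?E x \<le> ennreal ((2 powr (\<bar>a\<bar> + k * a)) powr q) * ?L x"
    proof (cases "x \<in> dyadic_shell k")
      case True
      show ?thesis unfolding Eeq using q norm_powr_dyadic_shell(1)[OF True, of a]
        by (intro mult_right_mono ennreal_leI powr_mono2) auto
    qed (use q in simp)
  qed
  also have "\<dots> = ennreal ((2 powr (\<bar>a\<bar> + k * a)) powr q) * (\<integral>\<^sup>+x. ?L x \<partial>lborel)"
    by (rule nn_integral_cmult) measurable
  finally have "epowr (\<integral>\<^sup>+x. ?E x \<partial>lborel) (1 / q) \<le> epowr (ennreal ((2 powr (\<bar>a\<bar> + k * a)) powr q) * (\<integral>\<^sup>+x. ?L x \<partial>lborel)) (1 / q)"
    using q by (intro epowr_mono) auto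
  then show ?le1 using q
    by (simp add: L E epowr_mult epowr_ennreal powr_powr powr_add ennreal_mult mult.assoc)
  have "ennreal ((2 powr (k * a)) powr q) * (\<integral>\<^sup>+x. ?L x \<partial>lborel) = (\<integral>\<^sup>+x. ennreal ((2 powr (k * a)) powr q) * ?L x \<partial>lborel)"
    by (rule nn_integral_cmult[symmetric]) measurable
  also have "\<dots> \<le> (\<integral>\<^sup>+x. ennreal ((2 powr \<bar>a\<bar>) powr q) * ?E x \<partial>lborel)"
  proof (intro nn_integral_mono)
    fix x
    show "ennreal ((2 powr (k * a)) powr q) * ?L x \<le> ennreal ((2 powr \<bar>a\<bar>) powr q) * ?E x"
    proof (cases "x \<in> dyadic_shell k")
      case True
      have "(2 powr (k * a)) powr q \<le> (2 powr \<bar>a\<bar> * norm x powr a) powr q"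
        using q norm_powr_dyadic_shell(2)[OF True, of a] by (intro powr_mono2) auto
      then have "ennreal ((2 powr (k * a)) powr q) \<le> ennreal ((2 powr \<bar>a\<bar>) powr q) * ennreal ((norm x powr a) powr q)"
        by (simp add: powr_mult flip: ennreal_mult)
      then show ?thesis unfolding Eeq mult.assoc[symmetric] by (rule mult_right_mono) simp
    qed (use q in simp)
  qed
  also have "\<dots> = ennreal ((2 powr \<bar>a\<bar>) powr q) * (\<integral>\<^sup>+x. ?E x \<partial>lborel)"
    by (rule nn_integral_cmult) measurable
  finally have "epowr (ennreal ((2 powr (k * a)) powr q) * (\<integral>\<^sup>+x. ?L x \<partial>lborel)) (1 / q)
      \<le> epowr (ennreal ((2 powr \<bar>a\<bar>) powr q) * (\<integral>\<^sup>+x. ?E x \<partial>lborel)) (1 / q)"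
    using q by (intro epowr_mono) auto
  then show ?le2 using q
    by (simp add: L E epowr_mult epowr_ennreal powr_powr mult.assoc)
qed

lemma MK_norm_equiv_herz_norm:
  fixes \<alpha> \<beta> \<gamma> \<mu> p q :: real
  assumes \<beta>: "\<beta> > - real CARD('n)" and p: "0 < p" and q: "0 < q"
    and l: "l = (1 + \<beta> / real CARD('n)) * \<mu>"
    and \<tau>: "\<tau> = (1 + \<beta> / real CARD('n)) * \<alpha> + (real CARD('n) + \<gamma>) / q"
  obtains C where "0 < C"
    "\<And>f :: real ^ 'n \<Rightarrow> complex. f \<in> borel_measurable borel \<Longrightarrow>
       MK_norm \<alpha> \<mu> p q (power_weight \<beta>) (power_weight \<gamma>) f \<le> ennreal C * herz_norm l p q (weighted_modulus \<tau> f)"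
    "\<And>f :: real ^ 'n \<Rightarrow> complex. f \<in> borel_measurable borel \<Longrightarrow>
       herz_norm l p q (weighted_modulus \<tau> f) \<le> ennreal C * MK_norm \<alpha> \<mu> p q (power_weight \<beta>) (power_weight \<gamma>) f"
proof -
  let ?n = "real CARD('n)"
  define a where "a = (1 + \<beta> / ?n) * \<alpha>"
  obtain c where c: "0 < c" "\<And>k. weight_measure (power_weight \<beta>) (dyadic_ball k :: (real ^ 'n) set) = c * 2 powr (k * (?n + \<beta>))"
    using weight_measure_power_weight[OF \<beta>] by blast
  \<comment> \<open>With v(B_k) = c 2^(k (n + \<beta>)), the weights become v(B_k)^(\<alpha>/n) = d
    2^(k a) and v(B_k)^(-\<mu>/n) = e 2^(-l k). Thus \<open>d\<close> and \<open>e\<close> collect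
    what does not depend on \<open>k\<close>.\<close>
  define d where "d = c powr (\<alpha> / ?n)"
  define e where "e = c powr (- \<mu> / ?n)"
  have de: "0 < d" "0 < e" using c(1) by (simp_all add: d_def e_def)
  have v1: "(c * 2 powr (k * (?n + \<beta>))) powr (- \<mu> / ?n) = e * 2 powr (- l * k)" for k
    using c(1) by (simp add: powr_mult powr_powr e_def l field_simps)
  have v2: "(c * 2 powr (k * (?n + \<beta>))) powr (\<alpha> * p / ?n) = (d * 2 powr (k * a)) powr p" for k
    using c(1) by (simp add: powr_mult powr_powr d_def a_def field_simps)
  have MK: "MK_norm \<alpha> \<mu> p q (power_weight \<beta>) (power_weight \<gamma>) f =
      (SUP k0. ennreal e * (ennreal (2 powr (- l * k0)) *
         (ennreal d * enorm (count_space {..k0}) p (\<lambda>k. ennreal (2 powr (k * a)) * shell_Lq_norm q \<gamma> f k))))"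
    for f :: "real ^ 'n \<Rightarrow> complex"
    unfolding MK_norm_def
  proof (intro SUP_cong refl)
    fix k0 :: int
    have "(\<Sum>\<^sub>\<infinity>k\<in>{..k0}. ennreal (weight_measure (power_weight \<beta>) (dyadic_ball k :: (real ^ 'n) set) powr (\<alpha> * p / ?n)) *
          epowr (shell_Lq_norm q \<gamma> f k) p) = (\<integral>\<^sup>+k. epowr (ennreal d * (ennreal (2 powr (k * a)) * shell_Lq_norm q \<gamma> f k)) p \<partial>count_space {..k0})"
      unfolding infsum_ennreal_atMost_int c v2 using de
      by (intro nn_integral_cong) (simp add: epowr_mult epowr_ennreal powr_mult ennreal_mult mult.assoc)
    then have "epowr (\<Sum>\<^sub>\<infinity>k\<in>{..k0}. ennreal (weight_measure (power_weight \<beta>) (dyadic_ball k :: (real ^ 'n) set) powr (\<alpha> * p / ?n)) *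
          epowr (shell_Lq_norm q \<gamma> f k) p) (1 / p) = ennreal d * enorm (count_space {..k0}) p (\<lambda>k. ennreal (2 powr (k * a)) * shell_Lq_norm q \<gamma> f k)"
      using p by (subst enorm_cmult[symmetric]) (auto simp: enorm_def)
    then show "ennreal (weight_measure (power_weight \<beta>) (dyadic_ball k0 :: (real ^ 'n) set) powr (- \<mu> / ?n)) *
       epowr (\<Sum>\<^sub>\<infinity>k\<in>{..k0}. ennreal (weight_measure (power_weight \<beta>) (dyadic_ball k :: (real ^ 'n) set) powr (\<alpha> * p / ?n)) *
          epowr (shell_Lq_norm q \<gamma> f k) p) (1 / p)
      = ennreal e * (ennreal (2 powr (- l * k0)) *
         (ennreal d * enorm (count_space {..k0}) p (\<lambda>k. ennreal (2 powr (k * a)) * shell_Lq_norm q \<gamma> f k)))"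
      unfolding c v1 using de by (simp add: ennreal_mult mult.assoc)
  qed
  have MK: "MK_norm \<alpha> \<mu> p q (power_weight \<beta>) (power_weight \<gamma>) f = ennreal (d * e) *
      (SUP k0. ennreal (2 powr (- l * k0)) * enorm (count_space {..k0}) p (\<lambda>k. ennreal (2 powr (k * a)) * shell_Lq_norm q \<gamma> f k))"
    for f :: "real ^ 'n \<Rightarrow> complex"
    unfolding MK using de by (simp add: SUP_mult_left_ennreal ennreal_mult mult_ac)
  define C1 where "C1 = 2 powr \<bar>a\<bar>"
  have C1: "0 < C1" by (simp add: C1_def)
  have le1: "(SUP k0. ennreal (2 powr (- l * k0)) * enorm (count_space {..k0}) p (\<lambda>k. ennreal (2 powr (k * a)) * shell_Lq_norm q \<gamma> f k))
      \<le> ennreal C1 * herz_norm l p q (weighted_modulus \<tau> f)" if [measurable]: "f \<in> borel_measurable borel" for f :: "real ^ 'n \<Rightarrow> complex"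
  proof (rule SUP_least)
    fix k0 :: int
    have "enorm (count_space {..k0}) p (\<lambda>k. ennreal (2 powr (k * a)) * shell_Lq_norm q \<gamma> f k)
      \<le> enorm (count_space {..k0}) p (\<lambda>k. ennreal C1 * enorm (shell_measure k) q (weighted_modulus \<tau> f))"
      unfolding C1_def using p q \<tau> by (intro enorm_mono shell_Lq_norm_equiv) (auto simp: a_def)
    also have "\<dots> = ennreal C1 * enorm (count_space {..k0}) p (\<lambda>k. enorm (shell_measure k) q (weighted_modulus \<tau> f))"
      using p by (intro enorm_cmult) auto
    finally have "ennreal (2 powr (- l * k0)) * enorm (count_space {..k0}) p (\<lambda>k. ennreal (2 powr (k * a)) * shell_Lq_norm q \<gamma> f k)
      \<le> ennreal (2 powr (- l * k0)) * (ennreal C1 * enorm (count_space {..k0}) p (\<lambda>k. enorm (shell_measure k) q (weighted_modulus \<tau> f)))"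
      by (rule mult_left_mono) simp
    also have "\<dots> = ennreal C1 * block_norm l p q k0 (weighted_modulus \<tau> f)"
      by (simp add: block_norm_def mult_ac)
    also have "\<dots> \<le> ennreal C1 * herz_norm l p q (weighted_modulus \<tau> f)"
      by (intro mult_left_mono block_norm_le_herz_norm) simp
    finally show "ennreal (2 powr (- l * k0)) * enorm (count_space {..k0}) p (\<lambda>k. ennreal (2 powr (k * a)) * shell_Lq_norm q \<gamma> f k)
      \<le> ennreal C1 * herz_norm l p q (weighted_modulus \<tau> f)" .
  qed
  have le2: "herz_norm l p q (weighted_modulus \<tau> f) \<le> ennreal C1 *
      (SUP k0. ennreal (2 powr (- l * k0)) * enorm (count_space {..k0}) p (\<lambda>k. ennreal (2 powr (k * a)) * shell_Lq_norm q \<gamma> f k))"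
    if [measurable]: "f \<in> borel_measurable borel" for f :: "real ^ 'n \<Rightarrow> complex"
    unfolding SUP_mult_left_ennreal herz_norm_def
  proof (intro SUP_mono')
    fix k0 :: int
    have "enorm (count_space {..k0}) p (\<lambda>k. enorm (shell_measure k) q (weighted_modulus \<tau> f))
      \<le> enorm (count_space {..k0}) p (\<lambda>k. ennreal C1 * (ennreal (2 powr (k * a)) * shell_Lq_norm q \<gamma> f k))"
      unfolding C1_def using p q \<tau> by (intro enorm_mono shell_Lq_norm_equiv) (auto simp: a_def)
    also have "\<dots> = ennreal C1 * enorm (count_space {..k0}) p (\<lambda>k. ennreal (2 powr (k * a)) * shell_Lq_norm q \<gamma> f k)"
      using p by (intro enorm_cmult) auto
    finally have "block_norm l p q k0 (weighted_modulus \<tau> f) \<le> ennreal (2 powr (- l * k0)) *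
        (ennreal C1 * enorm (count_space {..k0}) p (\<lambda>k. ennreal (2 powr (k * a)) * shell_Lq_norm q \<gamma> f k))"
      unfolding block_norm_def by (rule mult_left_mono) simp
    then show "block_norm l p q k0 (weighted_modulus \<tau> f) \<le> ennreal C1 * (ennreal (2 powr (- l * k0)) *
        enorm (count_space {..k0}) p (\<lambda>k. ennreal (2 powr (k * a)) * shell_Lq_norm q \<gamma> f k))"
      by (simp add: mult_ac)
  qed
  \<comment> \<open>The first entry serves the bound of \<open>MK_norm\<close> by
    \<open>herz_norm\<close>, the second one the converse bound.\<close>
  define C where "C = max (d * e * C1) (C1 / (d * e))"
  show thesis
  proof (rule that[of C])
    show "0 < C" using de C1 by (simp add: C_def less_max_iff_disj)
    fix f :: "real ^ 'n \<Rightarrow> complex" assume f: "f \<in> borel_measurable borel"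
    have "MK_norm \<alpha> \<mu> p q (power_weight \<beta>) (power_weight \<gamma>) f \<le> ennreal (d * e) * (ennreal C1 * herz_norm l p q (weighted_modulus \<tau> f))"
      unfolding MK by (intro mult_left_mono le1 f) simp
    also have "\<dots> = ennreal (d * e * C1) * herz_norm l p q (weighted_modulus \<tau> f)"
      using de C1 by (simp add: ennreal_mult mult_ac)
    also have "\<dots> \<le> ennreal C * herz_norm l p q (weighted_modulus \<tau> f)"
      by (intro mult_right_mono ennreal_leI) (auto simp: C_def)
    finally show "MK_norm \<alpha> \<mu> p q (power_weight \<beta>) (power_weight \<gamma>) f \<le> ennreal C * herz_norm l p q (weighted_modulus \<tau> f)" .
    have "herz_norm l p q (weighted_modulus \<tau> f) \<le> ennreal (C1 / (d * e) * (d * e)) *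
      (SUP k0. ennreal (2 powr (- l * k0)) * enorm (count_space {..k0}) p (\<lambda>k. ennreal (2 powr (k * a)) * shell_Lq_norm q \<gamma> f k))"
      using le2[OF f] de by simp
    also have "\<dots> = ennreal (C1 / (d * e)) * MK_norm \<alpha> \<mu> p q (power_weight \<beta>) (power_weight \<gamma>) f"
      unfolding MK using de C1 by (subst ennreal_mult) (auto simp: mult.assoc)
    also have "\<dots> \<le> ennreal C * MK_norm \<alpha> \<mu> p q (power_weight \<beta>) (power_weight \<gamma>) f"
      by (intro mult_right_mono ennreal_leI) (auto simp: C_def)
    finally show "herz_norm l p q (weighted_modulus \<tau> f) \<le> ennreal C * MK_norm \<alpha> \<mu> p q (power_weight \<beta>) (power_weight \<gamma>) f" .
  qed
qed

section \<open>Representatives of functions and membership in the space\<close>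

lemma MK_norm_cong_AE:
  assumes "AE x in lebesgue. f x = g x"
  shows "MK_norm \<alpha> \<mu> p q v \<omega> f = MK_norm \<alpha> \<mu> p q v \<omega> g"
proof -
  have "Lq_norm q \<omega> (\<lambda>x. f x * indicator (dyadic_shell k) x) = Lq_norm q \<omega> (\<lambda>x. g x * indicator (dyadic_shell k) x)" for k
    unfolding Lq_norm_def using assms
    by (intro arg_cong[where f="\<lambda>z. epowr z _"] nn_integral_cong_AE) (auto elim!: eventually_mono)
  then show ?thesis by (simp add: MK_norm_def)
qed

text \<open>Elements of the spaces are only Lebesgue measurable, whereas the unweighted norms and
  the composition with matrices call for Borel functions. Real and imaginary parts are modified
  separately.\<close>

lemma lebesgue_measurable_complex_borel_ex:
  fixes f :: "'a::euclidean_space \<Rightarrow> complex"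
  assumes "f \<in> borel_measurable lebesgue"
  obtains g where "g \<in> borel_measurable borel" "AE x in lebesgue. f x = g x"
proof -
  have "(\<lambda>x. Re (f x)) \<in> borel_measurable lebesgue" "(\<lambda>x. Im (f x)) \<in> borel_measurable lebesgue"
    using assms by measurable
  from this[THEN completion_ex_borel_measurable_real]
  obtain u v where uv: "u \<in> borel_measurable lborel" "AE x in lborel. Re (f x) = u x"
     "v \<in> borel_measurable lborel" "AE x in lborel. Im (f x) = v x"
    by blast
  show thesis
  proof (rule that[of "\<lambda>x. Complex (u x) (v x)"])
    have [measurable]: "u \<in> borel_measurable borel" "v \<in> borel_measurable borel" using uv by simp_all
    show "(\<lambda>x. Complex (u x) (v x)) \<in> borel_measurable borel"
      unfolding Complex_eq by measurable
    show "AE x in lebesgue. f x = Complex (u x) (v x)"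
      using uv(2,4) unfolding AE_completion_iff by eventually_elim (simp add: complex_eq_iff)
  qed
qed

text \<open>Finiteness of the norm makes the integral over every shell finite, and a compact set
  that avoids the origin meets only finitely many shells. So the integrability condition in the
  space comes for free.\<close>

lemma mem_MK_spaceI:
  fixes f :: "real ^ 'n \<Rightarrow> complex"
  assumes \<beta>: "\<beta> > - real CARD('n)" and pq: "0 < p" "0 < q" and f: "f \<in> borel_measurable lebesgue"
    and fin: "MK_norm \<alpha> \<mu> p q (power_weight \<beta>) (power_weight \<gamma>) f < top"
  shows "f \<in> fst (MK_space \<alpha> \<mu> p q (power_weight \<beta>) (power_weight \<gamma>))"
proof -
  obtain g where g: "g \<in> borel_measurable borel" "AE x in lebesgue. f x = g x"
    using lebesgue_measurable_complex_borel_ex[OF f] .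
  define a where "a = (1 + \<beta> / real CARD('n)) * \<alpha>"
  define \<tau> where "\<tau> = a + (real CARD('n) + \<gamma>) / q"
  obtain C where C: "herz_norm ((1 + \<beta> / real CARD('n)) * \<mu>) p q (weighted_modulus \<tau> g)
      \<le> ennreal C * MK_norm \<alpha> \<mu> p q (power_weight \<beta>) (power_weight \<gamma>) g"
    using MK_norm_equiv_herz_norm[OF \<beta> pq refl, of \<tau> \<alpha> \<gamma>] g(1) unfolding \<tau>_def a_def by metis
  have herz: "herz_norm ((1 + \<beta> / real CARD('n)) * \<mu>) p q (weighted_modulus \<tau> g) < top"
    using C fin by (intro le_less_trans[OF C]) (simp add: MK_norm_cong_AE[OF g(2)] ennreal_mult_less_top)
  let ?L = "\<lambda>k x. ennreal (norm (f x * indicator (dyadic_shell k) x) powr q * power_weight \<gamma> x)"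
  have L: "(\<integral>\<^sup>+x. ?L k x \<partial>lebesgue) < top" for k
  proof -
    have "ennreal (2 powr (k * a)) * shell_Lq_norm q \<gamma> g k \<le> ennreal (2 powr \<bar>a\<bar>) * enorm (shell_measure k) q (weighted_modulus \<tau> g)"
      using pq g(1) by (intro shell_Lq_norm_equiv) (auto simp: \<tau>_def)
    also have "\<dots> < top"
      using herz_norm_finite_imp_shell[OF pq(1) herz] by (simp add: ennreal_mult_less_top)
    finally have "shell_Lq_norm q \<gamma> g k < top" by (auto simp: ennreal_mult_less_top)
    moreover have "shell_Lq_norm q \<gamma> f k = shell_Lq_norm q \<gamma> g k"
      unfolding Lq_norm_def using g(2)
      by (intro arg_cong[where f="\<lambda>z. epowr z _"] nn_integral_cong_AE) (auto elim!: eventually_mono)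
    ultimately have "shell_Lq_norm q \<gamma> f k < top" by simp
    then show ?thesis by (simp add: Lq_norm_def)
  qed
  have "(\<integral>\<^sup>+x\<in>K. ennreal (norm (f x) powr q * power_weight \<gamma> x) \<partial>lebesgue) < top" if K: "compact K" "0 \<notin> K" for K
  proof -
    obtain M where M: "\<And>x. x \<in> K \<Longrightarrow> norm x \<le> M" using compact_imp_bounded[OF K(1)] bounded_iff by blast
    obtain r where r: "0 < r" "\<And>x. x \<in> K \<Longrightarrow> r \<le> norm x"
      using separate_point_closed[OF compact_imp_closed[OF K(1)] K(2)] by auto
    define J where "J = {\<lceil>log 2 r\<rceil>..\<lceil>log 2 M\<rceil>}"
    have pw [measurable]: "power_weight \<gamma> \<in> borel_measurable lebesgue"
      unfolding power_weight_def[abs_def] by (intro measurable_completion) measurable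
    have sh [measurable]: "dyadic_shell k \<in> sets lebesgue" for k
      using sets_dyadic(2)[of k] by simp
    have fm [measurable]: "f \<in> borel_measurable lebesgue" by fact
    have "(\<integral>\<^sup>+x\<in>K. ennreal (norm (f x) powr q * power_weight \<gamma> x) \<partial>lebesgue) \<le> (\<integral>\<^sup>+x. (\<Sum>k\<in>J. ?L k x) \<partial>lebesgue)"
    proof (intro nn_integral_mono)
      fix x :: "real ^ 'n"
      show "ennreal (norm (f x) powr q * power_weight \<gamma> x) * indicator K x \<le> (\<Sum>k\<in>J. ?L k x)"
      proof (cases "x \<in> K")
        case True
        define k where "k = \<lceil>log 2 (norm x)\<rceil>"
        have x: "0 < norm x" using r True by fastforce
        have "x \<in> dyadic_shell k" unfolding k_def using x by (intro ex_dyadic_shell) auto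
        have "log 2 r \<le> log 2 (norm x)" "log 2 (norm x) \<le> log 2 M" using r M True x by (auto intro: log_mono)
        then have "k \<in> J" unfolding k_def J_def by (auto intro: ceiling_mono)
        have "ennreal (norm (f x) powr q * power_weight \<gamma> x) * indicator K x = ?L k x"
          using True \<open>x \<in> dyadic_shell k\<close> by simp
        also have "\<dots> \<le> (\<Sum>k\<in>J. ?L k x)"
          using \<open>k \<in> J\<close> by (intro member_le_sum) (auto simp: J_def)
        finally show ?thesis .
      qed simp
    qed
    also have "\<dots> = (\<Sum>k\<in>J. \<integral>\<^sup>+x. ?L k x \<partial>lebesgue)"
      by (rule nn_integral_sum) measurable
    also have "\<dots> < top" using L by (simp add: J_def)
    finally show ?thesis .
  qed
  then show ?thesis using f fin by (simp add: MK_space_def)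
qed

text \<open>The norm of |x|^l on shell \<open>k\<close> is at most a constant times 2^(l k). For
  \<open>l > 0\<close> the l^p norm over \<open>k \<le> k0\<close> is a geometric series dominated
  by its last term 2^(l k0), which the factor 2^(-l k0) cancels. This is where positivity of the
  Morrey parameters enters.\<close>

lemma herz_norm_power:
  fixes l p q :: real
  assumes "0 < l" "0 < p" "0 < q"
  shows "herz_norm l p q (\<lambda>x :: real ^ 'n. ennreal (norm x powr l)) < top"
    and "0 < herz_norm l p q (\<lambda>x :: real ^ 'n. ennreal (norm x powr l))"
proof -
  let ?G = "\<lambda>x :: real ^ 'n. ennreal (norm x powr l)"
  define V where "V = epowr (ennreal (2 ^ CARD('n) * unit_ball_vol (real CARD('n)))) (1 / q)"
  have V: "V < top" by (simp add: V_def epowr_ennreal)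
  define S where "S = (\<integral>\<^sup>+j. ennreal ((2 powr (- l * p)) ^ j) \<partial>count_space UNIV)"
  have S: "S < top"
  proof -
    have "2 powr (- l * p) < 2 powr 0" using assms by (intro powr_less_mono) auto
    then have "summable (\<lambda>j. (2 powr (- l * p)) ^ j)" by (intro summable_geometric) auto
    then have "(\<Sum>j. ennreal ((2 powr (- l * p)) ^ j)) < top"
      by (intro suminf_ennreal2[THEN ord_eq_less_trans]) auto
    then show ?thesis unfolding S_def nn_integral_count_space_nat .
  qed
  have E: "enorm (shell_measure k) q ?G \<le> (ennreal (2 powr l) * V) * ennreal (2 powr (l * k))" for k
  proof -
    have "enorm (shell_measure k) q ?G \<le> enorm (shell_measure k) q (\<lambda>x::real ^ 'n. ennreal (2 powr (l + k * l)) * 1)"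
    proof (rule enorm_mono_AE[OF assms(3)])
      show "AE x in shell_measure k. ?G x \<le> ennreal (2 powr (l + k * l)) * 1"
        using AE_shell_measure by eventually_elim
          (use norm_powr_dyadic_shell(1)[of _ k l] assms in \<open>auto intro!: ennreal_leI\<close>)
    qed
    also have "\<dots> = ennreal (2 powr (l + k * l)) * enorm (shell_measure k) q (\<lambda>x::real ^ 'n. 1)"
      using assms by (intro enorm_cmult) auto
    also have "enorm (shell_measure k) q (\<lambda>x::real ^ 'n. 1) \<le> V"
      unfolding enorm_def V_def using assms emeasure_shell_measure_le[where 'n='n] by (intro epowr_mono) auto
    finally have "enorm (shell_measure k) q ?G \<le> ennreal (2 powr (l + k * l)) * V"
      by (simp add: mult_left_mono)
    then show ?thesis
      by (simp add: powr_add ennreal_mult mult_ac)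
  qed
  have "block_norm l p q k0 ?G \<le> ennreal (2 powr l) * V * epowr S (1 / p)" for k0
  proof -
    have "(\<integral>\<^sup>+k. epowr (ennreal (2 powr (l * k))) p \<partial>count_space {..k0})
        = (\<integral>\<^sup>+j. ennreal (2 powr (l * k0 * p)) * ennreal ((2 powr (- l * p)) ^ j) \<partial>count_space UNIV)"
    proof -
      \<comment> \<open>Counting downwards from \<open>k0\<close> by \<open>k = k0 - j\<close>
        exhibits the geometric series in \<open>j\<close>.\<close>
      have bij: "bij_betw (\<lambda>j. k0 - int j) UNIV {..k0}"
        by (rule bij_betwI[where g="\<lambda>k. nat (k0 - k)"]) auto
      show ?thesis
        unfolding nn_integral_bij_count_space[OF bij, symmetric]
        by (intro nn_integral_cong) (simp add: epowr_ennreal powr_powr powr_power algebra_simps flip: ennreal_mult powr_add)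
    qed
    also have "\<dots> = ennreal (2 powr (l * k0 * p)) * S"
      unfolding S_def by (rule nn_integral_cmult) simp
    finally have sum: "enorm (count_space {..k0}) p (\<lambda>k. ennreal (2 powr (l * k))) = ennreal (2 powr (l * k0)) * epowr S (1 / p)"
      unfolding enorm_def using assms by (simp add: epowr_mult epowr_ennreal powr_powr)
    have "enorm (count_space {..k0}) p (\<lambda>k. enorm (shell_measure k) q ?G)
        \<le> enorm (count_space {..k0}) p (\<lambda>k. (ennreal (2 powr l) * V) * ennreal (2 powr (l * k)))"
      using assms by (intro enorm_mono E) auto
    also have "\<dots> = (ennreal (2 powr l) * V) * (ennreal (2 powr (l * k0)) * epowr S (1 / p))"
      using assms by (subst enorm_cmult) (auto simp: sum)
    finally have "block_norm l p q k0 ?G \<le> ennreal (2 powr (- l * k0)) * ((ennreal (2 powr l) * V) * (ennreal (2 powr (l * k0)) * epowr S (1 / p)))"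
      unfolding block_norm_def by (rule mult_left_mono) simp
    also have "\<dots> = (ennreal (2 powr (- l * k0)) * ennreal (2 powr (l * k0))) * (ennreal (2 powr l) * V * epowr S (1 / p))"
      by (simp add: mult_ac)
    also have "ennreal (2 powr (- l * k0)) * ennreal (2 powr (l * k0)) = 1"
      by (simp flip: ennreal_mult powr_add)
    finally show ?thesis by simp
  qed
  then have "herz_norm l p q ?G \<le> ennreal (2 powr l) * V * epowr S (1 / p)"
    unfolding herz_norm_def by (rule SUP_least)
  also have "\<dots> < top" using V S by (auto simp: ennreal_mult_less_top less_top)
  finally show "herz_norm l p q ?G < top" .
  show "0 < herz_norm l p q ?G"
  proof (rule ccontr)
    assume "\<not> 0 < herz_norm l p q ?G"
    then have "herz_norm l p q ?G = 0" by simp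
    then have "enorm (shell_measure 0) q ?G = 0"
      using shell_le_herz_norm[OF assms(2), of l 0 q ?G] by simp
    then have "AE x :: real ^ 'n in shell_measure 0. ?G x = 0"
      using assms by (simp add: enorm_def nn_integral_0_iff_AE)
    then have "AE x :: real ^ 'n in lborel. x \<notin> dyadic_shell 0"
      unfolding AE_shell_measure_iff
      by eventually_elim (auto simp: ennreal_eq_0_iff dest: dyadic_shell_nonzero)
    then have null: "emeasure lborel (dyadic_shell 0 :: (real ^ 'n) set) = 0"
      by (subst (asm) AE_iff_measurable[of "dyadic_shell 0"]) auto
    \<comment> \<open>Shell 0 is 1/2 < |x| \<le> 1, so the ball of radius 1/4 about a point of norm
      3/4 fits inside it and shows that it is not a null set.\<close>
    obtain c :: "real ^ 'n" where c: "norm c = 3/4" using vector_choose_size[of "3/4"] by auto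
    have "ball c (1/4) \<subseteq> dyadic_shell 0"
    proof
      fix x assume "x \<in> ball c (1/4)"
      then have "norm (c - x) < 1/4" by (simp add: dist_norm)
      moreover have "norm c \<le> norm (c - x) + norm x" "norm x \<le> norm (c - x) + norm c"
        using norm_triangle_ineq[of "c - x" x] norm_triangle_ineq4[of c "c - x"] by auto
      ultimately show "x \<in> dyadic_shell 0"
        using c by (simp add: dyadic_shell_iff powr_minus)
    qed
    then have "emeasure lborel (ball c (1/4)) \<le> emeasure lborel (dyadic_shell 0 :: (real ^ 'n) set)"
      by (intro emeasure_mono) auto
    moreover have "\<not> unit_ball_vol (real CARD('n)) * (1 / 4) ^ CARD('n) \<le> 0" by (simp add: not_le)
    ultimately show False
      using null by (simp add: emeasure_ball ennreal_eq_0_iff)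
  qed
qed

section \<open>The Hausdorff operator\<close>

lemma prod_less_top_ennreal:
  fixes f :: "'i \<Rightarrow> ennreal"
  shows "(\<And>i. i \<in> I \<Longrightarrow> f i < top) \<Longrightarrow> prod f I < top"
  by (induction I rule: infinite_finite_induct) (auto simp: ennreal_mult_less_top)

text \<open>\<open>W\<close> will be the integrand of \<open>C3_const\<close>, for which no
  measurability is established. The constant is therefore pulled out of the integral of
  \<open>h / c\<close>, which is measurable and dominated by \<open>W\<close>.\<close>

lemma nn_integral_le_cmult:
  fixes c :: ennreal
  assumes [measurable]: "h \<in> borel_measurable M" and c: "c < top" and le: "AE y in M. h y \<le> c * W y"
  shows "(\<integral>\<^sup>+y. h y \<partial>M) \<le> c * (\<integral>\<^sup>+y. W y \<partial>M)"
proof (cases "c = 0")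
  case True
  then have "AE y in M. h y = 0" using le by simp
  then have "(\<integral>\<^sup>+y. h y \<partial>M) = 0" by (subst nn_integral_0_iff_AE) auto
  then show ?thesis by simp
next
  case False
  have hc: "h y = c * (h y / c)" for y
    using False c mult_divide_eq_ennreal[of c "h y"] by (simp add: ennreal_times_divide mult.commute)
  have "(\<integral>\<^sup>+y. h y \<partial>M) = (\<integral>\<^sup>+y. c * (h y / c) \<partial>M)" by (simp flip: hc)
  also have "\<dots> = c * (\<integral>\<^sup>+y. h y / c \<partial>M)" by (rule nn_integral_cmult) measurable
  also have "(\<integral>\<^sup>+y. h y / c \<partial>M) \<le> (\<integral>\<^sup>+y. W y \<partial>M)"
    using le by (intro nn_integral_mono_AE)
      (auto elim!: eventually_mono intro!: divide_le_posI_ennreal simp: False zero_less_iff_neq_zero)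
  finally show ?thesis by (simp add: mult_left_mono)
qed

section \<open>Absolute convergence and the central estimate\<close>

lemma AE_le_ess_rho:
  assumes "ess_rho m A = ereal \<rho>"
  shows "AE y in lebesgue. \<forall>i\<in>{1..m}. norm (A i y) * norm (matrix_inv (A i y)) \<le> \<rho>"
proof -
  have "AE y in lebesgue. (SUP i\<in>{1..m}. ereal (norm (A i y) * norm (matrix_inv (A i y)))) \<le> ereal \<rho>"
    using esssup_AE[of "\<lambda>y. SUP i\<in>{1..m}. ereal (norm (A i y) * norm (matrix_inv (A i y)))" lebesgue] assms
    by (simp add: ess_rho_def)
  then show ?thesis
    by eventually_elim (simp add: SUP_le_iff)
qed

text \<open>The function is the pointwise limit of its restrictions to the balls of radius
  \<open>j\<close>; at each point this sequence is eventually constant.\<close>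

lemma locally_integrable_imp_measurable:
  fixes \<Phi> :: "real ^ 'n \<Rightarrow> complex"
  assumes "locally_integrable \<Phi>"
  shows "\<Phi> \<in> borel_measurable lebesgue"
proof (rule borel_measurable_LIMSEQ_metric)
  fix j :: nat
  show "(\<lambda>x. indicator (cball 0 (real j)) x *\<^sub>R \<Phi> x) \<in> borel_measurable lebesgue"
    using assms unfolding locally_integrable_def set_integrable_def by (auto intro: borel_measurable_integrable)
next
  fix x :: "real ^ 'n"
  have "\<forall>\<^sub>F j in sequentially. indicator (cball 0 (real j)) x *\<^sub>R \<Phi> x = \<Phi> x"
    using eventually_ge_at_top[of "nat \<lceil>norm x\<rceil>"]
    by eventually_elim (auto simp: indicator_def)
  then show "(\<lambda>j. indicator (cball 0 (real j)) x *\<^sub>R \<Phi> x) \<longlonglongrightarrow> \<Phi> x"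
    by (rule tendsto_eventually)
qed

text \<open>A value in [0, \<infinity>] that is meaningful at every point. Estimating it first
  settles both questions at once: where it is finite the integral converges absolutely, and it
  dominates the modulus of the operator.\<close>

definition hausdorff_majorant ::
  "nat \<Rightarrow> (real ^ 'n \<Rightarrow> complex) \<Rightarrow> (nat \<Rightarrow> real ^ 'n \<Rightarrow> real ^ 'n ^ 'n) \<Rightarrow>
   (nat \<Rightarrow> real ^ 'n \<Rightarrow> complex) \<Rightarrow> real ^ 'n \<Rightarrow> ennreal" where
  "hausdorff_majorant m \<Phi> A f x = (\<integral>\<^sup>+y. ennreal (norm (hausdorff_integrand m \<Phi> A f x y)) \<partial>lebesgue)"

lemma norm_hausdorff_integrand:
  "norm (hausdorff_integrand m \<Phi> A f x y) =
    norm (\<Phi> y) / norm y ^ CARD('n) * (\<Prod>i\<in>{1..m}. norm (f i (A i y *v x)))"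
  for \<Phi> :: "real ^ 'n \<Rightarrow> complex"
  by (simp add: hausdorff_integrand_def norm_mult norm_divide prod_norm norm_power)

lemma measurable_matrix_family:
  fixes A :: "real ^ 'n \<Rightarrow> real ^ 'n ^ 'n"
  assumes [measurable]: "A \<in> borel_measurable lebesgue"
  shows "(\<lambda>(x, y). A y *v x) \<in> borel_measurable (borel \<Otimes>\<^sub>M lebesgue)"
  unfolding case_prod_beta' by measurable

text \<open>Each \<open>f i\<close> is taken to be Borel because it is composed with a map that is
  only Lebesgue measurable in \<open>y\<close>.\<close>

lemma measurable_hausdorff_integrand:
  fixes \<Phi> :: "real ^ 'n \<Rightarrow> complex"
  assumes [measurable]: "\<Phi> \<in> borel_measurable lebesgue"
    and A: "\<And>i. i \<in> {1..m} \<Longrightarrow> A i \<in> borel_measurable lebesgue"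
    and f: "\<And>i. i \<in> {1..m} \<Longrightarrow> f i \<in> borel_measurable borel"
  shows "(\<lambda>(x, y). hausdorff_integrand m \<Phi> A f x y) \<in> borel_measurable (borel \<Otimes>\<^sub>M lebesgue)"
proof -
  have [measurable]: "(\<lambda>p. f i (A i (snd p) *v fst p)) \<in> borel_measurable (borel \<Otimes>\<^sub>M lebesgue)" if "i \<in> {1..m}" for i
    using measurable_compose[OF measurable_matrix_family[OF A[OF that]] f[OF that]] by (simp add: case_prod_beta')
  have [measurable]: "(\<lambda>y. norm y) \<in> borel_measurable (lebesgue :: (real ^ 'n) measure)"
    by (intro measurable_completion) simp
  have [measurable]: "(\<lambda>y. complex_of_real (norm y ^ CARD('n))) \<in> borel_measurable (lebesgue :: (real ^ 'n) measure)"
    by measurable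
  show ?thesis unfolding hausdorff_integrand_def case_prod_beta' by measurable
qed

text \<open>The core of part (i). Minkowski's inequality moves the norm inside the integral over
  \<open>y\<close>. For fixed \<open>y\<close>, |x|^\<tau> is distributed over the factors as
  |x|^(\<tau>_i) and Hoelder's inequality separates them. With b_i the norm of the inverse of
  \<open>A i y\<close>, passing from |x| to |A_i x| costs b_i^(\<tau>_i) and the change of shells
  costs b_i^(-l_i). The constant is chosen before the kernel, the matrices and the
  functions.\<close>

lemma herz_norm_hausdorff_majorant_le:
  fixes l p q \<tau> R :: real and ls ps qs \<tau>s :: "nat \<Rightarrow> real"
  assumes pq: "1 \<le> p" "1 \<le> q" "\<And>i. i \<in> {1..m} \<Longrightarrow> 1 \<le> ps i" "\<And>i. i \<in> {1..m} \<Longrightarrow> 1 \<le> qs i"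
    and ls: "\<And>i. i \<in> {1..m} \<Longrightarrow> 0 < ls i"
    and sum: "(\<Sum>i\<in>{1..m}. 1 / ps i) = 1 / p" "(\<Sum>i\<in>{1..m}. 1 / qs i) = 1 / q"
      "(\<Sum>i\<in>{1..m}. ls i) = l" "(\<Sum>i\<in>{1..m}. \<tau>s i) = \<tau>"
    and R: "1 \<le> R"
  obtains K where "0 < K"
    "\<And>(\<Phi> :: real ^ 'n \<Rightarrow> complex) A g. \<Phi> \<in> borel_measurable lebesgue \<Longrightarrow>
      (\<And>i. i \<in> {1..m} \<Longrightarrow> A i \<in> borel_measurable lebesgue) \<Longrightarrow>
      (AE y in lebesgue. \<forall>i\<in>{1..m}. invertible (A i y) \<and> norm (A i y) * norm (matrix_inv (A i y)) \<le> R) \<Longrightarrow>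
      (\<And>i. i \<in> {1..m} \<Longrightarrow> g i \<in> borel_measurable borel) \<Longrightarrow>
      (\<And>i. i \<in> {1..m} \<Longrightarrow> herz_norm (ls i) (ps i) (qs i) (weighted_modulus (\<tau>s i) (g i)) < top) \<Longrightarrow>
      herz_norm l p q (\<lambda>x. hausdorff_majorant m \<Phi> A g x * ennreal (norm x powr \<tau>)) \<le>
        ennreal K * (\<Prod>i\<in>{1..m}. herz_norm (ls i) (ps i) (qs i) (weighted_modulus (\<tau>s i) (g i))) *
        (\<integral>\<^sup>+y. ennreal (norm (\<Phi> y) / norm y ^ CARD('n) *
           (\<Prod>i\<in>{1..m}. norm (matrix_inv (A i y)) powr (\<tau>s i - ls i))) \<partial>lebesgue)"
proof -
  let ?I = "{1..m}"
  have "\<forall>i\<in>?I. \<exists>D. 0 < D \<and> (\<forall>(A :: real ^ 'n ^ 'n) G k0. invertible A \<longrightarrow> norm A * norm (matrix_inv A) \<le> R \<longrightarrow> G \<in> borel_measurable borel \<longrightarrow>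
      block_norm (ls i) (ps i) (qs i) k0 (\<lambda>x. G (A *v x)) \<le> ennreal (D * norm (matrix_inv A) powr - ls i) * herz_norm (ls i) (ps i) (qs i) G)"
    (is "\<forall>i\<in>?I. \<exists>D. ?Q i D")
  proof
    fix i assume i: "i \<in> ?I"
    show "\<exists>D. ?Q i D"
      using block_norm_matrix_le[where 'n='n, OF R less_imp_le[OF ls[OF i]] pq(3)[OF i] pq(4)[OF i]] by metis
  qed
  then obtain D where D: "\<And>i. i \<in> ?I \<Longrightarrow> ?Q i (D i)" by metis
  have D0: "0 \<le> D i" if "i \<in> ?I" for i using D[OF that] by simp
  define K where "K = (\<Prod>i\<in>?I. R powr \<bar>\<tau>s i\<bar> * D i)"
  have K: "0 < K" unfolding K_def using D R by (intro prod_pos) auto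
  show thesis
  proof (rule that[OF K])
    fix \<Phi> :: "real ^ 'n \<Rightarrow> complex" and A :: "nat \<Rightarrow> real ^ 'n \<Rightarrow> real ^ 'n ^ 'n" and g :: "nat \<Rightarrow> real ^ 'n \<Rightarrow> complex"
    assume \<Phi> [measurable]: "\<Phi> \<in> borel_measurable lebesgue"
      and A: "\<And>i. i \<in> {1..m} \<Longrightarrow> A i \<in> borel_measurable lebesgue"
      and AE: "AE y in lebesgue. \<forall>i\<in>{1..m}. invertible (A i y) \<and> norm (A i y) * norm (matrix_inv (A i y)) \<le> R"
      and g: "\<And>i. i \<in> {1..m} \<Longrightarrow> g i \<in> borel_measurable borel"
      and fin: "\<And>i. i \<in> {1..m} \<Longrightarrow> herz_norm (ls i) (ps i) (qs i) (weighted_modulus (\<tau>s i) (g i)) < top"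
    let ?w = "\<lambda>y. norm (\<Phi> y) / norm y ^ CARD('n)"
    let ?h = "\<lambda>i. herz_norm (ls i) (ps i) (qs i) (weighted_modulus (\<tau>s i) (g i))"
    let ?b = "\<lambda>i y. norm (matrix_inv (A i y))"
    let ?W = "\<lambda>y. ennreal (?w y * (\<Prod>i\<in>?I. ?b i y powr (\<tau>s i - ls i)))"
    define F where "F x y = ennreal (norm (hausdorff_integrand m \<Phi> A g x y) * norm x powr \<tau>)" for x y
    note HI = measurable_hausdorff_integrand[OF \<Phi> A g, of m]
    have F: "case_prod F \<in> borel_measurable (borel \<Otimes>\<^sub>M lebesgue)"
    proof -
      have [measurable]: "(\<lambda>p. hausdorff_integrand m \<Phi> A g (fst p) (snd p)) \<in> borel_measurable (borel \<Otimes>\<^sub>M lebesgue)"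
        using HI by (simp add: case_prod_beta')
      show ?thesis unfolding F_def case_prod_beta' by measurable
    qed
    have GF: "hausdorff_majorant m \<Phi> A g x * ennreal (norm x powr \<tau>) = (\<integral>\<^sup>+y. F x y \<partial>lebesgue)" for x
    proof -
      have [measurable]: "(\<lambda>y. hausdorff_integrand m \<Phi> A g x y) \<in> borel_measurable lebesgue"
        using measurable_compose[OF _ HI, of "\<lambda>y. (x, y)" lebesgue] by simp
      show ?thesis
        unfolding hausdorff_majorant_def F_def
        by (subst nn_integral_multc[symmetric]) (auto simp: ennreal_mult)
    qed
    have pos: "0 < ps i" "0 < qs i" if "i \<in> ?I" for i using pq(3,4)[OF that] by auto
    have blk: "block_norm l p q k0 (\<lambda>x. F x y) \<le> (ennreal K * (\<Prod>i\<in>?I. ?h i)) * ?W y"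
      if y: "\<forall>i\<in>{1..m}. invertible (A i y) \<and> norm (A i y) * ?b i y \<le> R" for k0 y
    proof -
      have [measurable]: "(\<lambda>x. g i (A i y *v x)) \<in> borel_measurable borel" if "i \<in> ?I" for i
        using measurable_compose[OF _ g[OF that], of "\<lambda>x. A i y *v x" borel] by simp
      let ?H = "\<lambda>i x. ennreal (norm (g i (A i y *v x)) * norm x powr \<tau>s i)"
      have "block_norm l p q k0 (\<lambda>x. F x y) \<le> block_norm l p q k0 (\<lambda>x. ennreal (?w y) * (\<Prod>i\<in>?I. ?H i x))"
      proof (rule block_norm_mono)
        fix k
        show "AE x in shell_measure k. F x y \<le> ennreal (?w y) * (\<Prod>i\<in>?I. ?H i x)"
          using AE_shell_measure
        proof eventually_elim
          case (elim x)
          then have "norm x powr \<tau> = (\<Prod>i\<in>?I. norm x powr \<tau>s i)"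
            using dyadic_shell_nonzero[OF elim] by (simp add: powr_sum flip: sum(4))
          then show ?case
            by (simp add: F_def norm_hausdorff_integrand prod_ennreal prod_nonneg prod.distrib mult.assoc flip: ennreal_mult)
        qed
      qed (use pq in auto)
      also have "\<dots> = ennreal (?w y) * block_norm l p q k0 (\<lambda>x. \<Prod>i\<in>?I. ?H i x)"
        using pq by (intro block_norm_cmult) auto
      also have "block_norm l p q k0 (\<lambda>x. \<Prod>i\<in>?I. ?H i x) \<le> (\<Prod>i\<in>?I. block_norm (ls i) (ps i) (qs i) k0 (?H i))"
        using pq(1,2) by (intro block_norm_prod_le sum pos) auto
      also have "\<dots> \<le> (\<Prod>i\<in>?I. ennreal (R powr \<bar>\<tau>s i\<bar> * D i * ?b i y powr (\<tau>s i - ls i)) * ?h i)"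
      proof (intro prod_mono_ennreal)
        fix i assume i: "i \<in> ?I"
        then have yi: "invertible (A i y)" "norm (A i y) * ?b i y \<le> R" using y by auto
        note pqi = pq(3,4)[OF i]
        have "block_norm (ls i) (ps i) (qs i) k0 (?H i) \<le>
          block_norm (ls i) (ps i) (qs i) k0 (\<lambda>x. ennreal (R powr \<bar>\<tau>s i\<bar> * ?b i y powr \<tau>s i) * weighted_modulus (\<tau>s i) (g i) (A i y *v x))"
        proof (rule block_norm_mono)
          fix k
          show "AE x in shell_measure k. ?H i x \<le> ennreal (R powr \<bar>\<tau>s i\<bar> * ?b i y powr \<tau>s i) * weighted_modulus (\<tau>s i) (g i) (A i y *v x)"
            using AE_shell_measure
          proof eventually_elim
            case (elim x)
            have "norm (g i (A i y *v x)) * norm x powr \<tau>s i \<le>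
              norm (g i (A i y *v x)) * (R powr \<bar>\<tau>s i\<bar> * ?b i y powr \<tau>s i * norm (A i y *v x) powr \<tau>s i)"
              by (intro mult_left_mono norm_powr_le_matrix_vector_mult yi R dyadic_shell_nonzero[OF elim]) simp
            then show ?case
              unfolding weighted_modulus_def
              by (subst ennreal_mult[symmetric]) (auto intro!: ennreal_leI simp: mult_ac)
          qed
        qed (use pqi in auto)
        also have "\<dots> = ennreal (R powr \<bar>\<tau>s i\<bar> * ?b i y powr \<tau>s i) * block_norm (ls i) (ps i) (qs i) k0 (\<lambda>x. weighted_modulus (\<tau>s i) (g i) (A i y *v x))"
          using pqi measurable_compose[OF _ weighted_modulus_measurable[OF g[OF i]], of "\<lambda>x. A i y *v x" borel]
          by (intro block_norm_cmult) auto
        also have "\<dots> \<le> ennreal (R powr \<bar>\<tau>s i\<bar> * ?b i y powr \<tau>s i) * (ennreal (D i * ?b i y powr - ls i) * ?h i)"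
          using D[OF i] yi weighted_modulus_measurable[OF g[OF i]] by (intro mult_left_mono) auto
        also have "\<dots> = ennreal (R powr \<bar>\<tau>s i\<bar> * D i * ?b i y powr (\<tau>s i - ls i)) * ?h i"
        proof -
          have eq: "R powr \<bar>\<tau>s i\<bar> * D i * ?b i y powr (\<tau>s i - ls i) = (R powr \<bar>\<tau>s i\<bar> * ?b i y powr \<tau>s i) * (D i * ?b i y powr - ls i)"
            by (simp add: powr_diff powr_minus_divide)
          show ?thesis
            unfolding eq using D[OF i] by (subst ennreal_mult) (auto simp: mult.assoc)
        qed
        finally show "block_norm (ls i) (ps i) (qs i) k0 (?H i) \<le> ennreal (R powr \<bar>\<tau>s i\<bar> * D i * ?b i y powr (\<tau>s i - ls i)) * ?h i" .
      qed
      also have "\<dots> = (ennreal K * (\<Prod>i\<in>?I. ?h i)) * ennreal (\<Prod>i\<in>?I. ?b i y powr (\<tau>s i - ls i))"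
      proof -
        have "(\<Prod>i\<in>?I. ennreal (R powr \<bar>\<tau>s i\<bar> * D i * ?b i y powr (\<tau>s i - ls i))) = ennreal (K * (\<Prod>i\<in>?I. ?b i y powr (\<tau>s i - ls i)))"
          unfolding K_def prod.distrib[symmetric] by (intro prod_ennreal mult_nonneg_nonneg D0) auto
        then show ?thesis using K by (simp add: prod.distrib ennreal_mult prod_nonneg mult_ac)
      qed
      finally have "block_norm l p q k0 (\<lambda>x. F x y) \<le>
          ennreal (?w y) * ((ennreal K * (\<Prod>i\<in>?I. ?h i)) * ennreal (\<Prod>i\<in>?I. ?b i y powr (\<tau>s i - ls i)))"
        by (simp add: mult_left_mono)
      also have "\<dots> = (ennreal K * (\<Prod>i\<in>?I. ?h i)) * (ennreal (?w y) * ennreal (\<Prod>i\<in>?I. ?b i y powr (\<tau>s i - ls i)))"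
        by (rule mult.left_commute)
      also have "ennreal (?w y) * ennreal (\<Prod>i\<in>?I. ?b i y powr (\<tau>s i - ls i)) = ?W y"
        by (rule ennreal_mult[symmetric]) (auto intro: prod_nonneg)
      finally show ?thesis .
    qed
    \<comment> \<open>Finiteness of this factor is required by
      \<open>nn_integral_le_cmult\<close>.\<close>
    have cfin: "ennreal K * (\<Prod>i\<in>?I. ?h i) < top"
    proof -
      have "(\<Prod>i\<in>?I. ?h i) < top" by (rule prod_less_top_ennreal[OF fin])
      then show ?thesis by (simp add: ennreal_mult_less_top)
    qed
    show "herz_norm l p q (\<lambda>x. hausdorff_majorant m \<Phi> A g x * ennreal (norm x powr \<tau>)) \<le>
        ennreal K * (\<Prod>i\<in>{1..m}. ?h i) * (\<integral>\<^sup>+y. ?W y \<partial>lebesgue)"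
      unfolding GF herz_norm_def
    proof (rule SUP_least)
      fix k0
      have "block_norm l p q k0 (\<lambda>x. \<integral>\<^sup>+y. F x y \<partial>lebesgue) \<le> (\<integral>\<^sup>+y. block_norm l p q k0 (\<lambda>x. F x y) \<partial>lebesgue)"
        by (intro block_norm_nn_integral_le pq F sigma_finite_completion sigma_finite_lborel)
      also have "\<dots> \<le> ennreal K * (\<Prod>i\<in>{1..m}. ?h i) * (\<integral>\<^sup>+y. ?W y \<partial>lebesgue)"
      proof (intro nn_integral_le_cmult borel_measurable_block_norm F cfin)
        show "AE y in lebesgue. block_norm l p q k0 (\<lambda>x. F x y) \<le> ennreal K * (\<Prod>i\<in>{1..m}. ?h i) * ?W y"
          using AE by eventually_elim (rule blk)
      qed
      finally show "block_norm l p q k0 (\<lambda>x. \<integral>\<^sup>+y. F x y \<partial>lebesgue) \<le>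
         ennreal K * (\<Prod>i\<in>{1..m}. SUP k0. block_norm (ls i) (ps i) (qs i) k0 (weighted_modulus (\<tau>s i) (g i))) * (\<integral>\<^sup>+y. ?W y \<partial>lebesgue)"
        unfolding herz_norm_def .
    qed
  qed
qed

text \<open>For almost every fixed \<open>y\<close> the matrix is invertible, so the set of
  \<open>x\<close> that it maps into the exceptional null set is null. Fubini's theorem exchanges
  the order of the two quantifiers.\<close>

lemma AE_hausdorff_integrand_cong:
  fixes \<Phi> :: "real ^ 'n \<Rightarrow> complex"
  assumes A: "\<And>i. i \<in> {1..m} \<Longrightarrow> A i \<in> borel_measurable lebesgue"
    and inv: "\<And>i. i \<in> {1..m} \<Longrightarrow> AE y in lebesgue. invertible (A i y)"
    and fg: "\<And>i. i \<in> {1..m} \<Longrightarrow> AE x in lebesgue. f i x = g i x"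
  shows "AE x in lebesgue. AE y in lebesgue. hausdorff_integrand m \<Phi> A f x y = hausdorff_integrand m \<Phi> A g x y"
proof -
  interpret Y: sigma_finite_measure "lebesgue :: (real ^ 'n) measure"
    by (intro sigma_finite_completion sigma_finite_lborel)
  interpret P: pair_sigma_finite "lborel :: (real ^ 'n) measure" "lebesgue :: (real ^ 'n) measure" ..
  have "AE x in lebesgue. AE y in lebesgue. f i (A i y *v x) = g i (A i y *v x)" if i: "i \<in> {1..m}" for i
  proof -
    have "AE x in lborel. f i x = g i x" using fg[OF i] by (simp add: AE_completion_iff)
    \<comment> \<open>The exceptional set is enlarged to a Borel null set, so that its preimage in
      the product space is measurable.\<close>
    then obtain N where N: "{x. f i x \<noteq> g i x} \<subseteq> N" "N \<in> null_sets lborel"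
      by (auto elim!: AE_E simp: null_sets_def)
    have [measurable]: "N \<in> sets borel" using N by auto
    have [measurable]: "(\<lambda>p. A i (snd p) *v fst p) \<in> borel_measurable (lborel \<Otimes>\<^sub>M lebesgue)"
      using measurable_matrix_family[OF A[OF i]] by (simp add: case_prod_beta' cong: measurable_cong_sets sets_pair_measure_cong)
    have "AE x in lborel. AE y in lebesgue. A i y *v x \<notin> N"
    proof (subst P.AE_commute)
      show "{x \<in> space (lborel \<Otimes>\<^sub>M lebesgue). A i (snd x) *v fst x \<notin> N} \<in> sets (lborel \<Otimes>\<^sub>M lebesgue)"
        by measurable
      show "AE y in lebesgue. AE x in lborel. A i y *v x \<notin> N"
        using inv[OF i] by eventually_elim (rule AE_matrix_vector_mult[OF _ N(2)])
    qed
    then have "AE x in lborel. AE y in lebesgue. f i (A i y *v x) = g i (A i y *v x)"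
      by eventually_elim (use N(1) in \<open>auto elim!: eventually_mono\<close>)
    then show ?thesis by (simp add: AE_completion_iff)
  qed
  then have "AE x in lebesgue. \<forall>i\<in>{1..m}. AE y in lebesgue. f i (A i y *v x) = g i (A i y *v x)"
    by (subst AE_finite_all) auto
  then show ?thesis
  proof eventually_elim
    case (elim x)
    then have "AE y in lebesgue. \<forall>i\<in>{1..m}. f i (A i y *v x) = g i (A i y *v x)"
      by (subst AE_finite_all) auto
    then show ?case by eventually_elim (simp add: hausdorff_integrand_def)
  qed
qed

text \<open>Where the integrand is not integrable the Bochner integral has the default value 0, so
  the bound holds at every point.\<close>

lemma ennreal_norm_hausdorff_op_le:
  "ennreal (norm (hausdorff_op m \<Phi> A f x)) \<le> hausdorff_majorant m \<Phi> A f x"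
proof (cases "integrable lebesgue (hausdorff_integrand m \<Phi> A f x)")
  case True
  then show ?thesis unfolding hausdorff_op_def hausdorff_majorant_def by (rule integral_norm_bound_ennreal)
next
  case False
  then show ?thesis by (simp add: hausdorff_op_def not_integrable_integral_eq)
qed

text \<open>A finite norm forces finiteness almost everywhere on each shell, where |x|^\<tau> is
  positive. The countably many shells cover everything but the origin.\<close>

lemma AE_finite_of_herz_norm:
  fixes G :: "real ^ 'n \<Rightarrow> ennreal"
  assumes "0 < p" "0 < q" and [measurable]: "G \<in> borel_measurable borel"
    and fin: "herz_norm l p q (\<lambda>x. G x * ennreal (norm x powr \<tau>)) < top"
  shows "AE x in lebesgue. G x < top"
proof -
  have "AE x in lborel. x \<in> dyadic_shell k \<longrightarrow> G x < top" for k
  proof -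
    have "enorm (shell_measure k) q (\<lambda>x. G x * ennreal (norm x powr \<tau>)) < top"
      by (rule herz_norm_finite_imp_shell[OF assms(1) fin])
    then have "(\<integral>\<^sup>+x. epowr (G x * ennreal (norm x powr \<tau>)) q \<partial>shell_measure k) \<noteq> \<infinity>"
      by (simp add: enorm_def less_top)
    then have "AE x in shell_measure k. epowr (G x * ennreal (norm x powr \<tau>)) q \<noteq> \<infinity>"
      by (intro nn_integral_PInf_AE) measurable
    then show ?thesis
      unfolding AE_shell_measure_iff
      by eventually_elim (auto simp: ennreal_mult_eq_top_iff less_top ennreal_eq_0_iff dest: dyadic_shell_nonzero)
  qed
  then have "AE x in lborel. \<forall>k. x \<in> dyadic_shell k \<longrightarrow> G x < top"
    by (subst AE_all_countable) auto
  with AE_lborel_singleton[of 0] have "AE x in lborel. G x < top"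
    by eventually_elim (use ex_dyadic_shell in blast)
  then show ?thesis by (simp add: AE_completion_iff)
qed

text \<open>For nonnegative \<open>f i\<close> the integrand is its own modulus times a fixed sign
  \<open>s\<close>, so there is no cancellation in the integral.\<close>

lemma norm_hausdorff_op_constant_sign:
  fixes \<Phi> :: "real ^ 'n \<Rightarrow> complex"
  assumes "constant_sign \<Phi>" and int: "integrable lebesgue (hausdorff_integrand m \<Phi> A f x)"
    and f: "\<And>i z. i \<in> {1..m} \<Longrightarrow> f i z = complex_of_real (norm (f i z))"
  shows "ennreal (norm (hausdorff_op m \<Phi> A f x)) = hausdorff_majorant m \<Phi> A f x"
proof -
  obtain s :: complex where s: "norm s = 1" "\<And>y. \<Phi> y = s * complex_of_real (norm (\<Phi> y))"
  proof -
    have re: "\<Phi> y = complex_of_real (Re (\<Phi> y))" for y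
      using assms(1) by (auto simp: constant_sign_def elim: Reals_cases)
    have norm: "norm (\<Phi> y) = \<bar>Re (\<Phi> y)\<bar>" for y by (subst re) simp
    from assms(1) consider "\<And>y. 0 \<le> Re (\<Phi> y)" | "\<And>y. Re (\<Phi> y) \<le> 0"
      unfolding constant_sign_def by blast
    then show thesis
    proof cases
      case 1
      then have "\<Phi> y = 1 * complex_of_real (norm (\<Phi> y))" for y using re[of y] by (simp add: norm)
      then show thesis by (intro that[of 1]) simp_all
    next
      case 2
      then have "\<Phi> y = -1 * complex_of_real (norm (\<Phi> y))" for y using re[of y] by (simp add: norm)
      then show thesis by (intro that[of "-1"]) simp_all
    qed
  qed
  have eq: "hausdorff_integrand m \<Phi> A f x y = s * complex_of_real (norm (hausdorff_integrand m \<Phi> A f x y))" for y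
  proof -
    have "(\<Prod>i\<in>{1..m}. f i (A i y *v x)) = complex_of_real (\<Prod>i\<in>{1..m}. norm (f i (A i y *v x)))"
      unfolding of_real_prod using f by (intro prod.cong) auto
    then show ?thesis
      unfolding norm_hausdorff_integrand by (simp add: hausdorff_integrand_def s(2)[of y, symmetric] mult.assoc[symmetric])
  qed
  have "hausdorff_op m \<Phi> A f x = (LINT y|lebesgue. s * complex_of_real (norm (hausdorff_integrand m \<Phi> A f x y)))"
    unfolding hausdorff_op_def by (rule Bochner_Integration.integral_cong[OF refl eq])
  also have "\<dots> = s * complex_of_real (LINT y|lebesgue. norm (hausdorff_integrand m \<Phi> A f x y))"
    by simp
  finally have "norm (hausdorff_op m \<Phi> A f x) = (LINT y|lebesgue. norm (hausdorff_integrand m \<Phi> A f x y))"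
    using s(1) by (simp add: norm_mult)
  then show ?thesis
    unfolding hausdorff_majorant_def using int by (simp add: nn_integral_eq_integral)
qed

theorem theorem3p5:
  fixes m :: nat
    and \<alpha> \<beta> \<gamma> \<mu> p q \<rho> :: real
    and \<alpha>s \<beta>s \<gamma>s \<mu>s ps qs :: "nat \<Rightarrow> real"
    and X :: "nat \<Rightarrow> (real ^ 'n) fspace"
    and Y :: "(real ^ 'n) fspace"
  defines "X \<equiv> \<lambda>i. MK_space (\<alpha>s i) (\<mu>s i) (ps i) (qs i) (power_weight (\<beta>s i)) (power_weight (\<gamma>s i))"
    and "Y \<equiv> MK_space \<alpha> \<mu> p q (power_weight \<beta>) (power_weight \<gamma>)"
  assumes "m \<ge> 1"
    and "\<beta> > - real CARD('n)" and "\<gamma> > - real CARD('n)"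
    and "\<And>i. i \<in> {1..m} \<Longrightarrow> \<beta>s i > - real CARD('n)"
    and "\<And>i. i \<in> {1..m} \<Longrightarrow> \<gamma>s i > - real CARD('n)"
    and "p \<ge> 1" and "q \<ge> 1"
    and "\<And>i. i \<in> {1..m} \<Longrightarrow> ps i \<ge> 1"
    and "\<And>i. i \<in> {1..m} \<Longrightarrow> qs i \<ge> 1"
    and "(\<Sum>i\<in>{1..m}. 1 / ps i) = 1 / p"
    and "(\<Sum>i\<in>{1..m}. 1 / qs i) = 1 / q"
    and "\<And>i. i \<in> {1..m} \<Longrightarrow> \<mu>s i > 0"
    and "(\<Sum>i\<in>{1..m}. (1 + \<beta>s i / real CARD('n)) * \<mu>s i) = (1 + \<beta> / real CARD('n)) * \<mu>"
    and "(\<Sum>i\<in>{1..m}. \<gamma>s i / qs i) = \<gamma> / q"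
    and "(\<Sum>i\<in>{1..m}. (1 + \<beta>s i / real CARD('n)) * \<alpha>s i) = (1 + \<beta> / real CARD('n)) * \<alpha>"
  shows "(\<exists>K>0. \<forall>(\<Phi> :: real ^ 'n \<Rightarrow> complex) A.
            hausdorff_data m \<Phi> A \<and> ess_rho m A = ereal \<rho> \<and>
            C3_const m \<alpha>s \<mu>s qs \<beta>s \<gamma>s \<Phi> A < \<infinity> \<longrightarrow>
              hausdorff_bounded m X Y \<Phi> A \<and>
              hausdorff_norm m X Y \<Phi> A \<le> ennreal K * C3_const m \<alpha>s \<mu>s qs \<beta>s \<gamma>s \<Phi> A) \<and>
         (\<exists>K>0. \<forall>(\<Phi> :: real ^ 'n \<Rightarrow> complex) A.
            hausdorff_data m \<Phi> A \<and> ess_rho m A = ereal \<rho> \<and>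
            constant_sign \<Phi> \<and> hausdorff_bounded m X Y \<Phi> A \<longrightarrow>
              C3_const m \<alpha>s \<mu>s qs \<beta>s \<gamma>s \<Phi> A < \<infinity> \<and>
              C3_const m \<alpha>s \<mu>s qs \<beta>s \<gamma>s \<Phi> A \<le> ennreal K * hausdorff_norm m X Y \<Phi> A)"
proof -
  note m = assms(3) and \<beta> = assms(4) and \<beta>s = assms(6)
    and p = assms(8) and q = assms(9) and ps = assms(10) and qs = assms(11)
    and sum_p = assms(12) and sum_q = assms(13) and \<mu>s = assms(14) and sum_\<mu> = assms(15)
    and sum_\<gamma> = assms(16) and sum_\<alpha> = assms(17)
  let ?I = "{1..m}" and ?n = "real CARD('n)"
  have n: "0 < ?n" by simp
  define l where "l = (1 + \<beta> / ?n) * \<mu>"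
  define ls where "ls i = (1 + \<beta>s i / ?n) * \<mu>s i" for i
  define \<tau> where "\<tau> = (1 + \<beta> / ?n) * \<alpha> + (?n + \<gamma>) / q"
  define \<tau>s where "\<tau>s i = (1 + \<beta>s i / ?n) * \<alpha>s i + (?n + \<gamma>s i) / qs i" for i
  \<comment> \<open>The estimates for matrices ask for a bound that is at least 1.\<close>
  define R where "R = max 1 \<rho>"
  have R: "1 \<le> R" by (simp add: R_def)
  have ls: "0 < ls i" if "i \<in> ?I" for i
  proof -
    have "0 < 1 + \<beta>s i / ?n" using \<beta>s[OF that] n by (simp add: field_simps)
    then show ?thesis using \<mu>s[OF that] by (simp add: ls_def)
  qed
  have sum_l: "(\<Sum>i\<in>?I. ls i) = l" using sum_\<mu> by (simp add: ls_def l_def)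
  have l: "0 < l"
    unfolding sum_l[symmetric] using m ls by (intro sum_pos) auto
  have sum_\<tau>: "(\<Sum>i\<in>?I. \<tau>s i) = \<tau>"
  proof -
    have "(\<Sum>i\<in>?I. (?n + \<gamma>s i) / qs i) = ?n * (\<Sum>i\<in>?I. 1 / qs i) + (\<Sum>i\<in>?I. \<gamma>s i / qs i)"
      by (simp add: add_divide_distrib sum.distrib sum_distrib_left)
    also have "\<dots> = (?n + \<gamma>) / q"
      unfolding sum_q sum_\<gamma> by (simp add: add_divide_distrib)
    finally show ?thesis
      unfolding \<tau>s_def \<tau>_def sum.distrib sum_\<alpha> by simp
  qed
  have pos: "0 < ps i" "0 < qs i" if "i \<in> ?I" for i using ps[OF that] qs[OF that] by auto
  have exponent: "(1 + \<beta>s i / ?n) * (\<alpha>s i - \<mu>s i) + (?n + \<gamma>s i) / qs i = \<tau>s i - ls i" for i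
    by (simp add: \<tau>s_def ls_def right_diff_distrib)
  have C3: "C3_const m \<alpha>s \<mu>s qs \<beta>s \<gamma>s \<Phi> A = (\<integral>\<^sup>+y. ennreal (norm (\<Phi> y) / norm y ^ CARD('n) *
       (\<Prod>i\<in>?I. norm (matrix_inv (A i y)) powr (\<tau>s i - ls i))) \<partial>lebesgue)"
    for \<Phi> :: "real ^ 'n \<Rightarrow> complex" and A
    unfolding C3_const_def exponent ..
  let ?MK = "MK_norm \<alpha> \<mu> p q (power_weight \<beta>) (power_weight \<gamma>) :: (real ^ 'n \<Rightarrow> complex) \<Rightarrow> ennreal"
  let ?MKs = "\<lambda>i. MK_norm (\<alpha>s i) (\<mu>s i) (ps i) (qs i) (power_weight (\<beta>s i)) (power_weight (\<gamma>s i)) :: (real ^ 'n \<Rightarrow> complex) \<Rightarrow> ennreal"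
  have snd_X: "snd (X i) = ?MKs i" for i by (simp add: X_def MK_space_def)
  have snd_Y: "snd Y = ?MK" by (simp add: Y_def MK_space_def)
  obtain C where C: "0 < C"
    "\<And>f :: real ^ 'n \<Rightarrow> complex. f \<in> borel_measurable borel \<Longrightarrow> ?MK f \<le> ennreal C * herz_norm l p q (weighted_modulus \<tau> f)"
    "\<And>f :: real ^ 'n \<Rightarrow> complex. f \<in> borel_measurable borel \<Longrightarrow> herz_norm l p q (weighted_modulus \<tau> f) \<le> ennreal C * ?MK f"
    using p q by (rule_tac MK_norm_equiv_herz_norm[OF \<beta> _ _ l_def \<tau>_def]) auto
  have "\<forall>i\<in>?I. \<exists>C>0. \<forall>f :: real ^ 'n \<Rightarrow> complex. f \<in> borel_measurable borel \<longrightarrow>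
      ?MKs i f \<le> ennreal C * herz_norm (ls i) (ps i) (qs i) (weighted_modulus (\<tau>s i) f) \<and>
      herz_norm (ls i) (ps i) (qs i) (weighted_modulus (\<tau>s i) f) \<le> ennreal C * ?MKs i f"
    (is "\<forall>i\<in>?I. \<exists>C>0. ?Q i C")
  proof
    fix i assume i: "i \<in> ?I"
    show "\<exists>C>0. ?Q i C"
      using MK_norm_equiv_herz_norm[OF \<beta>s[OF i] pos(1)[OF i] pos(2)[OF i] ls_def \<tau>s_def] by metis
  qed
  then obtain Cs where Cs: "\<And>i. i \<in> ?I \<Longrightarrow> 0 < Cs i" "\<And>i. i \<in> ?I \<Longrightarrow> ?Q i (Cs i)" by metis
  obtain K where K: "0 < K"
    "\<And>(\<Phi> :: real ^ 'n \<Rightarrow> complex) A g. \<Phi> \<in> borel_measurable lebesgue \<Longrightarrow>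
      (\<And>i. i \<in> {1..m} \<Longrightarrow> A i \<in> borel_measurable lebesgue) \<Longrightarrow>
      (AE y in lebesgue. \<forall>i\<in>{1..m}. invertible (A i y) \<and> norm (A i y) * norm (matrix_inv (A i y)) \<le> R) \<Longrightarrow>
      (\<And>i. i \<in> {1..m} \<Longrightarrow> g i \<in> borel_measurable borel) \<Longrightarrow>
      (\<And>i. i \<in> {1..m} \<Longrightarrow> herz_norm (ls i) (ps i) (qs i) (weighted_modulus (\<tau>s i) (g i)) < top) \<Longrightarrow>
      herz_norm l p q (\<lambda>x. hausdorff_majorant m \<Phi> A g x * ennreal (norm x powr \<tau>)) \<le>
        ennreal K * (\<Prod>i\<in>{1..m}. herz_norm (ls i) (ps i) (qs i) (weighted_modulus (\<tau>s i) (g i))) *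
        C3_const m \<alpha>s \<mu>s qs \<beta>s \<gamma>s \<Phi> A"
    unfolding C3
    by (rule herz_norm_hausdorff_majorant_le[where 'n='n, OF p q ps qs ls sum_p sum_q sum_l sum_\<tau> R]) auto
  have data: "\<Phi> \<in> borel_measurable lebesgue" "\<And>i. i \<in> ?I \<Longrightarrow> A i \<in> borel_measurable lebesgue"
      "\<And>i. i \<in> ?I \<Longrightarrow> AE y in lebesgue. invertible (A i y)"
      "AE y in lebesgue. \<forall>i\<in>?I. invertible (A i y) \<and> norm (A i y) * norm (matrix_inv (A i y)) \<le> R"
    if "hausdorff_data m \<Phi> A" "ess_rho m A = ereal \<rho>" for \<Phi> :: "real ^ 'n \<Rightarrow> complex" and A
  proof -
    show "\<Phi> \<in> borel_measurable lebesgue" "\<And>i. i \<in> ?I \<Longrightarrow> A i \<in> borel_measurable lebesgue"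
      and inv: "\<And>i. i \<in> ?I \<Longrightarrow> AE y in lebesgue. invertible (A i y)"
      using that(1) locally_integrable_imp_measurable[of \<Phi>] by (auto simp: hausdorff_data_def)
    from inv have "AE y in lebesgue. \<forall>i\<in>?I. invertible (A i y)" by (subst AE_finite_all) auto
    with AE_le_ess_rho[OF that(2)]
    show "AE y in lebesgue. \<forall>i\<in>?I. invertible (A i y) \<and> norm (A i y) * norm (matrix_inv (A i y)) \<le> R"
      by eventually_elim (force simp: R_def)
  qed
  show ?thesis
  proof (intro conjI)

    \<comment> \<open>Upper bound: finiteness of the constant implies boundedness\<close>
    define K' where "K' = C * K * (\<Prod>i\<in>?I. Cs i)"
    have K': "0 < K'" using C(1) K(1) Cs(1) by (auto simp: K'_def intro!: mult_pos_pos prod_pos)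
    show "\<exists>K>0. \<forall>(\<Phi> :: real ^ 'n \<Rightarrow> complex) A.
            hausdorff_data m \<Phi> A \<and> ess_rho m A = ereal \<rho> \<and>
            C3_const m \<alpha>s \<mu>s qs \<beta>s \<gamma>s \<Phi> A < \<infinity> \<longrightarrow>
              hausdorff_bounded m X Y \<Phi> A \<and>
              hausdorff_norm m X Y \<Phi> A \<le> ennreal K * C3_const m \<alpha>s \<mu>s qs \<beta>s \<gamma>s \<Phi> A"
    proof (intro exI[of _ K'] conjI K' allI impI)
      fix \<Phi> :: "real ^ 'n \<Rightarrow> complex" and A
      assume asm: "hausdorff_data m \<Phi> A \<and> ess_rho m A = ereal \<rho> \<and> C3_const m \<alpha>s \<mu>s qs \<beta>s \<gamma>s \<Phi> A < \<infinity>"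
      define c where "c = enn2real (C3_const m \<alpha>s \<mu>s qs \<beta>s \<gamma>s \<Phi> A)"
      have c: "C3_const m \<alpha>s \<mu>s qs \<beta>s \<gamma>s \<Phi> A = ennreal c" "0 \<le> c" using asm by (auto simp: c_def less_top)
      note D = data[of \<Phi> A, OF conjunct1[OF asm] conjunct1[OF conjunct2[OF asm]]]
      \<comment> \<open>Admissibility of this one constant yields both boundedness and, as the
        operator norm is an infimum, the norm estimate.\<close>
      have bc: "K' * c \<in> bound_constants m X Y (hausdorff_defined m \<Phi> A) (hausdorff_op m \<Phi> A)"
        unfolding bound_constants_def
      proof (intro CollectI conjI allI impI)
        show "0 \<le> K' * c" using K' c(2) by simp
        fix f assume f: "\<forall>i\<in>{1..m}. f i \<in> fst (X i)"
        then have f_meas: "f i \<in> borel_measurable lebesgue" and f_fin: "?MKs i (f i) < top" if "i \<in> ?I" for i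
          using that by (auto simp: X_def MK_space_def)
        have "\<forall>i\<in>?I. \<exists>g. g \<in> borel_measurable borel \<and> (AE x in lebesgue. f i x = g x)"
          using lebesgue_measurable_complex_borel_ex[OF f_meas] by metis
        then obtain g where g: "\<And>i. i \<in> ?I \<Longrightarrow> g i \<in> borel_measurable borel"
            "\<And>i. i \<in> ?I \<Longrightarrow> AE x in lebesgue. f i x = g i x" by metis
        have MKfg: "?MKs i (g i) = ?MKs i (f i)" if "i \<in> ?I" for i
          using MK_norm_cong_AE[OF g(2)[OF that]] by metis
        have herz_g: "herz_norm (ls i) (ps i) (qs i) (weighted_modulus (\<tau>s i) (g i)) \<le> ennreal (Cs i) * ?MKs i (f i)" if "i \<in> ?I" for i
          using Cs(2)[OF that] g(1)[OF that] MKfg[OF that] by metis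
        have herz_g_fin: "herz_norm (ls i) (ps i) (qs i) (weighted_modulus (\<tau>s i) (g i)) < top" if "i \<in> ?I" for i
          using le_less_trans[OF herz_g[OF that]] f_fin[OF that] by (simp add: ennreal_mult_less_top)
        let ?G = "hausdorff_majorant m \<Phi> A g"
        have HI: "(\<lambda>(x, y). hausdorff_integrand m \<Phi> A g x y) \<in> borel_measurable (borel \<Otimes>\<^sub>M lebesgue)"
          by (rule measurable_hausdorff_integrand[OF D(1,2) g(1)])
        have HIx: "hausdorff_integrand m \<Phi> A g x \<in> borel_measurable lebesgue" for x
          using measurable_compose[OF _ HI, of "\<lambda>y. (x, y)" lebesgue] by simp
        interpret Y: sigma_finite_measure "lebesgue :: (real ^ 'n) measure"
          by (intro sigma_finite_completion sigma_finite_lborel)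
        have G [measurable]: "?G \<in> borel_measurable borel"
        proof -
          have "(\<lambda>(x, y). ennreal (norm (hausdorff_integrand m \<Phi> A g x y))) \<in> borel_measurable (borel \<Otimes>\<^sub>M lebesgue)"
            using measurable_compose[OF measurable_compose[OF HI borel_measurable_norm] measurable_ennreal]
            by (simp add: case_prod_beta')
          then show ?thesis unfolding hausdorff_majorant_def[abs_def] by (rule Y.borel_measurable_nn_integral)
        qed
        have t [measurable]: "hausdorff_op m \<Phi> A g \<in> borel_measurable borel"
          unfolding hausdorff_op_def[abs_def] by (rule Y.borel_measurable_lebesgue_integral[OF HI])
        have G_le: "herz_norm l p q (\<lambda>x. ?G x * ennreal (norm x powr \<tau>)) \<le>
            ennreal K * (\<Prod>i\<in>?I. ennreal (Cs i) * ?MKs i (f i)) * ennreal c"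
        proof -
          have "herz_norm l p q (\<lambda>x. ?G x * ennreal (norm x powr \<tau>)) \<le>
            ennreal K * (\<Prod>i\<in>{1..m}. herz_norm (ls i) (ps i) (qs i) (weighted_modulus (\<tau>s i) (g i))) * ennreal c"
            using K(2)[OF D(1,2,4) g(1) herz_g_fin] by (simp add: c)
          also have "\<dots> \<le> ennreal K * (\<Prod>i\<in>?I. ennreal (Cs i) * ?MKs i (f i)) * ennreal c"
            by (intro mult_right_mono mult_left_mono prod_mono_ennreal herz_g) auto
          finally show ?thesis .
        qed
        also have "\<dots> < top"
          using f_fin by (auto simp: ennreal_mult_less_top intro!: prod_less_top_ennreal)
        finally have "herz_norm l p q (\<lambda>x. ?G x * ennreal (norm x powr \<tau>)) < top" .
        \<comment> \<open>Finiteness of the majorant at almost every \<open>x\<close> is what makes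
          the operator well defined almost everywhere.\<close>
        then have G_fin: "AE x in lebesgue. ?G x < top"
          using p q by (intro AE_finite_of_herz_norm[of p q _ l \<tau>] G) auto
        have fg: "AE x in lebesgue. AE y in lebesgue. hausdorff_integrand m \<Phi> A f x y = hausdorff_integrand m \<Phi> A g x y"
          by (rule AE_hausdorff_integrand_cong[OF D(2,3) g(2)])
        \<comment> \<open>For almost every \<open>x\<close> the integrands of \<open>f\<close> and
          \<open>g\<close> agree for almost all \<open>y\<close>, so integrability and the value of
          the integral pass from the Borel representatives \<open>g\<close> to
          \<open>f\<close>.\<close>
        have good: "AE x in lebesgue. hausdorff_defined m \<Phi> A f x \<and> hausdorff_op m \<Phi> A g x = hausdorff_op m \<Phi> A f x"
          using G_fin fg
        proof eventually_elim
          case (elim x)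
          have eq: "AE y in lebesgue. hausdorff_integrand m \<Phi> A g x y = hausdorff_integrand m \<Phi> A f x y"
            using elim(2) by eventually_elim simp
          have f_m: "hausdorff_integrand m \<Phi> A f x \<in> borel_measurable lebesgue"
            by (rule borel_measurable_AE[OF HIx eq])
          have "integrable lebesgue (hausdorff_integrand m \<Phi> A g x)"
            using HIx elim(1) by (intro integrableI_bounded) (simp_all add: hausdorff_majorant_def)
          then have "hausdorff_defined m \<Phi> A f x"
            unfolding hausdorff_defined_def using f_m eq by (rule integrable_cong_AE_imp)
          moreover have "hausdorff_op m \<Phi> A g x = hausdorff_op m \<Phi> A f x"
            unfolding hausdorff_op_def by (rule integral_cong_AE[OF HIx f_m eq])
          ultimately show ?case by simp
        qed
        then show "AE x in lebesgue. hausdorff_defined m \<Phi> A f x" by eventually_elim simp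
        have op_eq: "AE x in lebesgue. hausdorff_op m \<Phi> A g x = hausdorff_op m \<Phi> A f x"
          using good by eventually_elim simp
        have "?MK (hausdorff_op m \<Phi> A f) = ?MK (hausdorff_op m \<Phi> A g)"
          using MK_norm_cong_AE[OF op_eq] by metis
        also have "\<dots> \<le> ennreal C * herz_norm l p q (weighted_modulus \<tau> (hausdorff_op m \<Phi> A g))"
          by (rule C(2)[OF t])
        also have "\<dots> \<le> ennreal C * herz_norm l p q (\<lambda>x. ?G x * ennreal (norm x powr \<tau>))"
          using p q ennreal_norm_hausdorff_op_le[of m \<Phi> A g]
          by (intro mult_left_mono herz_norm_mono) (auto simp: weighted_modulus_def ennreal_mult mult_right_mono)
        also have "\<dots> \<le> ennreal C * (ennreal K * (\<Prod>i\<in>?I. ennreal (Cs i) * ?MKs i (f i)) * ennreal c)"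
          by (intro mult_left_mono G_le) simp
        also have "\<dots> = ennreal (K' * c) * (\<Prod>i\<in>?I. ?MKs i (f i))"
        proof -
          have "ennreal (K' * c) = ennreal C * (ennreal K * (\<Prod>i\<in>?I. ennreal (Cs i)) * ennreal c)"
          proof -
            have "(\<Prod>i\<in>?I. ennreal (Cs i)) = ennreal (prod Cs ?I)" "0 \<le> prod Cs ?I"
              using less_imp_le[OF Cs(1)] by (auto intro!: prod_ennreal prod_nonneg)
            then show ?thesis
              using C(1) K(1) c(2) by (simp add: K'_def ennreal_mult mult.assoc)
          qed
          then show ?thesis by (simp add: prod.distrib mult_ac)
        qed
        finally have le: "?MK (hausdorff_op m \<Phi> A f) \<le> ennreal (K' * c) * (\<Prod>i\<in>?I. ?MKs i (f i))" .
        then show "snd Y (hausdorff_op m \<Phi> A f) \<le> ennreal (K' * c) * (\<Prod>i\<in>{1..m}. snd (X i) (f i))"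
          by (simp add: snd_X snd_Y)
        have "hausdorff_op m \<Phi> A f \<in> borel_measurable lebesgue"
          by (rule borel_measurable_AE[OF measurable_completion op_eq]) simp
        moreover have "?MK (hausdorff_op m \<Phi> A f) < top"
          using f_fin by (intro le_less_trans[OF le]) (auto simp: ennreal_mult_less_top intro!: prod_less_top_ennreal)
        ultimately show "hausdorff_op m \<Phi> A f \<in> fst Y"
          unfolding Y_def using p q by (intro mem_MK_spaceI \<beta>) auto
      qed
      then show "hausdorff_bounded m X Y \<Phi> A" by (auto simp: hausdorff_bounded_def)
      have "hausdorff_norm m X Y \<Phi> A \<le> ennreal (K' * c)"
        unfolding hausdorff_norm_def using bc by (intro Inf_lower) auto
      then show "hausdorff_norm m X Y \<Phi> A \<le> ennreal K' * C3_const m \<alpha>s \<mu>s qs \<beta>s \<gamma>s \<Phi> A"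
        using K' c by (simp add: ennreal_mult)
    qed
  next

    \<comment> \<open>Lower bound: testing the operator on powers\<close>
    define F where "F i x = complex_of_real (norm x powr (ls i - \<tau>s i))" for i and x :: "real ^ 'n"
    have F_meas: "F i \<in> borel_measurable borel" for i unfolding F_def[abs_def] by measurable
    \<comment> \<open>At the origin both sides vanish, since \<open>0 powr\<close> any exponent is
      0.\<close>
    have wm_F: "weighted_modulus (\<tau>s i) (F i) x = ennreal (norm x powr ls i)" for i x
      by (cases "x = 0") (auto simp: weighted_modulus_def F_def simp flip: powr_add)
    have F_fin: "?MKs i (F i) < top" if i: "i \<in> ?I" for i
    proof -
      have "herz_norm (ls i) (ps i) (qs i) (weighted_modulus (\<tau>s i) (F i)) < top"
        unfolding wm_F[abs_def] using herz_norm_power(1)[OF ls[OF i] pos[OF i]] by (simp add: wm_F[abs_def])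
      then show ?thesis
        using Cs(2)[OF i] F_meas[of i] by (auto intro: le_less_trans simp: ennreal_mult_less_top)
    qed
    have F_X: "F i \<in> fst (X i)" if i: "i \<in> ?I" for i
      unfolding X_def
      by (intro mem_MK_spaceI \<beta>s pos i F_fin measurable_completion) (simp add: F_meas)
    define P where "P = enn2real (\<Prod>i\<in>?I. ?MKs i (F i))"
    have P: "(\<Prod>i\<in>?I. ?MKs i (F i)) = ennreal P" "0 \<le> P"
      using prod_less_top_ennreal[of ?I "\<lambda>i. ?MKs i (F i)", OF F_fin] by (auto simp: P_def less_top)
    \<comment> \<open>The norm of |x|^l is positive and finite, so it can be divided out at the
      end.\<close>
    define h where "h = enn2real (herz_norm l p q (\<lambda>x :: real ^ 'n. ennreal (norm x powr l)))"
    have h: "herz_norm l p q (\<lambda>x :: real ^ 'n. ennreal (norm x powr l)) = ennreal h" "0 < h"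
      using herz_norm_power[of l p q, where 'n='n] l p q by (auto simp: h_def enn2real_positive_iff less_top)
    define \<kappa> where "\<kappa> = (\<Prod>i\<in>?I. R powr \<bar>ls i - \<tau>s i\<bar>)"
    have \<kappa>: "0 < \<kappa>" using R by (auto simp: \<kappa>_def intro!: prod_pos)
    \<comment> \<open>The summand 1 secures positivity without a proof that \<open>P\<close> is
      positive.\<close>
    define K' where "K' = \<kappa> * (C * P) / h + 1"
    have K': "0 < K'" using \<kappa> C(1) P(2) h(2) by (auto simp: K'_def intro!: add_nonneg_pos)
    show "\<exists>K>0. \<forall>(\<Phi> :: real ^ 'n \<Rightarrow> complex) A.
            hausdorff_data m \<Phi> A \<and> ess_rho m A = ereal \<rho> \<and>
            constant_sign \<Phi> \<and> hausdorff_bounded m X Y \<Phi> A \<longrightarrow>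
              C3_const m \<alpha>s \<mu>s qs \<beta>s \<gamma>s \<Phi> A < \<infinity> \<and>
              C3_const m \<alpha>s \<mu>s qs \<beta>s \<gamma>s \<Phi> A \<le> ennreal K * hausdorff_norm m X Y \<Phi> A"
    proof (intro exI[of _ K'] conjI[OF K'] allI impI)
      fix \<Phi> :: "real ^ 'n \<Rightarrow> complex" and A
      assume asm: "hausdorff_data m \<Phi> A \<and> ess_rho m A = ereal \<rho> \<and> constant_sign \<Phi> \<and> hausdorff_bounded m X Y \<Phi> A"
      note D = data[of \<Phi> A, OF conjunct1[OF asm] conjunct1[OF conjunct2[OF asm]]]
      let ?C3 = "C3_const m \<alpha>s \<mu>s qs \<beta>s \<gamma>s \<Phi> A"
      let ?T = "hausdorff_op m \<Phi> A F"
      \<comment> \<open>The comparison of |x| with |A_i x|, used with the exponents l_i - \<tau>_i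
        and multiplied over \<open>i\<close>, bounds the product in \<open>C3_const\<close> times
        |x|^(l - \<tau>) by \<kappa> times the product of the |F_i(A_i x)|. Integrating against
        |\<Phi>(y)| / |y|^n gives the claim, because the constant sign makes the integral of the
        modulus equal to the modulus of the integral.\<close>
      have lower: "?C3 * ennreal (norm x powr (l - \<tau>)) \<le> ennreal \<kappa> * ennreal (norm (?T x))"
        if x: "x \<noteq> 0" and def: "hausdorff_defined m \<Phi> A F x" for x
      proof -
        let ?H = "\<lambda>y. ennreal (norm (hausdorff_integrand m \<Phi> A F x y))"
        have int: "integrable lebesgue (hausdorff_integrand m \<Phi> A F x)"
          using def by (simp add: hausdorff_defined_def)
        note [measurable] = borel_measurable_integrable[OF int]
        define e where "e = norm x powr (l - \<tau>)"
        have e: "0 < e" using x by (simp add: e_def)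
        have e_prod: "e = (\<Prod>i\<in>?I. norm x powr (ls i - \<tau>s i))"
          unfolding e_def sum_l[symmetric] sum_\<tau>[symmetric] sum_subtractf[symmetric]
          using x by (intro powr_sum) auto
        have "?C3 \<le> ennreal (\<kappa> / e) * (\<integral>\<^sup>+y. ?H y \<partial>lebesgue)"
        proof -
          have "?C3 \<le> (\<integral>\<^sup>+y. ennreal (\<kappa> / e) * ?H y \<partial>lebesgue)"
            unfolding C3
          proof (intro nn_integral_mono_AE)
            show "AE y in lebesgue. ennreal (norm (\<Phi> y) / norm y ^ CARD('n) *
               (\<Prod>i\<in>?I. norm (matrix_inv (A i y)) powr (\<tau>s i - ls i))) \<le> ennreal (\<kappa> / e) * ?H y"
              using D(4)
            proof eventually_elim
              case (elim y)
              have "e * (\<Prod>i\<in>?I. norm (matrix_inv (A i y)) powr (\<tau>s i - ls i))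
                  = (\<Prod>i\<in>?I. norm x powr (ls i - \<tau>s i) * norm (matrix_inv (A i y)) powr (\<tau>s i - ls i))"
                by (simp add: e_prod prod.distrib)
              also have "\<dots> \<le> (\<Prod>i\<in>?I. R powr \<bar>ls i - \<tau>s i\<bar> * norm (F i (A i y *v x)))"
              proof (intro prod_mono conjI)
                fix i assume i: "i \<in> ?I"
                then have iy: "invertible (A i y)" "norm (A i y) * norm (matrix_inv (A i y)) \<le> R" using elim by auto
                have b: "0 < norm (matrix_inv (A i y))" by (rule invertible_imp_norm_bounds[OF iy(1)])
                have "norm x powr (ls i - \<tau>s i) * norm (matrix_inv (A i y)) powr (\<tau>s i - ls i) \<le>
                   (R powr \<bar>ls i - \<tau>s i\<bar> * norm (matrix_inv (A i y)) powr (ls i - \<tau>s i) * norm (A i y *v x) powr (ls i - \<tau>s i))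
                    * norm (matrix_inv (A i y)) powr (\<tau>s i - ls i)"
                  by (intro mult_right_mono norm_powr_le_matrix_vector_mult iy R x) simp
                also have "\<dots> = R powr \<bar>ls i - \<tau>s i\<bar> * norm (F i (A i y *v x)) *
                    (norm (matrix_inv (A i y)) powr (ls i - \<tau>s i) * norm (matrix_inv (A i y)) powr (\<tau>s i - ls i))"
                  by (simp add: F_def mult_ac)
                also have "norm (matrix_inv (A i y)) powr (ls i - \<tau>s i) * norm (matrix_inv (A i y)) powr (\<tau>s i - ls i) = 1"
                  using b by (simp flip: powr_add)
                finally show "norm x powr (ls i - \<tau>s i) * norm (matrix_inv (A i y)) powr (\<tau>s i - ls i)
                   \<le> R powr \<bar>ls i - \<tau>s i\<bar> * norm (F i (A i y *v x))" by simp
              qed simp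
              also have "\<dots> = \<kappa> * (\<Prod>i\<in>?I. norm (F i (A i y *v x)))"
                by (simp add: \<kappa>_def prod.distrib)
              finally have "(\<Prod>i\<in>?I. norm (matrix_inv (A i y)) powr (\<tau>s i - ls i)) \<le> \<kappa> / e * (\<Prod>i\<in>?I. norm (F i (A i y *v x)))"
                using e by (simp add: field_simps)
              then have "norm (\<Phi> y) / norm y ^ CARD('n) * (\<Prod>i\<in>?I. norm (matrix_inv (A i y)) powr (\<tau>s i - ls i))
                 \<le> norm (\<Phi> y) / norm y ^ CARD('n) * (\<kappa> / e * (\<Prod>i\<in>?I. norm (F i (A i y *v x))))"
                by (rule mult_left_mono) simp
              also have "\<dots> = \<kappa> / e * norm (hausdorff_integrand m \<Phi> A F x y)"
                by (simp add: norm_hausdorff_integrand mult_ac)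
              finally show ?case
                using e \<kappa> by (subst ennreal_mult[symmetric]) (auto intro: ennreal_leI)
            qed
          qed
          also have "\<dots> = ennreal (\<kappa> / e) * (\<integral>\<^sup>+y. ?H y \<partial>lebesgue)"
            by (rule nn_integral_cmult) measurable
          finally show ?thesis .
        qed
        also have "(\<integral>\<^sup>+y. ?H y \<partial>lebesgue) = ennreal (norm (?T x))"
          using norm_hausdorff_op_constant_sign[of \<Phi> m A F x] asm int
          by (simp add: hausdorff_majorant_def F_def)
        finally have "?C3 * ennreal e \<le> ennreal (\<kappa> / e) * ennreal (norm (?T x)) * ennreal e"
          by (rule mult_right_mono) simp
        also have "\<dots> = ennreal \<kappa> * ennreal (norm (?T x))"
          using e \<kappa> by (simp flip: ennreal_mult)
        finally show ?thesis by (simp add: e_def)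
      qed
      have bound: "?C3 < top \<and> ?C3 \<le> ennreal K' * ennreal B"
        if B: "B \<in> bound_constants m X Y (hausdorff_defined m \<Phi> A) (hausdorff_op m \<Phi> A)" for B
      proof -
        have B0: "0 \<le> B" and def: "AE x in lebesgue. hausdorff_defined m \<Phi> A F x"
          and TY: "?T \<in> fst Y" and le: "?MK ?T \<le> ennreal B * ennreal P"
          using B F_X unfolding bound_constants_def by (auto simp: snd_X snd_Y P(1)[symmetric])
        have "AE x in lebesgue. x \<noteq> (0 :: real ^ 'n)"
          using AE_lborel_singleton by (simp add: AE_completion_iff)
        with def have AE_low: "AE x in lebesgue. x \<noteq> 0 \<and> ?C3 * ennreal (norm x powr (l - \<tau>)) \<le> ennreal \<kappa> * ennreal (norm (?T x))"
          by eventually_elim (use lower in blast)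
        \<comment> \<open>A single nonzero point at which the lower bound holds suffices, since the
          value of the operator there is a finite number.\<close>
        have fin: "?C3 < top"
        proof -
          have "\<exists>x :: real ^ 'n. x \<noteq> 0 \<and> ?C3 * ennreal (norm x powr (l - \<tau>)) \<le> ennreal \<kappa> * ennreal (norm (?T x))"
          proof (rule ccontr)
            assume "\<not> ?thesis"
            with AE_low have "AE x in (lebesgue :: (real ^ 'n) measure). False" by (auto elim: eventually_mono)
            then have "emeasure lborel (UNIV :: (real ^ 'n) set) = 0"
              by (simp add: AE_completion_iff AE_iff_measurable[of UNIV])
            then show False by simp
          qed
          then obtain x :: "real ^ 'n" where x: "x \<noteq> 0" "?C3 * ennreal (norm x powr (l - \<tau>)) \<le> ennreal \<kappa> * ennreal (norm (?T x))"
            by blast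
          have "?C3 * ennreal (norm x powr (l - \<tau>)) < top"
            by (rule le_less_trans[OF x(2)]) (simp add: ennreal_mult_less_top)
          then show ?thesis using x(1) by (auto simp: ennreal_mult_less_top ennreal_eq_0_iff)
        qed
        have "?T \<in> borel_measurable lebesgue" using TY by (simp add: Y_def MK_space_def)
        then obtain t where t: "t \<in> borel_measurable borel" "AE x in lebesgue. ?T x = t x"
          by (rule lebesgue_measurable_complex_borel_ex)
        \<comment> \<open>Multiplied by |x|^\<tau>, the lower bound compares a multiple of |x|^l
          with the weighted modulus of the image. Taking unweighted norms then gives
          \<open>h\<close> times the constant on the left.\<close>
        have "AE x in lebesgue. ?C3 * ennreal (norm x powr l) \<le> ennreal \<kappa> * weighted_modulus \<tau> t x"
          using AE_low t(2)
        proof eventually_elim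
          case (elim x)
          have "?C3 * ennreal (norm x powr l) = ?C3 * ennreal (norm x powr (l - \<tau>)) * ennreal (norm x powr \<tau>)"
            by (simp add: mult.assoc flip: ennreal_mult powr_add)
          also have "\<dots> \<le> ennreal \<kappa> * ennreal (norm (?T x)) * ennreal (norm x powr \<tau>)"
            using elim(1) by (intro mult_right_mono) auto
          finally show ?case by (simp add: weighted_modulus_def elim(2) ennreal_mult mult.assoc)
        qed
        then have "AE x in lborel. ?C3 * ennreal (norm x powr l) \<le> ennreal \<kappa> * weighted_modulus \<tau> t x"
          by (simp add: AE_completion_iff)
        then have "herz_norm l p q (\<lambda>x :: real ^ 'n. ?C3 * ennreal (norm x powr l)) \<le> herz_norm l p q (\<lambda>x. ennreal \<kappa> * weighted_modulus \<tau> t x)"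
          using p q by (intro herz_norm_mono) (auto simp: AE_shell_measure_iff)
        moreover have "herz_norm l p q (\<lambda>x :: real ^ 'n. ?C3 * ennreal (norm x powr l)) = ?C3 * ennreal h"
          using p q by (subst herz_norm_cmult) (auto simp: h(1))
        moreover have "herz_norm l p q (\<lambda>x. ennreal \<kappa> * weighted_modulus \<tau> t x) = ennreal \<kappa> * herz_norm l p q (weighted_modulus \<tau> t)"
          using p q weighted_modulus_measurable[OF t(1)] by (intro herz_norm_cmult) auto
        ultimately have "?C3 * ennreal h \<le> ennreal \<kappa> * herz_norm l p q (weighted_modulus \<tau> t)" by simp
        also have "\<dots> \<le> ennreal \<kappa> * (ennreal C * ?MK t)"
          by (intro mult_left_mono C(3) t) simp
        also have "?MK t = ?MK ?T" using MK_norm_cong_AE[OF t(2)] by metis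
        also have "ennreal \<kappa> * (ennreal C * ?MK ?T) \<le> ennreal \<kappa> * (ennreal C * (ennreal B * ennreal P))"
          by (intro mult_left_mono le) auto
        also have "\<dots> = ennreal (\<kappa> * (C * (B * P)))"
          using \<kappa> C(1) B0 P(2) by (simp add: ennreal_mult)
        finally have le: "?C3 * ennreal h \<le> ennreal (\<kappa> * (C * (B * P)))" .
        obtain c where c: "?C3 = ennreal c" "0 \<le> c" using fin by (cases ?C3) auto
        have "c * h \<le> \<kappa> * (C * (B * P))"
          using le \<kappa> C(1) B0 P(2) h(2) c(2) by (simp add: c(1) flip: ennreal_mult)
        then have "c \<le> \<kappa> * (C * P) / h * B" using h(2) by (simp add: field_simps)
        also have "\<dots> \<le> K' * B" unfolding K'_def using B0 by (intro mult_right_mono) auto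
        finally show ?thesis
          using fin c K' B0 by (simp add: ennreal_leI flip: ennreal_mult)
      qed
      obtain B where "B \<in> bound_constants m X Y (hausdorff_defined m \<Phi> A) (hausdorff_op m \<Phi> A)"
        using asm unfolding hausdorff_bounded_def by blast
      then have "?C3 < \<infinity>" using bound by auto
      \<comment> \<open>The quotient is a lower bound of all admissible constants, hence of their
        infimum, the operator norm.\<close>
      moreover have "?C3 / ennreal K' \<le> hausdorff_norm m X Y \<Phi> A"
        unfolding hausdorff_norm_def using bound K'
        by (intro INF_greatest divide_le_posI_ennreal) auto
      then have "ennreal K' * (?C3 / ennreal K') \<le> ennreal K' * hausdorff_norm m X Y \<Phi> A"
        by (rule mult_left_mono) simp
      then have "?C3 \<le> ennreal K' * hausdorff_norm m X Y \<Phi> A"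
        using K' mult_divide_eq_ennreal[of "ennreal K'" ?C3]
        by (simp add: ennreal_times_divide mult.commute)
      ultimately show "?C3 < \<infinity> \<and> ?C3 \<le> ennreal K' * hausdorff_norm m X Y \<Phi> A" by simp
    qed
  qed
qed

end
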